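(* There is no $\frac{1}{4}$-homogeneous smooth fan.
   Context: All spaces are metric. A continuum is a compact connected metric space. A dendroid is an arcwise connected and hereditarily unicoherent continuum. In a dendroid $X$, for points $p,q \in X$, $pq$ denotes the unique arc in $X$ with endpoints $p$ and $q$ (with $pp=\{p\}$). A point $p$ of a dendroid $X$ has order $r$ (in the classical sense) if $p$ is a common endpoint of exactly $r$ arcs in $X$ which are disjoint from one another beyond $p$; a ramification point is a point of order greater than $2$ (possibly infinite). A fan is a dendroid with exactly one ramification point, called its top. A dendroid $X$ is smooth if there is a point $p \in X$ such that for each sequence $\{a_n\}_n$ of points of $X$ converging to a point $a \in X$, the arcs $pa_n$ converge to the arc $pa$ in the Hausdorff metric (in a smooth fan the top can always be used as $p$). A space $X$ is $\frac{1}{n}$-homogeneous if the action of the group of homeomorphisms of $X$ onto itself on $X$ has exactly $n$ orbits. *)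

theory Defs
  imports "HOL-Analysis.Analysis"
begin

text \<open>
  A metric space is rendered as a subset \<open>X\<close> of an arbitrary metric space type, with the
  restricted metric.
\<close>

definition continuum :: "'a::metric_space set \<Rightarrow> bool" where
  "continuum X \<longleftrightarrow> compact X \<and> connected X"

definition hereditarily_unicoherent :: "'a::metric_space set \<Rightarrow> bool" where
  "hereditarily_unicoherent X \<longleftrightarrow> (\<forall>Y. Y \<subseteq> X \<and> continuum Y \<longrightarrow> unicoherent Y)"

text \<open>
  An arc as a point set; the endpoints are necessarily distinct, since \<^const>\<open>arc\<close>
  demands injectivity.
\<close>

definition arc_joining :: "'a::metric_space \<Rightarrow> 'a \<Rightarrow> 'a set \<Rightarrow> bool" where
  "arc_joining p q A \<longleftrightarrow>
     (\<exists>g. arc g \<and> pathstart g = p \<and> pathfinish g = q \<and> path_image g = A)"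

definition arcwise_connected :: "'a::metric_space set \<Rightarrow> bool" where
  "arcwise_connected X \<longleftrightarrow>
     (\<forall>p\<in>X. \<forall>q\<in>X. p \<noteq> q \<longrightarrow> (\<exists>A. A \<subseteq> X \<and> arc_joining p q A))"

definition dendroid :: "'a::metric_space set \<Rightarrow> bool" where
  "dendroid X \<longleftrightarrow> continuum X \<and> arcwise_connected X \<and> hereditarily_unicoherent X"

text \<open>
  The arc \<open>pq\<close>. The description is meaningful for points of a dendroid, where the arc exists
  and is unique.
\<close>

definition the_arc :: "'a::metric_space set \<Rightarrow> 'a \<Rightarrow> 'a \<Rightarrow> 'a set" where
  "the_arc X p q = (if p = q then {p} else (THE A. A \<subseteq> X \<and> arc_joining p q A))"

definition arcs_disjoint_beyond :: "'a::metric_space set \<Rightarrow> 'a \<Rightarrow> 'a set set \<Rightarrow> bool" where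
  "arcs_disjoint_beyond X p F \<longleftrightarrow>
     (\<forall>A\<in>F. A \<subseteq> X \<and> (\<exists>q. arc_joining p q A)) \<and>
     (\<forall>A\<in>F. \<forall>B\<in>F. A \<noteq> B \<longrightarrow> A \<inter> B = {p})"

text \<open>
  ``Exactly \<open>r\<close> arcs'' means that \<open>r\<close> is the largest size of a family of arcs that share the
  endpoint \<open>p\<close> and are otherwise pairwise disjoint. The order is \<open>\<infinity>\<close> if there
  are arbitrarily large finite families; infinite cardinals are not distinguished.
\<close>

definition point_order :: "'a::metric_space set \<Rightarrow> 'a \<Rightarrow> enat" where
  "point_order X p = (SUP F \<in> {F. finite F \<and> arcs_disjoint_beyond X p F}. enat (card F))"

definition ramification_point :: "'a::metric_space set \<Rightarrow> 'a \<Rightarrow> bool" where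
  "ramification_point X p \<longleftrightarrow> p \<in> X \<and> point_order X p > 2"

definition fan :: "'a::metric_space set \<Rightarrow> bool" where
  "fan X \<longleftrightarrow> dendroid X \<and> (\<exists>!p. ramification_point X p)"

text \<open>Only used for nonempty compact sets, where both suprema are finite.\<close>

definition hausdorff_dist :: "'a::metric_space set \<Rightarrow> 'a set \<Rightarrow> real" where
  "hausdorff_dist A B = max (SUP a\<in>A. infdist a B) (SUP b\<in>B. infdist b A)"

definition smooth :: "'a::metric_space set \<Rightarrow> bool" where
  "smooth X \<longleftrightarrow>
     (\<exists>p\<in>X. \<forall>(a :: nat \<Rightarrow> 'a) l.
        (\<forall>n. a n \<in> X) \<and> l \<in> X \<and> a \<longlonglongrightarrow> l \<longrightarrow>
        (\<lambda>n. hausdorff_dist (the_arc X p (a n)) (the_arc X p l)) \<longlonglongrightarrow> 0)"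

definition homeo_orbit :: "'a::metric_space set \<Rightarrow> 'a \<Rightarrow> 'a set" where
  "homeo_orbit X x = {h x | h k. homeomorphism X X h k}"

text \<open>\<open>one_over_homogeneous n X\<close> says that \<open>X\<close> is $\frac{1}{n}$-homogeneous.\<close>

definition one_over_homogeneous :: "nat \<Rightarrow> 'a::metric_space set \<Rightarrow> bool" where
  "one_over_homogeneous n X \<longleftrightarrow>
     finite (homeo_orbit X ` X) \<and> card (homeo_orbit X ` X) = n"

end

(*
  Fix a smooth fan with top T and order it by x <= y iff x lies on the arc from T to y.  Every
  homeomorphism fixes T and preserves this order, so it preserves the set E of maximal points (the
  endpoints) and the set O of the remaining points.  If O were one orbit, so would be E, giving at
  most three orbits; hence four orbits force E to be one orbit and O to split into exactly two,
  both of which meet every leg.  Now closure E is invariant as well.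

  A smooth fan is a quotient of {(c, u). c : C, 0 <= u <= f c} for a zero-dimensional compact C and
  an upper semicontinuous f, with the fibre over u = 0 collapsed to T.
  - If closure E misses O, a piecewise linear stretching of the legs joins any two points of O on
    one leg by a homeomorphism.
  - If O is contained in closure E, the fan is the Lelek fan.  A back-and-forth argument over finite
    clopen partitions shows that any two such functions f, g are related by g (sigma c) =
    alpha c * f c; applied to f and to f after a homeomorphism of the height scale, this again joins
    any two points of O on a suitable leg.
  - Otherwise the two orbits in O are the points inside and outside closure E.  On each leg a point
    outside has a point of closure E strictly between it and the endpoint, and Baire's theorem,
    applied to the distance from the first such point to the endpoint, contradicts the
    definition of closure E.
*)
theory Submission
  imports Defs
begin

section \<open>Arcs in dendroids\<close>

text \<open>The obstacle is that \<open>f\<close> is only upper semicontinuous: legs near a given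
  one may be much shorter, so rescaling each leg by its own length need not be continuous. If no
  interior point is a limit of ends, this does no harm: along points whose heights tend to a
  positive limit, the leg lengths are forced to converge. In the Lelek case the homeomorphism
  multiplies heights by a continuous positive factor \<open>\<alpha>\<close> before undoing a change
  of the height scale, and such a factor is continuous whatever \<open>f\<close> does. It is the
  exponential of a uniform limit of log ratios of suprema over matched clopen blocks. Suprema are
  used because a semicontinuous function attains them and because they converge to its values on
  shrinking blocks. The leg chosen there has maximal height: that height is fixed by the scale
  change, so \<open>\<alpha> = 1\<close> on this leg and the scale change moves its points exactly
  as designed. Two preparations are needed: smoothness may be given at a point other than the top,
  and a compact space of legs must include limits of codes of vanishing legs, where \<open>f\<close>
  is 0.\<close>

lemma arc_connected_subset_eq:
  fixes g :: "real \<Rightarrow> 'a::t2_space"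
  assumes g: "arc g" and S: "connected S" "S \<subseteq> path_image g"
    and ends: "pathstart g \<in> S" "pathfinish g \<in> S"
  shows "S = path_image g"
proof -
  obtain k where hom: "homeomorphism {0..1} (path_image g) g k"
    using homeomorphism_arc[OF g] by blast
  have "connected (k ` S)"
    using S hom by (meson connected_continuous_image continuous_on_subset homeomorphism_cont2)
  moreover have "0 \<in> k ` S" "1 \<in> k ` S"
    using ends homeomorphism_apply1[OF hom, of 0] homeomorphism_apply1[OF hom, of 1]
    unfolding pathstart_def pathfinish_def by (metis atLeastAtMost_iff image_eqI order.refl zero_le_one)+
  ultimately have "{0..1} \<subseteq> k ` S"
    using connected_contains_Icc by blast
  then have "g ` {0..1} \<subseteq> g ` k ` S"
    by blast
  also have "g ` k ` S = S"
    using S homeomorphism_apply2[OF hom] by force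
  finally show ?thesis
    using S(2) by (auto simp: path_image_def)
qed

lemma arc_joining_continuum: "arc_joining p q A \<Longrightarrow> continuum A"
  unfolding arc_joining_def continuum_def
  using arc_imp_path compact_path_image connected_path_image by blast

lemma arc_joining_ends: "arc_joining p q A \<Longrightarrow> p \<in> A \<and> q \<in> A \<and> p \<noteq> q"
  unfolding arc_joining_def using arc_distinct_ends pathfinish_in_path_image pathstart_in_path_image
  by metis

lemma continuum_Un:
  assumes "continuum A" "continuum B" "A \<inter> B \<noteq> {}"
  shows "continuum (A \<union> B)"
  using assms unfolding continuum_def by (simp add: compact_Un connected_Un)

locale dendroid_set =
  fixes X :: "'a::metric_space set"
  assumes dendroid: "dendroid X"
begin

abbreviation seg :: "'a \<Rightarrow> 'a \<Rightarrow> 'a set" where "seg \<equiv> the_arc X"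

lemma compact_X: "compact X" and connected_X: "connected X"
  using dendroid by (auto simp: dendroid_def continuum_def)

text \<open>The union of two intersecting subcontinua is again a continuum, and its unicoherence
  says exactly that the two pieces meet in a connected set. Hereditary unicoherence enters
  here.\<close>

lemma connected_Int:
  assumes "continuum A" "continuum B" "A \<subseteq> X" "B \<subseteq> X"
  shows "connected (A \<inter> B)"
proof (cases "A \<inter> B = {}")
  case False
  then have "continuum (A \<union> B)"
    using assms continuum_Un by blast
  then have U: "unicoherent (A \<union> B)"
    using dendroid assms unfolding dendroid_def hereditarily_unicoherent_def by blast
  show ?thesis
    by (rule unicoherentD[OF U])
      (use assms in \<open>auto simp: continuum_def compact_imp_closed intro!: closed_subset\<close>)
qed auto

text \<open>The trace of \<open>K\<close> on the arc is connected and contains both endpoints, so it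
  is the whole arc. An arc is thus the least continuum through its endpoints, which makes it
  unique.\<close>

lemma arc_joining_subset:
  assumes A: "arc_joining p q A" "A \<subseteq> X" and K: "continuum K" "K \<subseteq> X" "p \<in> K" "q \<in> K"
  shows "A \<subseteq> K"
proof -
  obtain g where g: "arc g" "pathstart g = p" "pathfinish g = q" "path_image g = A"
    using A unfolding arc_joining_def by blast
  have "connected (A \<inter> K)"
    using assms connected_Int arc_joining_continuum by blast
  then have "A \<inter> K = path_image g"
    using g K arc_joining_ends[OF A(1)] by (intro arc_connected_subset_eq) auto
  then show ?thesis using g by auto
qed

lemma arc_joining_the_arc:
  assumes "arc_joining p q A" "A \<subseteq> X"
  shows "seg p q = A"
proof -
  have "p \<noteq> q" using assms arc_joining_ends by blast
  moreover have "(THE A. A \<subseteq> X \<and> arc_joining p q A) = A"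
    using assms arc_joining_subset arc_joining_continuum arc_joining_ends
    by (intro the_equality) (auto; blast)+
  ultimately show ?thesis by (simp add: the_arc_def)
qed

lemma the_arc_joining:
  assumes "p \<in> X" "q \<in> X" "p \<noteq> q"
  shows "arc_joining p q (seg p q)" "seg p q \<subseteq> X"
proof -
  obtain A where "A \<subseteq> X" "arc_joining p q A"
    using dendroid assms unfolding dendroid_def arcwise_connected_def by blast
  then show "arc_joining p q (seg p q)" "seg p q \<subseteq> X"
    using arc_joining_the_arc by auto
qed

lemma seg_refl [simp]: "seg p p = {p}"
  by (simp add: the_arc_def)

lemma seg_subset: "p \<in> X \<Longrightarrow> q \<in> X \<Longrightarrow> seg p q \<subseteq> X"
  using the_arc_joining(2) by (cases "p = q") auto

lemma seg_continuum: "p \<in> X \<Longrightarrow> q \<in> X \<Longrightarrow> continuum (seg p q)"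
  using the_arc_joining(1)[of p q] arc_joining_continuum[of p q]
  by (cases "p = q") (auto simp: continuum_def)

lemma seg_closed: "p \<in> X \<Longrightarrow> q \<in> X \<Longrightarrow> closed (seg p q)"
  using seg_continuum unfolding continuum_def by (simp add: compact_imp_closed)

lemma seg_compact: "p \<in> X \<Longrightarrow> q \<in> X \<Longrightarrow> compact (seg p q)"
  using seg_continuum unfolding continuum_def by simp

lemma seg_ends:
  assumes "p \<in> X" "q \<in> X"
  shows "p \<in> seg p q" "q \<in> seg p q"
  using the_arc_joining(1) arc_joining_ends assms by (cases "p = q"; fastforce)+

lemma seg_least:
  assumes "continuum K" "K \<subseteq> X" "p \<in> K" "q \<in> K"
  shows "seg p q \<subseteq> K"
  using arc_joining_subset the_arc_joining assms by (cases "p = q") (auto; blast)+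

lemma seg_commute: "p \<in> X \<Longrightarrow> q \<in> X \<Longrightarrow> seg p q = seg q p"
  by (meson seg_continuum seg_ends seg_least seg_subset subset_antisym)

lemma seg_triangle:
  assumes "x \<in> X" "y \<in> X" "z \<in> X"
  shows "seg x z \<subseteq> seg x y \<union> seg y z"
proof (rule seg_least)
  show "continuum (seg x y \<union> seg y z)"
    using assms by (intro continuum_Un) (auto simp: seg_continuum dest: seg_ends)
qed (use assms seg_subset seg_ends in auto)

lemma seg_arc:
  assumes g: "arc g" "path_image g \<subseteq> X" and su: "0 \<le> s" "s \<le> u" "u \<le> 1"
  shows "seg (g s) (g u) = g ` {s..u}"
proof (cases "s = u")
  case False
  define r where "r = (\<lambda>v::real. s + (u - s) * v)"
  have us: "0 < u - s" using su False by simp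
  have r01: "r ` {0..1} = {s..u}"
    unfolding r_def using us by (simp add: image_affinity_atLeastAtMost add.commute[of s])
  have sub: "{s..u} \<subseteq> {0..1}" using su by auto
  have "path (g \<circ> r)"
    unfolding path_def
  proof (rule continuous_on_compose)
    show "continuous_on {0..1} r" unfolding r_def by (intro continuous_intros)
    show "continuous_on (r ` {0..1}) g"
      unfolding r01 using g sub by (metis arc_imp_path continuous_on_subset path_def)
  qed
  moreover have "inj_on (g \<circ> r) {0..1}"
  proof (rule comp_inj_on)
    show "inj_on r {0..1}" unfolding r_def using us by (auto simp: inj_on_def)
    show "inj_on g (r ` {0..1})" unfolding r01 using g sub by (metis arc_def inj_on_subset)
  qed
  ultimately have "arc (g \<circ> r)" by (simp add: arc_def)
  moreover have "pathstart (g \<circ> r) = g s" "pathfinish (g \<circ> r) = g u"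
    by (auto simp: pathstart_def pathfinish_def r_def)
  moreover have "path_image (g \<circ> r) = g ` {s..u}"
    by (metis image_comp path_image_def r01)
  ultimately have "arc_joining (g s) (g u) (g ` {s..u})"
    unfolding arc_joining_def by blast
  moreover have "g ` {s..u} \<subseteq> X"
    using g su by (auto simp: path_image_def image_subset_iff)
  ultimately show ?thesis
    using arc_joining_the_arc by blast
qed auto

lemma seg_split:
  assumes "p \<in> X" "q \<in> X" "x \<in> seg p q"
  shows "seg p q = seg p x \<union> seg x q" "seg p x \<inter> seg x q = {x}"
proof -
  have "seg p q = seg p x \<union> seg x q \<and> seg p x \<inter> seg x q = {x}"
  proof (cases "p = q")
    case False
    then obtain g where g: "arc g" "pathstart g = p" "pathfinish g = q" "path_image g = seg p q"
      using the_arc_joining assms unfolding arc_joining_def by blast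
    have sub: "path_image g \<subseteq> X"
      using g seg_subset assms by auto
    obtain s where s: "0 \<le> s" "s \<le> 1" "x = g s"
      using assms(3) g(4) unfolding path_image_def by (metis atLeastAtMost_iff imageE)
    have 1: "seg p q = g ` {0..1}" "seg p x = g ` {0..s}" "seg x q = g ` {s..1}"
      using seg_arc[OF g(1) sub] s g by (auto simp: pathstart_def pathfinish_def)
    have inj: "inj_on g {0..1}"
      using g by (simp add: arc_def)
    have "g ` {0..s} \<inter> g ` {s..1} = g ` ({0..s} \<inter> {s..1})"
      by (rule inj_on_image_Int[OF inj, symmetric]) (use s in auto)
    also have "{0..s} \<inter> {s..1} = {s}"
      using s by auto
    moreover have "{0..1} = {0..s} \<union> {s..1}"
      using s by auto
    ultimately show ?thesis
      unfolding 1 using s by (auto simp flip: image_Un)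
  qed (use assms in auto)
  then show "seg p q = seg p x \<union> seg x q" "seg p x \<inter> seg x q = {x}"
    by blast+
qed

lemma seg_mono_right:
  assumes "p \<in> X" "q \<in> X" "x \<in> seg p q"
  shows "seg p x \<subseteq> seg p q"
  using seg_split(1)[OF assms] by blast

lemma seg_mono_left:
  assumes "p \<in> X" "q \<in> X" "x \<in> seg p q"
  shows "seg x q \<subseteq> seg p q"
  using seg_split(1)[OF assms] by blast

lemma seg_in_X: "p \<in> X \<Longrightarrow> q \<in> X \<Longrightarrow> x \<in> seg p q \<Longrightarrow> x \<in> X"
  using seg_subset by blast

lemma seg_trans:
  "p \<in> X \<Longrightarrow> z \<in> X \<Longrightarrow> y \<in> seg p z \<Longrightarrow> x \<in> seg p y \<Longrightarrow> x \<in> seg p z"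
  using seg_mono_right by blast

lemma seg_antisym:
  assumes "p \<in> X" "x \<in> X" "y \<in> X" "x \<in> seg p y" "y \<in> seg p x"
  shows "x = y"
proof -
  have "y \<in> seg p x \<inter> seg x y"
    using assms(2,3,5) by (simp add: seg_ends)
  then show ?thesis
    unfolding seg_split(2)[OF assms(1,3,4)] by simp
qed

text \<open>If neither held, splitting the arc at each point would put \<open>y\<close> between
  \<open>x\<close> and \<open>q\<close> and also \<open>x\<close> between \<open>y\<close> and
  \<open>q\<close>; antisymmetry of the order based at \<open>q\<close> would give
  \<open>x = y\<close>.\<close>

lemma seg_chain:
  assumes "p \<in> X" "q \<in> X" "x \<in> seg p q" "y \<in> seg p q"
  shows "x \<in> seg p y \<or> y \<in> seg p x"
proof (rule ccontr)
  assume n: "\<not> (x \<in> seg p y \<or> y \<in> seg p x)"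
  have X: "x \<in> X" "y \<in> X" using assms seg_in_X by blast+
  have "y \<in> seg x q" "x \<in> seg y q"
    using n seg_split(1)[OF assms(1,2,3)] seg_split(1)[OF assms(1,2,4)] assms by blast+
  then have "x = y"
    using seg_antisym[of q x y] X assms(2) seg_commute[of x q] seg_commute[of y q] by simp
  then show False using n X assms(1) seg_ends(2)[of p x] by simp
qed

lemma seg_between:
  assumes "p \<in> X" "q \<in> X" "y \<in> seg p q" "x \<in> seg p y"
  shows "y \<in> seg x q"
proof -
  have "y \<in> X" using assms(1-3) by (rule seg_in_X)
  moreover from this have "x \<in> X" using assms(1,4) seg_in_X[of p y x] by simp
  ultimately have X: "x \<in> X" "y \<in> X" by simp_all
  have x: "x \<in> seg p q" using assms seg_trans[of p q y x] by simp
  show ?thesis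
  proof (rule ccontr)
    assume "y \<notin> seg x q"
    then have "y \<in> seg p x" using seg_split(1)[OF assms(1,2) x] assms(3) by simp
    then have "x = y" using seg_antisym[of p x y] X assms by simp
    then show False using \<open>y \<notin> seg x q\<close> X assms(2) seg_ends(1)[of y q] by simp
  qed
qed

text \<open>The arc from \<open>p\<close> to \<open>q\<close> lies in the union of the two closed
  pieces. Avoiding their only common point \<open>r\<close> would disconnect it.\<close>

lemma seg_glue:
  assumes "p \<in> X" "q \<in> X" "r \<in> X" "seg p r \<inter> seg r q = {r}"
  shows "seg p q = seg p r \<union> seg r q" "r \<in> seg p q"
proof -
  have sub: "seg p q \<subseteq> seg p r \<union> seg r q"
    using seg_triangle[of p r q] assms(1-3) by simp
  have cl: "closed (seg p r)" "closed (seg r q)" and con: "connected (seg p q)"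
    using assms(1-3) seg_closed seg_continuum by (simp_all add: continuum_def)
  show r: "r \<in> seg p q"
  proof (rule ccontr)
    assume "r \<notin> seg p q"
    then have "seg p r \<inter> seg r q \<inter> seg p q = {}"
      using assms(4) by simp
    then have "seg p r \<inter> seg p q = {} \<or> seg r q \<inter> seg p q = {}"
      by (rule connected_closedD[OF con _ sub cl])
    moreover have "p \<in> seg p r" "p \<in> seg p q" "q \<in> seg r q" "q \<in> seg p q"
      using assms(1-3) by (simp_all add: seg_ends)
    ultimately show False
      by blast
  qed
  show "seg p q = seg p r \<union> seg r q"
    using seg_split(1)[OF assms(1,2) r] .
qed

end

section \<open>Fans and the order from the top\<close>

text \<open>A sequence of values staying away from \<open>f a\<close> would have a convergent
  subsequence in \<open>K\<close>, whose limit the closed graph identifies as \<open>f a\<close>.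
  Most continuity proofs below reduce to this criterion, since compactness supplies limits that only
  remain to be identified.\<close>

lemma continuous_on_compact_closed_graph:
  fixes f :: "'a::metric_space \<Rightarrow> 'b::metric_space"
  assumes K: "compact K" "f ` S \<subseteq> K"
    and cl: "\<And>z w l. \<lbrakk>\<And>n. z n \<in> S; z \<longlonglongrightarrow> w; w \<in> S; (\<lambda>n. f (z n)) \<longlonglongrightarrow> l\<rbrakk> \<Longrightarrow> l = f w"
  shows "continuous_on S f"
proof (rule continuous_on_sequentiallyI)
  fix u a assume u: "\<forall>n. u n \<in> S" "a \<in> S" "u \<longlonglongrightarrow> a"
  show "(\<lambda>n. f (u n)) \<longlonglongrightarrow> f a"
  proof (rule ccontr)
    assume "\<not> (\<lambda>n. f (u n)) \<longlonglongrightarrow> f a"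
    then obtain e where e: "e > 0" "\<not> (\<forall>\<^sub>F n in sequentially. dist (f (u n)) (f a) < e)"
      unfolding tendsto_iff by blast
    then have "infinite {n. e \<le> dist (f (u n)) (f a)}"
      unfolding cofinite_eq_sequentially[symmetric] eventually_cofinite by (simp add: not_less)
    then obtain r :: "nat \<Rightarrow> nat" where r: "strict_mono r" "\<And>n. e \<le> dist (f (u (r n))) (f a)"
      using infinite_enumerate by blast
    have "\<forall>n. f (u (r n)) \<in> K"
      using u K by auto
    then obtain l s where s: "strict_mono s" "((\<lambda>n. f (u (r n))) \<circ> s) \<longlonglongrightarrow> l"
      using K(1) unfolding compact_eq_seq_compact_metric by (metis seq_compactE)
    have "strict_mono (r \<circ> s)" using r s by (simp add: strict_mono_o)
    then have "(u \<circ> (r \<circ> s)) \<longlonglongrightarrow> a"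
      using u LIMSEQ_subseq_LIMSEQ by blast
    then have "l = f a"
      using u s by (intro cl[of "u \<circ> (r \<circ> s)" a l]) (auto simp: o_def)
    then have "(\<lambda>n. dist (f (u (r (s n)))) (f a)) \<longlonglongrightarrow> 0"
      using s(2) by (simp add: o_def tendsto_dist_iff[symmetric])
    then have "e \<le> 0"
      by (rule Lim_bounded2) (use r in auto)
    then show False using e by simp
  qed
qed

context dendroid_set
begin

lemma seg_between':
  assumes "p \<in> X" "q \<in> X" "y \<in> seg p q" "x \<in> seg y q"
  shows "y \<in> seg p x"
proof -
  have y: "y \<in> X" using seg_in_X[OF assms(1,2,3)] .
  have x: "x \<in> X" using seg_in_X[OF y assms(2,4)] .
  have "y \<in> seg q p" "x \<in> seg q y"
    using assms y seg_commute by blast+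
  then have "y \<in> seg x p"
    using seg_between[of q p y x] assms by simp
  then show ?thesis
    using seg_commute[of x p] assms x by simp
qed

text \<open>\<open>w\<close> is the last point of the arc from \<open>x\<close> to \<open>y\<close>
  that lies on the arc from \<open>x\<close> to \<open>z\<close>.\<close>

lemma seg_branch:
  assumes "x \<in> X" "y \<in> X" "z \<in> X"
  obtains w where "w \<in> X" "w \<in> seg x y" "w \<in> seg x z" "seg w y \<inter> seg w z = {w}"
proof (cases "x = y")
  case True
  then show ?thesis using that[of x] assms seg_ends[OF assms(1,3)] by auto
next
  case False
  then obtain g where g: "arc g" "pathstart g = x" "pathfinish g = y" "path_image g = seg x y"
    using the_arc_joining assms unfolding arc_joining_def by blast
  have sub: "path_image g \<subseteq> X"
    using g seg_subset assms by simp
  have cont: "continuous_on {0..1} g"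
    using g by (simp add: arc_def path_def)
  define S where "S = {0..1} \<inter> g -` seg x z"
  have "closed S"
    unfolding S_def using cont by (intro continuous_closed_preimage seg_closed assms) auto
  moreover have "bounded S"
    unfolding S_def by (rule bounded_subset[OF bounded_closed_interval[of 0 1]]) auto
  ultimately have "compact S" by (simp add: compact_eq_bounded_closed)
  moreover have "0 \<in> S"
    using g assms seg_ends by (auto simp: S_def pathstart_def)
  ultimately obtain s where s: "s \<in> S" "\<And>u. u \<in> S \<Longrightarrow> u \<le> s"
    using compact_attains_sup[of S] by blast
  have s01: "0 \<le> s" "s \<le> 1" and gz: "g s \<in> seg x z"
    using s by (auto simp: S_def)
  have gy: "g s \<in> seg x y"
    using s01 g(4) unfolding path_image_def by auto
  have segy: "seg (g s) y = g ` {s..1}"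
    using seg_arc[OF g(1) sub, of s 1] s01 g by (simp add: pathfinish_def)
  have gX: "g s \<in> X" using seg_in_X[OF assms(1,2) gy] .
  have "v = g s" if v: "v \<in> seg (g s) y" "v \<in> seg (g s) z" for v
  proof -
    obtain u where u: "s \<le> u" "u \<le> 1" "v = g u"
      using v(1) unfolding segy by auto
    have "v \<in> seg x z"
      using seg_mono_left[OF assms(1,3) gz] v(2) by blast
    then have "u \<in> S" using u s01 by (auto simp: S_def)
    then show ?thesis using s(2) u by force
  qed
  then have "seg (g s) y \<inter> seg (g s) z = {g s}"
    using seg_ends gX assms by blast
  then show ?thesis using that gX gy gz by blast
qed

lemma ramification_pointI:
  assumes "w \<in> X" "x \<in> X" "y \<in> X" "z \<in> X" "x \<noteq> w" "y \<noteq> w" "z \<noteq> w"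
    and "seg w x \<inter> seg w y = {w}" "seg w x \<inter> seg w z = {w}" "seg w y \<inter> seg w z = {w}"
  shows "ramification_point X w"
proof -
  define F where "F = {seg w x, seg w y, seg w z}"
  have ne: "seg w u \<noteq> {w}" if "u \<in> X" "u \<noteq> w" for u
    using seg_ends(2)[OF assms(1) that(1)] that by auto
  have d: "seg w x \<noteq> seg w y" "seg w x \<noteq> seg w z" "seg w y \<noteq> seg w z"
    using assms ne by auto
  have "arcs_disjoint_beyond X w F"
    unfolding arcs_disjoint_beyond_def F_def
    using the_arc_joining[OF assms(1)] assms by (auto simp: Int_commute)
  moreover have "finite F" "card F = 3"
    unfolding F_def using d by auto
  ultimately have "enat 3 \<le> point_order X w"
    unfolding point_order_def by (intro SUP_upper2[of F]) auto
  moreover have "(2::enat) < enat 3"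
    by (simp add: numeral_eq_enat)
  ultimately show ?thesis
    unfolding ramification_point_def using assms by (meson order_less_le_trans)
qed

end

locale fan_set = dendroid_set X for X :: "'a::metric_space set" +
  fixes T :: 'a
  assumes T_ramification: "ramification_point X T"
    and ramification_eq: "\<And>p. ramification_point X p \<Longrightarrow> p = T"
begin

lemma T_in [simp]: "T \<in> X"
  using T_ramification by (simp add: ramification_point_def)

text \<open>If the arcs from \<open>x\<close> to \<open>y\<close> and to \<open>z\<close> parted at
  a point \<open>w\<close> other than \<open>y\<close> and \<open>z\<close>, the arcs from
  \<open>w\<close> to \<open>T\<close>, \<open>y\<close> and \<open>z\<close> would make
  \<open>w\<close> a second ramification point. So the order from \<open>T\<close> does not branch
  upwards except at \<open>T\<close>.\<close>

lemma seg_T_directed: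
  assumes "x \<noteq> T" "y \<in> X" "z \<in> X" "x \<in> seg T y" "x \<in> seg T z"
  shows "y \<in> seg T z \<or> z \<in> seg T y"
proof -
  have x: "x \<in> X" using seg_in_X[OF T_in assms(2,4)] .
  obtain w where w: "w \<in> X" "w \<in> seg x y" "w \<in> seg x z" "seg w y \<inter> seg w z = {w}"
    using seg_branch[OF x assms(2,3)] .
  have wy: "w \<in> seg T y" and wz: "w \<in> seg T z"
    using seg_mono_left[OF T_in assms(2,4)] seg_mono_left[OF T_in assms(3,5)] w by auto
  have "w \<noteq> T"
  proof
    assume "w = T"
    then have "T \<in> seg T x \<inter> seg x y" using w x by (simp add: seg_ends)
    then show False using seg_split(2)[OF T_in assms(2,4)] assms(1) by simp
  qed
  have "w = y \<or> w = z"
  proof (rule ccontr)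
    assume n: "\<not> (w = y \<or> w = z)"
    have "seg w T \<inter> seg w y = {w}" "seg w T \<inter> seg w z = {w}"
      using seg_split(2)[OF T_in assms(2) wy] seg_split(2)[OF T_in assms(3) wz]
        seg_commute[OF w(1) T_in] by simp_all
    then have "ramification_point X w"
      using w n \<open>w \<noteq> T\<close> assms by (intro ramification_pointI[of w T y z]) auto
    then show False using ramification_eq \<open>w \<noteq> T\<close> by blast
  qed
  then show ?thesis using wy wz by blast
qed

text \<open>The arcs from \<open>T\<close> to \<open>x\<close> and \<open>y\<close> part at some
  \<open>w\<close>. If \<open>w = T\<close> they form one arc through \<open>T\<close>; otherwise
  both points lie above \<open>w\<close> and are comparable.\<close>

lemma seg_T_cases:
  assumes "x \<in> X" "y \<in> X"
  shows "x \<in> seg T y \<or> y \<in> seg T x \<or> T \<in> seg x y"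
proof -
  obtain w where w: "w \<in> X" "w \<in> seg T x" "w \<in> seg T y" "seg w x \<inter> seg w y = {w}"
    using seg_branch[OF T_in assms] .
  show ?thesis
  proof (cases "w = T")
    case True
    then have "seg x T \<inter> seg T y = {T}"
      using w seg_commute[OF assms(1) T_in] by simp
    then show ?thesis
      using seg_glue(2)[of x y T] assms by simp
  next
    case False
    then show ?thesis using seg_T_directed[of w x y] w assms by blast
  qed
qed

end

section \<open>Smoothness at the top\<close>

lemma infinite_subseq:
  assumes "infinite {n::nat. P n}"
  obtains r :: "nat \<Rightarrow> nat" where "strict_mono r" "\<And>n. P (r n)"
  using infinite_enumerate[OF assms] by auto

lemma not_eventually_subseq:
  assumes "\<not> (\<forall>\<^sub>F n in sequentially. P n)"
  obtains r :: "nat \<Rightarrow> nat" where "strict_mono r" "\<And>n. \<not> P (r n)"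
proof -
  have "infinite {n. \<not> P n}"
    using assms unfolding cofinite_eq_sequentially[symmetric] eventually_cofinite by simp
  then show ?thesis using that infinite_subseq by blast
qed

context dendroid_set
begin

text \<open>The upper half of continuity of \<open>a \<mapsto> seg p a\<close>; the lower half is automatic,
  because segments are connected.\<close>

definition arcs_usc :: "'a \<Rightarrow> bool" where
  "arcs_usc p \<longleftrightarrow> (\<forall>x a l m. (\<forall>n::nat. a n \<in> X \<and> x n \<in> seg p (a n)) \<and> x \<longlonglongrightarrow> l \<and> a \<longlonglongrightarrow> m
      \<longrightarrow> l \<in> seg p m)"

lemma arcs_uscD:
  assumes "arcs_usc p" "\<And>n::nat. a n \<in> X" "\<And>n. x n \<in> seg p (a n)" "x \<longlonglongrightarrow> l" "a \<longlonglongrightarrow> m"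
  shows "l \<in> seg p m"
  using assms unfolding arcs_usc_def by blast

lemma closed_X: "closed X"
  using compact_X by (rule compact_imp_closed)

text \<open>The distance of \<open>x n\<close> from the closed arc \<open>seg p m\<close> is at most
  the Hausdorff distance of the two arcs, hence tends to 0.\<close>

lemma smooth_imp_arcs_usc:
  assumes "smooth X"
  obtains p where "p \<in> X" "arcs_usc p"
proof -
  obtain p where p: "p \<in> X" and lim: "\<And>a l. \<lbrakk>\<And>n::nat. a n \<in> X; l \<in> X; a \<longlonglongrightarrow> l\<rbrakk> \<Longrightarrow>
      (\<lambda>n. hausdorff_dist (seg p (a n)) (seg p l)) \<longlonglongrightarrow> 0"
    using assms unfolding smooth_def by blast
  have "l \<in> seg p m"
    if a: "\<And>n::nat. a n \<in> X" and x: "\<And>n. x n \<in> seg p (a n)" and xl: "x \<longlonglongrightarrow> l" and am: "a \<longlonglongrightarrow> m"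
    for x a l m
  proof -
    have m: "m \<in> X" using closed_sequentially[OF closed_X _ am] a by blast
    have le: "infdist (x n) (seg p m) \<le> hausdorff_dist (seg p (a n)) (seg p m)" for n
    proof -
      have "compact ((\<lambda>y. infdist y (seg p m)) ` seg p (a n))"
        using p a by (intro compact_continuous_image continuous_intros seg_compact)
      then have "bdd_above ((\<lambda>y. infdist y (seg p m)) ` seg p (a n))"
        by (intro bounded_imp_bdd_above compact_imp_bounded)
      then show ?thesis
        unfolding hausdorff_dist_def using x by (intro max.coboundedI1 cSUP_upper) auto
    qed
    have "(\<lambda>n. infdist (x n) (seg p m)) \<longlonglongrightarrow> 0"
      by (rule tendsto_sandwich[OF _ _ tendsto_const lim[OF a m am]])
        (auto simp: infdist_nonneg le)
    moreover have "(\<lambda>n. infdist (x n) (seg p m)) \<longlonglongrightarrow> infdist l (seg p m)"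
      using xl by (rule tendsto_infdist)
    ultimately have "infdist l (seg p m) = 0"
      using LIMSEQ_unique by blast
    then show ?thesis
      using in_closed_iff_infdist_zero[OF seg_closed[OF p m]] seg_ends[OF p m] by blast
  qed
  then have "arcs_usc p"
    unfolding arcs_usc_def by blast
  then show ?thesis using that p by blast
qed

end

context fan_set
begin

text \<open>If some \<open>a n\<close> dominates infinitely many terms, the limit stays in the
  closed arc from \<open>p\<close> to \<open>a n\<close>. Otherwise almost all terms lie above a
  fixed \<open>a n\<close> different from \<open>p\<close>; then semicontinuity at \<open>p\<close>
  puts \<open>a n\<close> on the arc from \<open>p\<close> to \<open>m\<close>, beyond the reach of
  the arc from \<open>p\<close> to \<open>T\<close>, so \<open>a n\<close> and with it
  \<open>p\<close> lie below \<open>m\<close>.\<close>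

lemma seg_T_ge_closed:
  assumes p: "p \<in> X" "p \<noteq> T" and U: "arcs_usc p"
    and a: "\<And>n::nat. a n \<in> X" "\<And>n. p \<in> seg T (a n)" "a \<longlonglongrightarrow> m"
  shows "p \<in> seg T m"
proof (cases "\<exists>n. infinite {k. a k \<in> seg T (a n)}")
  case True
  then obtain n where "infinite {k. a k \<in> seg T (a n)}" by blast
  then obtain r :: "nat \<Rightarrow> nat" where r: "strict_mono r" "\<And>k. a (r k) \<in> seg T (a n)"
    by (rule infinite_subseq) blast
  have "a (r k) \<in> seg p (a n)" for k
    using seg_between[OF T_in a(1) r(2) a(2)] .
  moreover have ar: "(a \<circ> r) \<longlonglongrightarrow> m"
    using LIMSEQ_subseq_LIMSEQ a(3) r(1) by blast
  ultimately have "m \<in> seg p (a n)"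
    by (intro closed_sequentially[OF seg_closed[OF p(1) a(1)] _ ar]) simp
  then show ?thesis
    using seg_between'[OF T_in a(1) a(2)] by blast
next
  case False
  have m: "m \<in> X" using closed_sequentially[OF closed_X _ a(3)] a by blast
  show ?thesis
  proof (cases "\<forall>n. a n = p")
    case True
    then have "a = (\<lambda>_. p)" by auto
    then have "m = p" using a(3) LIMSEQ_unique[OF tendsto_const, of p m] by simp
    then show ?thesis using p by (simp add: seg_ends)
  next
    case F: False
    then obtain n where n: "a n \<noteq> p" by blast
    have "finite {k. a k \<in> seg T (a n)}" using False by blast
    then have "\<forall>\<^sub>F k in sequentially. a k \<notin> seg T (a n)"
      unfolding cofinite_eq_sequentially[symmetric] eventually_cofinite by simp
    then obtain N where N: "\<And>k. k \<ge> N \<Longrightarrow> a k \<notin> seg T (a n)"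
      by (auto simp: eventually_sequentially)
    have "a n \<in> seg p (a (k + N))" for k
    proof -
      have "a n \<in> seg T (a (k + N))"
        using seg_T_directed[OF p(2) a(1) a(1) a(2) a(2)] N by (metis le_add2)
      then show ?thesis using seg_between[OF T_in a(1) _ a(2)] by blast
    qed
    then have anm: "a n \<in> seg p m"
      using arcs_uscD[OF U, of "\<lambda>k. a (k + N)" "\<lambda>_. a n" "a n" m] a(1) LIMSEQ_ignore_initial_segment[OF a(3), of N]
      by simp
    have "a n \<notin> seg p T"
      using seg_antisym[OF T_in p(1) a(1) a(2), of n] n seg_commute[OF p(1) T_in] by auto
    then have "a n \<in> seg T m"
      using anm seg_triangle[OF p(1) T_in m] by auto
    then show ?thesis
      using seg_trans[OF T_in m _ a(2)] by blast
  qed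
qed

text \<open>The definition of smoothness provides some base point \<open>p\<close>. Each possible
  position of the points relative to \<open>p\<close> lets an arc from \<open>T\<close> be compared
  with arcs from \<open>p\<close>, where semicontinuity is known.\<close>

lemma arcs_usc_T:
  assumes p: "p \<in> X" and U: "arcs_usc p"
  shows "arcs_usc T"
proof (cases "p = T")
  case False
  have main: "l \<in> seg T m"
    if a: "\<And>n::nat. a n \<in> X" and x: "\<And>n. x n \<in> seg T (a n)" and xl: "x \<longlonglongrightarrow> l" and am: "a \<longlonglongrightarrow> m"
    for x a l m
  proof -
    have m: "m \<in> X" using closed_sequentially[OF closed_X _ am] a by blast
    have xX: "x n \<in> X" for n using seg_in_X[OF T_in a x] .
    have l: "l \<in> X" using closed_sequentially[OF closed_X _ xl] xX by blast
    \<comment> \<open>By \<open>seg_T_cases\<close>, and by splitting at \<open>p\<close> when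
      \<open>p\<close> lies below \<open>a n\<close>, these four positions exhaust all indices. One
      of them recurs infinitely often, and the limits can be taken along it.\<close>
    define P1 where "P1 = {n. T \<in> seg p (a n)}"
    define P2 where "P2 = {n. a n \<in> seg T p}"
    define P3 where "P3 = {n. p \<in> seg T (a n) \<and> x n \<in> seg T p}"
    define P4 where "P4 = {n. p \<in> seg T (a n) \<and> x n \<in> seg p (a n)}"
    have "n \<in> P1 \<union> P2 \<union> P3 \<union> P4" for n
      using seg_T_cases[OF p a[of n]] seg_split(1)[OF T_in a[of n]] x[of n]
      by (auto simp: P1_def P2_def P3_def P4_def)
    then have "infinite (P1 \<union> P2 \<union> P3 \<union> P4)"
      by (metis UNIV_eq_I infinite_UNIV_nat)
    then consider "infinite P1" | "infinite P2" | "infinite P3" | "infinite P4"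
      by auto
    then show ?thesis
    proof cases
      case 1
      \<comment> \<open>Here the arc from \<open>T\<close> to \<open>a n\<close> is the final part
        of the arc from \<open>p\<close> to \<open>a n\<close>. Semicontinuity at \<open>p\<close>
        handles the latter, and the order of \<open>T\<close> and \<open>x n\<close> along it
        survives the limit.\<close>
      then obtain r :: "nat \<Rightarrow> nat" where r: "strict_mono r" "\<And>n. T \<in> seg p (a (r n))"
        unfolding P1_def by (rule infinite_subseq) blast
      have xr: "(\<lambda>n. x (r n)) \<longlonglongrightarrow> l" and ar: "(\<lambda>n. a (r n)) \<longlonglongrightarrow> m"
        using LIMSEQ_subseq_LIMSEQ[OF _ r(1)] xl am by (auto simp: o_def)
      have "x (r n) \<in> seg p (a (r n))" for n
        using seg_mono_left[OF p a r(2)] x by blast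
      then have lpm: "l \<in> seg p m"
        using arcs_uscD[OF U, of "\<lambda>n. a (r n)" "\<lambda>n. x (r n)"] a xr ar by blast
      have "T \<in> seg p (x (r n))" for n
        using seg_between'[OF p a r(2) x] .
      then have Tpl: "T \<in> seg p l"
        using arcs_uscD[OF U, of "\<lambda>n. x (r n)" "\<lambda>n. T"] xX xr by blast
      have Tpm: "T \<in> seg p m"
        using arcs_uscD[OF U, of "\<lambda>n. a (r n)" "\<lambda>n. T"] a r(2) ar by blast
      show ?thesis
        using seg_between[OF p m lpm Tpl] .
    next
      case 2
      then obtain r :: "nat \<Rightarrow> nat" where r: "strict_mono r" "\<And>n. a (r n) \<in> seg T p"
        unfolding P2_def by (rule infinite_subseq) blast
      have xr: "(\<lambda>n. x (r n)) \<longlonglongrightarrow> l" and ar: "(\<lambda>n. a (r n)) \<longlonglongrightarrow> m"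
        using LIMSEQ_subseq_LIMSEQ[OF _ r(1)] xl am by (auto simp: o_def)
      have "a (r n) \<in> seg p (x (r n))" for n
        using seg_between[OF T_in p r(2) x] seg_commute[OF p xX] by blast
      then have mpl: "m \<in> seg p l"
        using arcs_uscD[OF U, of "\<lambda>n. x (r n)" "\<lambda>n. a (r n)"] xX xr ar by blast
      have "x (r n) \<in> seg T p" for n
        using seg_trans[OF T_in p r(2) x] .
      then have lT: "l \<in> seg T p"
        using closed_sequentially[OF seg_closed[OF T_in p] _ xr] by blast
      have "m \<in> seg l p" using mpl seg_commute[OF p l] by simp
      then show ?thesis
        using seg_between'[OF T_in p lT] by blast
    next
      case 3
      then obtain r :: "nat \<Rightarrow> nat"
        where r: "strict_mono r" "\<And>n. p \<in> seg T (a (r n)) \<and> x (r n) \<in> seg T p"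
        unfolding P3_def by (rule infinite_subseq) blast
      have xr: "(\<lambda>n. x (r n)) \<longlonglongrightarrow> l" and ar: "(\<lambda>n. a (r n)) \<longlonglongrightarrow> m"
        using LIMSEQ_subseq_LIMSEQ[OF _ r(1)] xl am by (auto simp: o_def)
      have "p \<in> seg T m"
        using seg_T_ge_closed[OF p False U, of "\<lambda>n. a (r n)"] a r ar by blast
      moreover have "l \<in> seg T p"
        using closed_sequentially[OF seg_closed[OF T_in p] _ xr] r by blast
      ultimately show ?thesis
        using seg_trans[OF T_in m] by blast
    next
      case 4
      then obtain r :: "nat \<Rightarrow> nat"
        where r: "strict_mono r" "\<And>n. p \<in> seg T (a (r n)) \<and> x (r n) \<in> seg p (a (r n))"
        unfolding P4_def by (rule infinite_subseq) blast
      have xr: "(\<lambda>n. x (r n)) \<longlonglongrightarrow> l" and ar: "(\<lambda>n. a (r n)) \<longlonglongrightarrow> m"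
        using LIMSEQ_subseq_LIMSEQ[OF _ r(1)] xl am by (auto simp: o_def)
      have pm: "p \<in> seg T m"
        using seg_T_ge_closed[OF p False U, of "\<lambda>n. a (r n)"] a r ar by blast
      moreover have "l \<in> seg p m"
        using arcs_uscD[OF U, of "\<lambda>n. a (r n)" "\<lambda>n. x (r n)"] a r xr ar by blast
      ultimately show ?thesis
        using seg_mono_left[OF T_in m] by blast
    qed
  qed
  show ?thesis
    unfolding arcs_usc_def using main by blast
qed (use U in simp)

end

locale smooth_fan = fan_set +
  assumes usc: "arcs_usc T"
begin

lemma seg_T_limit:
  assumes "\<And>n::nat. a n \<in> X" "\<And>n. x n \<in> seg T (a n)" "x \<longlonglongrightarrow> l" "a \<longlonglongrightarrow> m"
  shows "l \<in> seg T m"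
  using arcs_uscD[OF usc] assms by blast

text \<open>If infinitely many arcs missed the ball, the part of \<open>seg T m\<close> outside it
  would fall into a lower piece containing \<open>T\<close> and an upper piece containing
  \<open>m\<close>. Each connecting arc has a point balanced between the pieces, and a limit of such
  points lies on \<open>seg T m\<close> outside the ball but in neither piece.\<close>

lemma seg_T_lower_limit:
  assumes a: "\<And>n::nat. a n \<in> X" "a \<longlonglongrightarrow> m" and z: "z \<in> seg T m" and e: "e > 0"
  shows "\<forall>\<^sub>F n in sequentially. seg T (a n) \<inter> ball z e \<noteq> {}"
proof (rule ccontr)
  assume "\<not> ?thesis"
  then obtain r :: "nat \<Rightarrow> nat" where r: "strict_mono r" "\<And>n. seg T (a (r n)) \<inter> ball z e = {}"
    by (rule not_eventually_subseq) auto
  define b where "b = a \<circ> r"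
  have b: "\<And>n. b n \<in> X" "b \<longlonglongrightarrow> m" "\<And>n. seg T (b n) \<inter> ball z e = {}"
    using a r LIMSEQ_subseq_LIMSEQ by (auto simp: b_def)
  have m: "m \<in> X" using closed_sequentially[OF closed_X _ b(2)] b by blast
  have zX: "z \<in> X" using seg_in_X[OF T_in m z] .
  define P where "P = seg T z - ball z e"
  define Q where "Q = seg z m - ball z e"
  have T_P: "T \<in> P"
    using b(3)[of 0] seg_ends(1)[OF T_in b(1)[of 0]] seg_ends(1)[OF T_in zX] unfolding P_def by blast
  have m_ball: "m \<notin> ball z e"
  proof
    assume "m \<in> ball z e"
    then have "\<forall>\<^sub>F n in sequentially. b n \<in> ball z e"
      using b(2) topological_tendstoD open_ball by blast
    then obtain n where "b n \<in> ball z e"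
      using eventually_happens by force
    then show False using b(3)[of n] seg_ends[OF T_in b(1)] by blast
  qed
  then have m_Q: "m \<in> Q"
    using m zX by (auto simp: Q_def seg_ends)
  have clP: "closed P" and clQ: "closed Q"
    unfolding P_def Q_def using zX m by (auto intro!: closed_Diff seg_closed)
  have PQ: "P \<inter> Q = {}"
  proof -
    have "P \<inter> Q \<subseteq> {z} - ball z e"
      unfolding P_def Q_def seg_split(2)[OF T_in m z, symmetric] by blast
    then show ?thesis using e by auto
  qed
  \<comment> \<open>As \<open>P\<close> and \<open>Q\<close> are disjoint and closed,
    \<open>f\<close> is negative on \<open>P\<close> and positive on \<open>Q\<close>; its zeros are
    the balanced points found by the intermediate value theorem.\<close>
  define f where "f = (\<lambda>y. infdist y P - infdist y Q)"
  have contf: "continuous_on S f" for S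
    unfolding f_def by (intro continuous_intros)
  have "T \<notin> Q" "m \<notin> P" using PQ T_P m_Q by auto
  then have "0 < infdist m P" "0 < infdist T Q"
    using infdist_pos_not_in_closed[OF clP] infdist_pos_not_in_closed[OF clQ] T_P m_Q by blast+
  then have fT: "f T < 0" and fm: "0 < f m"
    using T_P m_Q by (auto simp: f_def)
  have "(\<lambda>n. f (b n)) \<longlonglongrightarrow> f m"
    using contf[of UNIV] b(2) by (auto intro: continuous_on_tendsto_compose)
  then have "\<forall>\<^sub>F n in sequentially. 0 < f (b n)"
    using fm order_tendstoD(1) by blast
  then obtain N where N: "\<And>n. n \<ge> N \<Longrightarrow> 0 < f (b n)"
    by (auto simp: eventually_sequentially)
  have "\<exists>y\<in>seg T (b (n + N)). f y = 0" for n
  proof -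
    have "connected (f ` seg T (b (n + N)))"
      using seg_continuum[OF T_in b(1)] contf by (auto simp: continuum_def intro: connected_continuous_image)
    then have "{f T..f (b (n + N))} \<subseteq> f ` seg T (b (n + N))"
      by (rule connected_contains_Icc) (use seg_ends[OF T_in b(1)] in auto)
    moreover have "0 \<in> {f T..f (b (n + N))}" using fT N[of "n + N"] by simp
    ultimately have "0 \<in> f ` seg T (b (n + N))" by blast
    then show ?thesis by fastforce
  qed
  then obtain y where y: "\<And>n. y n \<in> seg T (b (n + N))" "\<And>n. f (y n) = 0"
    by metis
  have "\<forall>n. y n \<in> X" using seg_in_X[OF T_in b(1) y(1)] by blast
  then obtain l s where s: "strict_mono s" "(y \<circ> s) \<longlonglongrightarrow> l"
    using compact_X unfolding compact_eq_seq_compact_metric by (metis seq_compactE)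
  have "(\<lambda>n. b (n + N)) \<longlonglongrightarrow> m" using b(2) LIMSEQ_ignore_initial_segment by blast
  then have "(\<lambda>n. b (s n + N)) \<longlonglongrightarrow> m"
    using LIMSEQ_subseq_LIMSEQ[OF _ s(1)] by (auto simp: o_def)
  then have l: "l \<in> seg T m"
    using seg_T_limit[of "\<lambda>n. b (s n + N)" "y \<circ> s"] b(1) y(1) s by auto
  have "(\<lambda>n. f ((y \<circ> s) n)) \<longlonglongrightarrow> f l"
    by (intro continuous_on_tendsto_compose[OF contf[of UNIV] s(2)]) auto
  then have fl: "f l = 0"
    using y(2) LIMSEQ_unique[OF tendsto_const, of 0 "f l"] by (simp add: o_def)
  have "closed (- ball z e)" using open_ball by (rule closed_Compl)
  then have "l \<in> - ball z e"
  proof (rule closed_sequentially[OF _ _ s(2)])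
    show "(y \<circ> s) n \<in> - ball z e" for n
      using y(1) b(3) by (metis Compl_iff comp_apply disjoint_iff)
  qed
  then have "l \<in> P \<union> Q"
    using l seg_split(1)[OF T_in m z] by (auto simp: P_def Q_def)
  then have "infdist l P = 0 \<and> infdist l Q = 0"
    using fl infdist_zero[of l P] infdist_zero[of l Q] unfolding f_def by fastforce
  then have "l \<in> P" "l \<in> Q"
    using in_closed_iff_infdist_zero[OF clP] in_closed_iff_infdist_zero[OF clQ] T_P m_Q by blast+
  then show False using PQ by blast
qed

end

section \<open>A height function\<close>

lemma compact_dense_sequence:
  fixes K :: "'a::metric_space set"
  assumes "compact K" "K \<noteq> {}"
  obtains q :: "nat \<Rightarrow> 'a" where "range q \<subseteq> K" "\<And>x e. x \<in> K \<Longrightarrow> 0 < e \<Longrightarrow> \<exists>n. dist (q n) x < e"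
proof -
  have "\<forall>k::nat. \<exists>F. finite F \<and> F \<subseteq> K \<and> K \<subseteq> (\<Union>x\<in>F. ball x (1 / Suc k))"
    using seq_compact_imp_totally_bounded[of K] assms(1)
    by (simp add: compact_eq_seq_compact_metric)
  then obtain F where F: "\<And>k::nat. finite (F k)" "\<And>k. F k \<subseteq> K" "\<And>k. K \<subseteq> (\<Union>x\<in>F k. ball x (1 / Suc k))"
    by metis
  define D where "D = (\<Union>k. F k)"
  have "countable D"
    unfolding D_def using F(1) by (auto intro: countable_finite)
  have "F 0 \<noteq> {}"
    using F(3)[of 0] assms(2) by auto
  then have "D \<noteq> {}" by (auto simp: D_def)
  show ?thesis
  proof
    show "range (from_nat_into D) \<subseteq> K"
      using from_nat_into[OF \<open>D \<noteq> {}\<close>] F(2) by (auto simp: D_def)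
    fix x and e :: real assume "x \<in> K" "0 < e"
    obtain k :: nat where k: "1 / Suc k < e"
      using nat_approx_posE[OF \<open>0 < e\<close>] .
    obtain y where y: "y \<in> F k" "dist y x < 1 / Suc k"
      using F(3)[of k] \<open>x \<in> K\<close> by auto
    have "y \<in> D" using y by (auto simp: D_def)
    then obtain n where "from_nat_into D n = y"
      using from_nat_into_surj[OF \<open>countable D\<close>] by blast
    then have "dist (from_nat_into D n) x < e"
      using y(2) k by simp
    then show "\<exists>n. dist (from_nat_into D n) x < e" ..
  qed
qed

lemma infdist_attained:
  assumes "compact A" "A \<noteq> {}"
  shows "\<exists>z\<in>A. infdist q A = dist q z"
proof -
  obtain z where z: "z \<in> A" "\<And>y. y \<in> A \<Longrightarrow> dist q z \<le> dist q y"
    using continuous_attains_inf[OF assms, of "\<lambda>z. dist q z"]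
      continuous_on_dist[OF continuous_on_const continuous_on_id, of A q] by auto
  have "dist q z \<le> infdist q A"
    unfolding infdist_notempty[OF assms(2)] using assms(2) z(2) by (rule cINF_greatest)
  then show ?thesis using z infdist_le[OF z(1), of q] by force
qed

context smooth_fan
begin

text \<open>The two inequalities for the limit are the two halves of continuity of arcs: nearby arcs
  come close to a nearest point of \<open>seg T m\<close>, and limits of nearest points stay on
  \<open>seg T m\<close>.\<close>

lemma continuous_on_infdist_seg: "continuous_on X (\<lambda>x. infdist q (seg T x))"
proof (rule continuous_on_compact_closed_graph)
  have ne: "seg T x \<noteq> {}" if "x \<in> X" for x using seg_ends[OF T_in that] by auto
  show "compact {0..dist q T}" by simp
  show "(\<lambda>x. infdist q (seg T x)) ` X \<subseteq> {0..dist q T}"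
    using infdist_le[OF seg_ends(1)[OF T_in]] by (auto simp: infdist_nonneg)
  fix a m l
  assume a: "\<And>n::nat. a n \<in> X" "a \<longlonglongrightarrow> m" and m: "m \<in> X"
    and lim: "(\<lambda>n. infdist q (seg T (a n))) \<longlonglongrightarrow> l"
  show "l = infdist q (seg T m)"
  proof (rule antisym)
    obtain z where z: "z \<in> seg T m" "infdist q (seg T m) = dist q z"
      using infdist_attained[OF seg_compact[OF T_in m] ne[OF m]] by blast
    show "l \<le> infdist q (seg T m)"
    proof (rule field_le_epsilon)
      fix e :: real assume e: "0 < e"
      have "\<forall>\<^sub>F n in sequentially. infdist q (seg T (a n)) \<le> infdist q (seg T m) + e"
        using seg_T_lower_limit[OF a z(1) e]
      proof eventually_elim
        case (elim n)
        then obtain y where y: "y \<in> seg T (a n)" "dist z y < e" by auto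
        have "infdist q (seg T (a n)) \<le> dist q y" using y by (intro infdist_le)
        also have "\<dots> \<le> dist q z + dist z y" by (rule dist_triangle)
        finally show ?case using y z by simp
      qed
      then show "l \<le> infdist q (seg T m) + e"
        using tendsto_upperbound[OF lim] by simp
    qed
    have "\<exists>y. y \<in> seg T (a n) \<and> infdist q (seg T (a n)) = dist q y" for n
      using infdist_attained[OF seg_compact[OF T_in a(1)] ne[OF a(1)]] by blast
    then obtain y where y: "\<And>n. y n \<in> seg T (a n)" "\<And>n. infdist q (seg T (a n)) = dist q (y n)"
      by metis
    have "\<forall>n. y n \<in> X" using seg_in_X[OF T_in a(1) y(1)] by blast
    then obtain w s where s: "strict_mono s" "(y \<circ> s) \<longlonglongrightarrow> w"
      using compact_X unfolding compact_eq_seq_compact_metric by (metis seq_compactE)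
    have "(\<lambda>n. a (s n)) \<longlonglongrightarrow> m"
      using LIMSEQ_subseq_LIMSEQ[OF a(2) s(1)] by (simp add: o_def)
    then have w: "w \<in> seg T m"
      using seg_T_limit[of "\<lambda>n. a (s n)" "y \<circ> s"] a(1) y(1) s by auto
    have "(\<lambda>n. dist q (y (s n))) \<longlonglongrightarrow> l"
      using LIMSEQ_subseq_LIMSEQ[OF lim s(1)] y(2) by (simp add: o_def)
    moreover have "(\<lambda>n. dist q ((y \<circ> s) n)) \<longlonglongrightarrow> dist q w"
      using s(2) by (intro tendsto_intros)
    ultimately have "l = dist q w"
      using LIMSEQ_unique by (auto simp: o_def)
    then show "infdist q (seg T m) \<le> l"
      using infdist_le[OF w] by simp
  qed
qed

text \<open>A variant of a Whitney map: distances from a dense sequence to the growing arc are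
  summed with geometric weights.\<close>

lemma height_function:
  obtains h :: "'a \<Rightarrow> real" where "continuous_on X h" "h T = 0"
    "\<And>x y. y \<in> X \<Longrightarrow> x \<in> seg T y \<Longrightarrow> x \<noteq> y \<Longrightarrow> h x < h y"
proof -
  obtain q :: "nat \<Rightarrow> 'a" where q: "range q \<subseteq> X" "\<And>x e. x \<in> X \<Longrightarrow> 0 < e \<Longrightarrow> \<exists>n. dist (q n) x < e"
    using compact_dense_sequence[OF compact_X] T_in by blast
  obtain B where B: "\<And>x y. x \<in> X \<Longrightarrow> y \<in> X \<Longrightarrow> dist x y \<le> B"
    using compact_imp_bounded[OF compact_X] unfolding bounded_two_points by blast
  \<comment> \<open>Subtracting from \<open>dist (q n) T\<close> makes every term vanish at
    \<open>T\<close>, stay nonnegative, and grow with the arc.\<close>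
  define c where "c = (\<lambda>n x. (1/2)^n * (dist (q n) T - infdist (q n) (seg T x)))"
  have c0: "0 \<le> c n x" if "x \<in> X" for n x
    using infdist_le[OF seg_ends(1)[OF T_in that]] by (auto simp: c_def)
  have cB: "c n x \<le> B * (1/2)^n" for n x
  proof -
    have "dist (q n) T - infdist (q n) (seg T x) \<le> B"
      using B[OF range_subsetD[OF q(1)] T_in, of n] infdist_nonneg[of "q n" "seg T x"] by simp
    then show ?thesis unfolding c_def by (simp add: mult.commute)
  qed
  have sB: "summable (\<lambda>n. B * (1/2)^n :: real)"
    by (intro summable_mult) simp
  have sc: "summable (\<lambda>n. c n x)" if "x \<in> X" for x
    by (rule summable_comparison_test'[OF sB]) (use c0[OF that] cB in auto)
  define h where "h = (\<lambda>x. \<Sum>n. c n x)"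
  show ?thesis
  proof
    show "continuous_on X h"
    proof (rule uniform_limit_theorem)
      show "uniform_limit X (\<lambda>n x. \<Sum>i<n. c i x) h sequentially"
        unfolding h_def by (rule Weierstrass_m_test[OF _ sB]) (use c0 cB in auto)
      show "\<forall>\<^sub>F n in sequentially. continuous_on X (\<lambda>x. \<Sum>i<n. c i x)"
        unfolding c_def
        by (intro always_eventually allI continuous_intros continuous_on_infdist_seg)
    qed simp
    show "h T = 0" unfolding h_def c_def by simp
    fix x y assume y: "y \<in> X" and x: "x \<in> seg T y" "x \<noteq> y"
    have xX: "x \<in> X" using seg_in_X[OF T_in y x(1)] .
    have mono: "infdist (q n) (seg T y) \<le> infdist (q n) (seg T x)" for n
      using seg_mono_right[OF T_in y x(1)] seg_ends[OF T_in xX] by (intro infdist_mono) auto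
    have "y \<notin> seg T x" using seg_antisym[OF T_in xX y x(1)] x by blast
    then have pos: "0 < infdist y (seg T x)"
      using seg_ends[OF T_in xX] seg_closed[OF T_in xX] infdist_pos_not_in_closed by blast
    define d where "d = infdist y (seg T x)"
    \<comment> \<open>Such a \<open>q n\<close> is closer than \<open>d / 3\<close> to
      \<open>y\<close> but at least \<open>2 * d / 3\<close> away from the arc to \<open>x\<close>,
      so one summand increases strictly.\<close>
    obtain n where n: "dist (q n) y < d / 3"
      using q(2)[OF y, of "d/3"] pos by (auto simp: d_def)
    have "infdist (q n) (seg T y) \<le> dist (q n) y"
      using seg_ends[OF T_in y] by (intro infdist_le)
    moreover have "d \<le> infdist (q n) (seg T x) + dist y (q n)"
      unfolding d_def by (rule infdist_triangle)
    ultimately have lt: "infdist (q n) (seg T y) < infdist (q n) (seg T x)"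
      using n zero_le_dist[of y "q n"] dist_commute[of y "q n"] by linarith
    have "0 < (\<Sum>n. c n y - c n x)"
    proof (rule suminf_pos2[of _ n])
      show "summable (\<lambda>n. c n y - c n x)" using sc xX y by (intro summable_diff)
      show "0 \<le> c n y - c n x" for n
        using mono[of n] by (simp add: c_def)
      show "0 < c n y - c n x"
        using lt by (simp add: c_def)
    qed
    also have "\<dots> = h y - h x"
      unfolding h_def using sc xX y by (intro suminf_diff[symmetric])
    finally show "h x < h y" by simp
  qed
qed

end

section \<open>Separating legs by clopen sets\<close>

definition clopen_in :: "'a::topological_space set \<Rightarrow> 'a set \<Rightarrow> bool" where
  "clopen_in K U \<longleftrightarrow> openin (top_of_set K) U \<and> closedin (top_of_set K) U"

lemma clopen_in_subset: "clopen_in K U \<Longrightarrow> U \<subseteq> K"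
  unfolding clopen_in_def by (blast dest: openin_imp_subset)

lemma clopen_in_compact: "compact K \<Longrightarrow> clopen_in K U \<Longrightarrow> compact U"
  unfolding clopen_in_def using closedin_compact by blast

lemma clopen_in_Diff: "clopen_in K U \<Longrightarrow> clopen_in K V \<Longrightarrow> clopen_in K (U - V)"
  unfolding clopen_in_def by (auto intro: openin_diff closedin_diff)

lemma clopen_in_Int: "clopen_in K U \<Longrightarrow> clopen_in K V \<Longrightarrow> clopen_in K (U \<inter> V)"
  unfolding clopen_in_def by auto

lemma clopen_in_self [simp]: "clopen_in K K"
  unfolding clopen_in_def by auto

lemma clopen_in_empty [simp]: "clopen_in K {}"
  unfolding clopen_in_def by auto

lemma clopen_in_restrict: "clopen_in K U \<Longrightarrow> L \<subseteq> K \<Longrightarrow> clopen_in L (U \<inter> L)"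
  unfolding clopen_in_def openin_open closedin_closed by blast

lemma connected_clopen_in:
  assumes "connected C" "C \<subseteq> K" "clopen_in K U" "C \<inter> U \<noteq> {}"
  shows "C \<subseteq> U"
proof -
  have "clopen_in C (U \<inter> C)" using assms clopen_in_restrict by blast
  then show ?thesis
    using assms(1,4) unfolding clopen_in_def connected_clopen by blast
qed

text \<open>In compact Hausdorff spaces components and quasi-components agree; this is the resulting
  cut-wire-fence theorem for two closed sets.\<close>

lemma compact_separation:
  fixes K :: "'a::metric_space set"
  assumes "compact K" "closedin (top_of_set K) S" "closedin (top_of_set K) T"
    and con: "\<And>C. connected C \<Longrightarrow> C \<subseteq> K \<Longrightarrow> C \<inter> S = {} \<or> C \<inter> T = {}"
  obtains U where "clopen_in K U" "S \<subseteq> U" "U \<inter> T = {}"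
proof -
  have "separated_between (top_of_set K) S T"
  proof (rule cut_wire_fence_theorem)
    show "compact_space (top_of_set K)"
      using assms(1) by (simp add: compact_space_subtopology)
    show "Hausdorff_space (top_of_set K)"
      by (intro Hausdorff_space_subtopology Hausdorff_space_euclidean)
    show "disjnt C S \<or> disjnt C T" if "connectedin (top_of_set K) C" for C
      using that con[of C] by (auto simp: connectedin_subtopology disjnt_def)
  qed (use assms in auto)
  then show ?thesis
    using that unfolding separated_between clopen_in_def by fastforce
qed

text \<open>A clopen subset of a compact set is compact, so it is the trace of a finite union of
  balls from a countable base.\<close>

lemma countable_clopen_in:
  fixes K :: "'a::metric_space set"
  assumes K: "compact K"
  shows "countable {D. clopen_in K D}"
proof (cases "K = {}")
  case True
  then have "{D. clopen_in K D} \<subseteq> {{}}" using clopen_in_subset by auto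
  then show ?thesis by (rule countable_subset) simp
next
  case False
  obtain q :: "nat \<Rightarrow> 'a" where q: "range q \<subseteq> K" "\<And>x e. x \<in> K \<Longrightarrow> 0 < e \<Longrightarrow> \<exists>n. dist (q n) x < e"
    using compact_dense_sequence[OF K False] by blast
  define W where "W = (\<lambda>(n::nat, k::nat). ball (q n) (1 / Suc k))"
  have "D \<in> (\<lambda>G. K \<inter> (\<Union>p\<in>G. W p)) ` Collect finite" if D: "clopen_in K D" for D
  proof -
    obtain V where V: "open V" "D = K \<inter> V"
      using D unfolding clopen_in_def openin_open by blast
    define P where "P = {p. W p \<subseteq> V}"
    have cover: "D \<subseteq> \<Union> (W ` P)"
    proof
      fix x assume x: "x \<in> D"
      then obtain e where e: "e > 0" "ball x e \<subseteq> V"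
        using V openE[of V x] by blast
      obtain k where k: "1 / Suc k < e / 2"
        using nat_approx_posE[of "e/2"] e by auto
      obtain n where n: "dist (q n) x < 1 / Suc k"
        using q(2)[of x "1 / Suc k"] x V by auto
      have "W (n, k) \<subseteq> ball x e"
      proof
        fix y assume "y \<in> W (n, k)"
        then have "dist (q n) y < 1 / Suc k" by (simp add: W_def)
        then have "dist x y < e"
          using dist_triangle2[of x y "q n"] dist_commute[of x "q n"] dist_commute[of y "q n"] n k
          by linarith
        then show "y \<in> ball x e" by simp
      qed
      then have "(n, k) \<in> P" using e by (auto simp: P_def)
      moreover have "x \<in> W (n, k)" using n by (simp add: W_def)
      ultimately show "x \<in> \<Union> (W ` P)" by blast
    qed
    have "compact D" using clopen_in_compact[OF K D] .
    moreover have "\<forall>B\<in>W ` P. open B" by (auto simp: W_def)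
    ultimately obtain F where F: "F \<subseteq> W ` P" "finite F" "D \<subseteq> \<Union>F"
      using cover compactE[of D "W ` P"] by (metis (no_types, lifting))
    then obtain G where G: "finite G" "G \<subseteq> P" "F = W ` G"
      using finite_subset_image by metis
    have "D = K \<inter> (\<Union>p\<in>G. W p)"
      using F G V by (auto simp: P_def)
    then show ?thesis using G by blast
  qed
  then have "{D. clopen_in K D} \<subseteq> (\<lambda>G. K \<inter> (\<Union>p\<in>G. W p)) ` Collect finite" by blast
  then show ?thesis
    by (rule countable_subset) (intro countable_image countable_Collect_finite)
qed

lemma continuous_on_indicator_clopen:
  assumes "clopen_in K (A \<inter> K)"
  shows "continuous_on K (\<lambda>x. if x \<in> A then 1 else 0 :: real)"
proof -
  have "clopen_in K (K - A \<inter> K)" using assms by (intro clopen_in_Diff) auto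
  moreover have eq: "K = (A \<inter> K) \<union> (K - A \<inter> K)" by blast
  ultimately have "continuous_on ((A \<inter> K) \<union> (K - A \<inter> K)) (\<lambda>x. if x \<in> A then 1 else 0 :: real)"
    using assms by (intro continuous_on_cases_local) (auto simp: clopen_in_def)
  then show ?thesis using eq by simp
qed

lemma compact_zero_one_sequences: "compact {f :: nat \<Rightarrow> real. \<forall>i. f i \<in> {0, 1}}"
proof -
  have "compactin (product_topology (\<lambda>_::nat. euclidean :: real topology) UNIV) (PiE UNIV (\<lambda>_. {0, 1}))"
    unfolding compactin_PiE by (auto intro: finite_imp_compactin)
  then show ?thesis
    by (simp add: euclidean_product_topology PiE_def Pi_def)
qed

text \<open>A connected set of 0-1 sequences is a point, since a nonconstant coordinate would have
  to take the value 1/2. Hence \<open>c\<close> can be separated from the complement of the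
  ball.\<close>

lemma small_clopen_zero_one:
  assumes C: "compact C" "C \<subseteq> {f :: nat \<Rightarrow> real. \<forall>i. f i \<in> {0, 1}}" and c: "c \<in> C" and e: "e > 0"
  obtains U where "clopen_in C U" "c \<in> U" "U \<subseteq> ball c e"
proof -
  have const: "D \<subseteq> {c}" if D: "connected D" "D \<subseteq> C" "c \<in> D" for D
  proof
    fix d assume d: "d \<in> D"
    have "d i = c i" for i
    proof (rule ccontr)
      assume ne: "d i \<noteq> c i"
      have "continuous_on D (\<lambda>x. x i)"
        by (rule continuous_on_subset[OF continuous_on_product_coordinates]) simp
      then have con: "connected ((\<lambda>x. x i) ` D)" using D(1) connected_continuous_image by blast
      have "d i \<in> {0, 1}" "c i \<in> {0, 1}" using d c D(2) C(2) by blast+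
      then have "(d i = 0 \<and> c i = 1) \<or> (d i = 1 \<and> c i = 0)" using ne by auto
      moreover have "d i \<in> (\<lambda>x. x i) ` D" "c i \<in> (\<lambda>x. x i) ` D" using d D(3) by blast+
      ultimately have "0 \<in> (\<lambda>x. x i) ` D" "1 \<in> (\<lambda>x. x i) ` D" by metis+
      then have "{0..1} \<subseteq> (\<lambda>x. x i) ` D"
        using connected_contains_Icc[OF con, of 0 1] by blast
      moreover have "(1/2::real) \<in> {0..1}" by simp
      ultimately have "1/2 \<in> (\<lambda>x. x i) ` D" by (rule subsetD)
      then obtain x where x: "x \<in> D" "x i = 1/2" by (metis imageE)
      then have "x i \<in> {0, 1}" using D(2) C(2) by blast
      then show False using x by simp
    qed
    then show "d \<in> {c}" by auto
  qed
  obtain U where U: "clopen_in C U" "{c} \<subseteq> U" "U \<inter> (C - ball c e) = {}"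
  proof (rule compact_separation[OF C(1)])
    show "closedin (top_of_set C) {c}" using c by (simp add: closed_subset)
    show "closedin (top_of_set C) (C - ball c e)"
      by (metis Diff_eq closed_Compl closedin_closed_Int open_ball)
    show "D \<inter> {c} = {} \<or> D \<inter> (C - ball c e) = {}" if "connected D" "D \<subseteq> C" for D
      using const[OF that] e by (cases "c \<in> D") auto
  qed
  then show ?thesis using that clopen_in_subset[OF U(1)] by blast
qed

section \<open>Legs and their clopen separation away from the top\<close>

locale smooth_fan_height = smooth_fan +
  fixes h :: "'a \<Rightarrow> real"
  assumes cont_h: "continuous_on X h" and h_T [simp]: "h T = 0"
    and h_mono: "\<And>x y. y \<in> X \<Longrightarrow> x \<in> seg T y \<Longrightarrow> x \<noteq> y \<Longrightarrow> h x < h y"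
begin

lemma h_le: "y \<in> X \<Longrightarrow> x \<in> seg T y \<Longrightarrow> h x \<le> h y"
  using h_mono[of y x] by (cases "x = y") auto

lemma h_pos: "x \<in> X \<Longrightarrow> x \<noteq> T \<Longrightarrow> 0 < h x"
  using h_mono[of x T] seg_ends(1)[OF T_in] by auto

lemma h_nonneg: "x \<in> X \<Longrightarrow> 0 \<le> h x"
  using h_pos[of x] by (cases "x = T") auto

lemma h_zero: "x \<in> X \<Longrightarrow> h x = 0 \<longleftrightarrow> x = T"
  using h_pos[of x] by (cases "x = T") auto

definition same_leg :: "'a \<Rightarrow> 'a \<Rightarrow> bool" where
  "same_leg x y \<longleftrightarrow> x \<in> seg T y \<or> y \<in> seg T x"

lemma same_leg_sym: "same_leg x y \<Longrightarrow> same_leg y x"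
  by (auto simp: same_leg_def)

text \<open>\<open>T\<close> is comparable with every point, so the middle point has to differ from
  it; two points above the same \<open>y\<close> are then compared by
  \<open>seg_T_directed\<close>.\<close>

lemma same_leg_trans:
  assumes "x \<in> X" "y \<in> X" "z \<in> X" "y \<noteq> T" "same_leg x y" "same_leg y z"
  shows "same_leg x z"
proof -
  consider "x \<in> seg T y" "y \<in> seg T z" | "x \<in> seg T y" "z \<in> seg T y"
    | "y \<in> seg T x" "y \<in> seg T z" | "y \<in> seg T x" "z \<in> seg T y"
    using assms by (auto simp: same_leg_def)
  then show ?thesis
  proof cases
    case 1 then show ?thesis using seg_trans[OF T_in assms(3)] by (auto simp: same_leg_def)
  next
    case 2 then show ?thesis using seg_chain[OF T_in assms(2)] by (auto simp: same_leg_def)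
  next
    case 3 then show ?thesis using seg_T_directed[OF assms(4,1,3)] by (auto simp: same_leg_def)
  next
    case 4 then show ?thesis using seg_trans[OF T_in assms(1)] by (auto simp: same_leg_def)
  qed
qed

lemma same_leg_height:
  assumes "x \<in> X" "y \<in> X" "same_leg x y"
  shows "x \<in> seg T y \<longleftrightarrow> h x \<le> h y"
proof (cases "x = y")
  case True
  then show ?thesis using seg_ends(2)[OF T_in assms(2)] by auto
next
  case False
  then show ?thesis
    using assms h_mono[of y x] h_mono[of x y] unfolding same_leg_def by fastforce
qed

text \<open>All legs meet at \<open>T\<close>, so they can only be separated in
  \<open>X - {T}\<close>, which is not compact. The levels are a compact exhaustion of it.\<close>

definition level :: "nat \<Rightarrow> 'a set" where
  "level n = {x \<in> X. 1 / Suc n \<le> h x}"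

lemma level_subset: "level n \<subseteq> X - {T}"
  by (auto simp: level_def)

lemma level_mono: "m \<le> n \<Longrightarrow> level m \<subseteq> level n"
  unfolding level_def using frac_le[of 1 1 "Suc m" "Suc n"] by force

lemma level_exists:
  assumes "x \<in> X" "x \<noteq> T" obtains n where "1 / Suc n < h x" "x \<in> level n"
proof -
  obtain n where "1 / Suc n < h x" using nat_approx_posE[OF h_pos[OF assms]] .
  then show ?thesis using that assms by (auto simp: level_def)
qed

lemma level_exists2:
  assumes "x \<in> X" "x \<noteq> T" "y \<in> X" "y \<noteq> T" obtains n where "x \<in> level n" "y \<in> level n"
proof -
  obtain n m where "x \<in> level n" "y \<in> level m"
    using level_exists assms by metis
  then have "x \<in> level (max n m)" "y \<in> level (max n m)"
    using level_mono[of n "max n m"] level_mono[of m "max n m"] by auto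
  then show ?thesis by (rule that)
qed

lemma compact_level: "compact (level n)"
proof -
  have "level n = X \<inter> h -` {1 / Suc n..}" by (auto simp: level_def)
  moreover have "closedin (top_of_set X) (X \<inter> h -` {1 / Suc n..})"
    using cont_h closed_atLeast by (intro continuous_closedin_preimage)
  ultimately show ?thesis using compact_X closedin_compact by metis
qed

lemma seg_level:
  assumes "x \<in> level n" "y \<in> level n" "x \<in> seg T y"
  shows "seg x y \<subseteq> level n"
proof
  have x: "x \<in> X" and y: "y \<in> X" using assms level_subset by blast+
  fix z assume z: "z \<in> seg x y"
  have "x \<in> seg T z" using seg_between'[OF T_in y assms(3) z] .
  then have "h x \<le> h z" using h_le seg_in_X[OF x y z] by blast
  then show "z \<in> level n" using assms(1) seg_in_X[OF x y z] by (auto simp: level_def)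
qed

lemma same_leg_connected:
  assumes "x \<in> level n" "y \<in> level n" "same_leg x y"
  obtains S where "connected S" "S \<subseteq> level n" "x \<in> S" "y \<in> S"
proof -
  have X: "x \<in> X" "y \<in> X" using assms level_subset by blast+
  then have "connected (seg x y)" "connected (seg y x)"
    using seg_continuum by (auto simp: continuum_def)
  then show ?thesis
    using that[of "seg x y"] that[of "seg y x"] assms seg_level seg_ends X
    unfolding same_leg_def by blast
qed

text \<open>The closure of \<open>S\<close> is a continuum that still misses \<open>T\<close> and
  contains the arc from \<open>x\<close> to \<open>y\<close>. Points on different legs would be
  joined through \<open>T\<close>.\<close>

lemma connected_level:
  assumes S: "connected S" "S \<subseteq> level n" and x: "x \<in> S" "y \<in> S"
  shows "same_leg x y"
proof -
  have X: "x \<in> X" "y \<in> X" using assms level_subset by blast+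
  have sub: "closure S \<subseteq> level n"
    using S compact_level by (simp add: closure_minimal compact_imp_closed)
  then have "compact (closure S)"
    using compact_Int_closed[OF compact_level closed_closure, of n S] by (simp add: inf.absorb2)
  then have "continuum (closure S)"
    using S by (simp add: continuum_def connected_imp_connected_closure)
  then have "seg x y \<subseteq> closure S"
    using sub level_subset closure_subset x by (intro seg_least) blast+
  then have "T \<notin> seg x y" using sub level_subset by blast
  then show ?thesis using seg_T_cases[OF X] by (auto simp: same_leg_def)
qed

text \<open>Clopenness in \<open>X - {T}\<close>, tested on the compact exhaustion; away from
  \<open>T\<close> such a set is a union of whole legs.\<close>

definition leg_clopen :: "'a set \<Rightarrow> bool" where
  "leg_clopen A \<longleftrightarrow> (\<forall>n. clopen_in (level n) (A \<inter> level n))"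

lemma leg_clopen_saturated:
  assumes A: "leg_clopen A" and x: "x \<in> X" "x \<noteq> T" "y \<in> X" "y \<noteq> T" "same_leg x y"
  shows "x \<in> A \<longleftrightarrow> y \<in> A"
proof -
  obtain n where n: "x \<in> level n" "y \<in> level n" using level_exists2 x by metis
  obtain S where S: "connected S" "S \<subseteq> level n" "x \<in> S" "y \<in> S"
    using same_leg_connected[OF n x(5)] .
  have "clopen_in (level n) (A \<inter> level n)"
    using A unfolding leg_clopen_def by blast
  then have "S \<inter> (A \<inter> level n) \<noteq> {} \<Longrightarrow> S \<subseteq> A \<inter> level n"
    by (rule connected_clopen_in[OF S(1,2)])
  then show ?thesis using S(3,4) n by blast
qed

text \<open>A connected set in the larger level that meets both \<open>P\<close> and its complement
  in \<open>level n\<close> would have two points of \<open>level n\<close> on one leg. The arc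
  between them already lies in \<open>level n\<close> and would be cut by \<open>P\<close>. Hence
  the two parts can be separated in the larger level.\<close>

lemma clopen_level_Suc:
  assumes P: "clopen_in (level n) P"
  obtains P' where "clopen_in (level (Suc n)) P'" "P' \<inter> level n = P"
proof -
  have sub: "P \<subseteq> level n" "level n \<subseteq> level (Suc n)"
    using clopen_in_subset[OF P] level_mono by auto
  have comp: "compact P" "compact (level n - P)"
    using clopen_in_compact[OF compact_level P]
      clopen_in_compact[OF compact_level clopen_in_Diff[OF clopen_in_self P]] by auto
  obtain U where U: "clopen_in (level (Suc n)) U" "P \<subseteq> U" "U \<inter> (level n - P) = {}"
  proof (rule compact_separation[OF compact_level])
    show "closedin (top_of_set (level (Suc n))) P"
      "closedin (top_of_set (level (Suc n))) (level n - P)"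
      using comp sub by (auto intro!: closed_subset compact_imp_closed)
    show "C \<inter> P = {} \<or> C \<inter> (level n - P) = {}"
      if C: "connected C" "C \<subseteq> level (Suc n)" for C
    proof (rule ccontr)
      assume "\<not> ?thesis"
      then obtain x y where xy: "x \<in> C" "x \<in> P" "y \<in> C" "y \<in> level n" "y \<notin> P" by blast
      then have "same_leg x y" using connected_level[OF C] by blast
      then obtain S where S: "connected S" "S \<subseteq> level n" "x \<in> S" "y \<in> S"
        using same_leg_connected xy sub by blast
      then have "S \<subseteq> P" using connected_clopen_in[OF S(1,2) P] xy by blast
      then show False using S xy by blast
    qed
  qed
  then show ?thesis using that[of U] sub by blast
qed

text \<open>The set is extended from each level to the next by dependent choice. Since each stage
  restricts to all earlier ones, the union has the prescribed traces.\<close>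

lemma leg_clopen_extend:
  assumes D: "clopen_in (level n) D"
  obtains A where "leg_clopen A" "A \<inter> level n = D"
proof -
  have "\<exists>Q. \<forall>k. (clopen_in (level (n + k)) (Q k) \<and> (k = 0 \<longrightarrow> Q k = D))
      \<and> Q (Suc k) \<inter> level (n + k) = Q k"
  proof (rule dependent_nat_choice)
    show "\<exists>x. clopen_in (level (n + 0)) x \<and> (0 = 0 \<longrightarrow> x = D)"
      using D by auto
    show "\<exists>y. (clopen_in (level (n + Suc k)) y \<and> (Suc k = 0 \<longrightarrow> y = D)) \<and> y \<inter> level (n + k) = x"
      if "clopen_in (level (n + k)) x \<and> (k = 0 \<longrightarrow> x = D)" for x k
      using that clopen_level_Suc[of "n + k" x] by auto
  qed
  then obtain Q where Q: "\<And>k. clopen_in (level (n + k)) (Q k)" "Q 0 = D"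
    "\<And>k. Q (Suc k) \<inter> level (n + k) = Q k" by blast
  have later: "Q (k + j) \<inter> level (n + k) = Q k" for k j
  proof (induction j)
    case 0
    then show ?case using clopen_in_subset[OF Q(1)[of k]] by auto
  next
    case (Suc j)
    have "level (n + k) \<subseteq> level (n + (k + j))" by (intro level_mono) simp
    then have "Q (k + Suc j) \<inter> level (n + k) = Q (Suc (k + j)) \<inter> level (n + (k + j)) \<inter> level (n + k)"
      by auto
    then show ?case using Q(3) Suc by simp
  qed
  define A where "A = (\<Union>k. Q k)"
  have AQ: "A \<inter> level (n + k) = Q k" for k
  proof
    show "Q k \<subseteq> A \<inter> level (n + k)"
      using clopen_in_subset[OF Q(1)[of k]] by (auto simp: A_def)
    show "A \<inter> level (n + k) \<subseteq> Q k"
    proof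
      fix x assume x: "x \<in> A \<inter> level (n + k)"
      then obtain j where j: "x \<in> Q j" by (auto simp: A_def)
      show "x \<in> Q k"
      proof (cases "j \<le> k")
        case True
        then show ?thesis using later[of j "k - j"] j by auto
      next
        case False
        then show ?thesis using later[of k "j - k"] j x by auto
      qed
    qed
  qed
  have "leg_clopen A"
    unfolding leg_clopen_def
  proof
    fix m
    have "level m \<subseteq> level (n + m)" by (intro level_mono) simp
    then have "clopen_in (level m) (A \<inter> level (n + m) \<inter> level m)"
      using Q(1) AQ by (intro clopen_in_restrict) auto
    then show "clopen_in (level m) (A \<inter> level m)"
      using \<open>level m \<subseteq> level (n + m)\<close> by (simp add: Int_assoc inf.absorb2)
  qed
  moreover have "A \<inter> level n = D" using AQ[of 0] Q(2) by simp
  ultimately show ?thesis by (rule that)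
qed

text \<open>One extension is fixed for each of the countably many pairs of a level and a clopen
  subset. Any two points on different legs lie in a common level and are separated by a clopen
  subset of it.\<close>

lemma leg_clopen_sequence:
  obtains A :: "nat \<Rightarrow> 'a set" where "\<And>i. leg_clopen (A i)"
    "\<And>x y. \<lbrakk>x \<in> X - {T}; y \<in> X - {T}; \<And>i. x \<in> A i \<longleftrightarrow> y \<in> A i\<rbrakk> \<Longrightarrow> same_leg x y"
proof -
  define \<D> where "\<D> = Sigma UNIV (\<lambda>n. {D. clopen_in (level n) D})"
  have "countable \<D>"
    unfolding \<D>_def using countable_clopen_in[OF compact_level] by (intro countable_SIGMA) auto
  define E where "E = (\<lambda>(n, D). SOME A. leg_clopen A \<and> A \<inter> level n = D)"
  have E: "leg_clopen (E (n, D)) \<and> E (n, D) \<inter> level n = D" if D: "clopen_in (level n) D" for n D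
  proof -
    obtain A where "leg_clopen A" "A \<inter> level n = D" by (rule leg_clopen_extend[OF D])
    then have "leg_clopen A \<and> A \<inter> level n = D" ..
    then show ?thesis unfolding E_def prod.case by (rule someI)
  qed
  have "(0, {}) \<in> \<D>" unfolding \<D>_def by simp
  then have ne: "\<D> \<noteq> {}" by blast
  show ?thesis
  proof
    show "leg_clopen (E (from_nat_into \<D> i))" for i
    proof -
      obtain n D where "from_nat_into \<D> i = (n, D)" by fastforce
      moreover from this have "clopen_in (level n) D"
        using from_nat_into[OF ne, of i] by (simp add: \<D>_def)
      ultimately show ?thesis using E by simp
    qed
    fix x y assume x: "x \<in> X - {T}" and y: "y \<in> X - {T}"
      and eq: "\<And>i. x \<in> E (from_nat_into \<D> i) \<longleftrightarrow> y \<in> E (from_nat_into \<D> i)"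
    show "same_leg x y"
    proof (rule ccontr)
      assume n: "\<not> same_leg x y"
      obtain n where lev: "x \<in> level n" "y \<in> level n" using level_exists2 x y by blast
      obtain U where U: "clopen_in (level n) U" "{x} \<subseteq> U" "U \<inter> {y} = {}"
      proof (rule compact_separation[OF compact_level])
        show "C \<inter> {x} = {} \<or> C \<inter> {y} = {}" if "connected C" "C \<subseteq> level n" for C
          using connected_level[OF that, of x y] n by auto
      qed (use lev in \<open>auto intro!: closed_subset\<close>)
      obtain i where i: "from_nat_into \<D> i = (n, U)"
        using from_nat_into_surj[OF \<open>countable \<D>\<close>, of "(n, U)"] U by (auto simp: \<D>_def)
      then show False using eq[of i] E[OF U(1)] U lev by auto
    qed
  qed
qed

end

section \<open>Coordinates on a smooth fan\<close>

definition hypograph :: "'b set \<Rightarrow> ('b \<Rightarrow> real) \<Rightarrow> ('b \<times> real) set" where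
  "hypograph C f = {(c, u). c \<in> C \<and> 0 \<le> u \<and> u \<le> f c}"

lemma mem_hypograph [simp]: "(c, u) \<in> hypograph C f \<longleftrightarrow> c \<in> C \<and> 0 \<le> u \<and> u \<le> f c"
  by (simp add: hypograph_def)

text \<open>Zero-dimensionality is encoded by small clopen neighbourhoods and upper semicontinuity
  by compactness of the hypograph. The value 0 is permitted because codes of shrinking legs may
  converge to a code that belongs to no leg; positivity on a dense set still makes the supremum over
  every nonempty clopen set positive.\<close>

locale usc_positive =
  fixes C :: "'b::metric_space set" and f :: "'b \<Rightarrow> real"
  assumes compact_C: "compact C"
    and small_clopen: "\<And>c e. c \<in> C \<Longrightarrow> 0 < e \<Longrightarrow> \<exists>U. clopen_in C U \<and> c \<in> U \<and> U \<subseteq> ball c e"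
    and f_nonneg: "\<And>c. c \<in> C \<Longrightarrow> 0 \<le> f c"
    and compact_hypograph: "compact (hypograph C f)"
    and f_pos_dense: "\<And>c e. c \<in> C \<Longrightarrow> 0 < e \<Longrightarrow> \<exists>d\<in>C. dist d c < e \<and> 0 < f d"

locale fan_coordinates = smooth_fan X T + usc_positive C f
  for X :: "'a::metric_space set" and T and C :: "'b::metric_space set" and f +
  fixes \<Phi> :: "'b \<times> real \<Rightarrow> 'a"
  assumes cont_\<Phi>: "continuous_on (hypograph C f) \<Phi>"
    and \<Phi>_image: "\<Phi> ` hypograph C f = X"
    and \<Phi>_top: "\<And>c u. (c, u) \<in> hypograph C f \<Longrightarrow> \<Phi> (c, u) = T \<longleftrightarrow> u = 0"
    and \<Phi>_order: "\<And>c u d v. \<lbrakk>(c, u) \<in> hypograph C f; (d, v) \<in> hypograph C f; 0 < u; 0 < v\<rbrakk>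
      \<Longrightarrow> \<Phi> (c, u) \<in> seg T (\<Phi> (d, v)) \<longleftrightarrow> c = d \<and> u \<le> v"

lemma (in fan_set) ex_not_T: "\<exists>y\<in>X. y \<noteq> T"
proof -
  have "2 < point_order X T" using T_ramification by (simp add: ramification_point_def)
  then obtain F where F: "arcs_disjoint_beyond X T F" "2 < enat (card F)"
    unfolding point_order_def less_SUP_iff by blast
  then have "F \<noteq> {}" by auto
  then obtain A where "A \<in> F" by blast
  moreover have "\<forall>A\<in>F. A \<subseteq> X \<and> (\<exists>q. arc_joining T q A)"
    using F(1) unfolding arcs_disjoint_beyond_def by (rule conjunct1)
  ultimately obtain q where q: "A \<subseteq> X" "arc_joining T q A" by metis
  then have "q \<in> X" "q \<noteq> T" using arc_joining_ends[OF q(2)] by auto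
  then show ?thesis by blast
qed

context smooth_fan_height
begin

text \<open>The code of a point is its membership pattern in the separating sequence. Continuity is
  claimed on levels only, because every neighbourhood of \<open>T\<close> meets legs of different
  codes.\<close>

lemma leg_code:
  obtains \<pi> :: "'a \<Rightarrow> nat \<Rightarrow> real" where "\<And>x i. \<pi> x i \<in> {0, 1}" "\<And>n. continuous_on (level n) \<pi>"
    "\<And>x y. \<lbrakk>x \<in> X - {T}; y \<in> X - {T}\<rbrakk> \<Longrightarrow> \<pi> x = \<pi> y \<longleftrightarrow> same_leg x y"
proof -
  obtain A :: "nat \<Rightarrow> 'a set" where A: "\<And>i. leg_clopen (A i)"
    "\<And>x y. \<lbrakk>x \<in> X - {T}; y \<in> X - {T}; \<And>i. x \<in> A i \<longleftrightarrow> y \<in> A i\<rbrakk> \<Longrightarrow> same_leg x y"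
    using leg_clopen_sequence by blast
  define \<pi> :: "'a \<Rightarrow> nat \<Rightarrow> real" where "\<pi> = (\<lambda>x i. if x \<in> A i then 1 else 0)"
  show ?thesis
  proof
    show "\<pi> x i \<in> {0, 1}" for x i by (simp add: \<pi>_def)
    show "continuous_on (level n) \<pi>" for n
    proof (rule continuous_on_coordinatewise_then_product)
      show "continuous_on (level n) (\<lambda>x. \<pi> x i)" for i
        unfolding \<pi>_def
        using A(1)[of i] by (intro continuous_on_indicator_clopen) (simp add: leg_clopen_def)
    qed
    fix x y assume x: "x \<in> X - {T}" and y: "y \<in> X - {T}"
    show "\<pi> x = \<pi> y \<longleftrightarrow> same_leg x y"
    proof
      assume "\<pi> x = \<pi> y"
      then have "\<pi> x i = \<pi> y i" for i by simp
      then have "x \<in> A i \<longleftrightarrow> y \<in> A i" for i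
        unfolding \<pi>_def by (metis zero_neq_one)
      then show "same_leg x y" using A(2) x y by blast
    next
      assume s: "same_leg x y"
      have "x \<in> A i \<longleftrightarrow> y \<in> A i" for i
        using leg_clopen_saturated[OF A(1) _ _ _ _ s] x y by blast
      then show "\<pi> x = \<pi> y" by (simp add: \<pi>_def)
    qed
  qed
qed

text \<open>Points above \<open>x\<close> form a closed set by semicontinuity of arcs; a point of
  maximal height in it dominates the whole leg.\<close>

lemma leg_top:
  assumes x: "x \<in> X" "x \<noteq> T"
  obtains e where "e \<in> X" "e \<noteq> T" "same_leg x e"
    "\<And>y. y \<in> X \<Longrightarrow> y \<noteq> T \<Longrightarrow> same_leg x y \<Longrightarrow> y \<in> seg T e"
proof -
  define S where "S = {y \<in> X. x \<in> seg T y}"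
  have "closed S"
    unfolding closed_sequential_limits
  proof (intro allI impI, elim conjE)
    fix a l assume a: "\<forall>n. a n \<in> S" "a \<longlonglongrightarrow> l"
    then have aS: "a n \<in> X" "x \<in> seg T (a n)" for n by (auto simp: S_def)
    have "l \<in> X" using closed_sequentially[OF closed_X _ a(2)] aS by blast
    moreover have "x \<in> seg T l" using seg_T_limit[OF aS tendsto_const a(2)] .
    ultimately show "l \<in> S" by (simp add: S_def)
  qed
  then have "compact (X \<inter> S)" using compact_X by (rule compact_Int_closed[rotated])
  then have "compact S" unfolding S_def by (simp add: Int_def)
  moreover have xS: "x \<in> S" using x seg_ends[OF T_in x(1)] by (simp add: S_def)
  moreover have "continuous_on S h" using cont_h by (rule continuous_on_subset) (auto simp: S_def)
  ultimately obtain e where e: "e \<in> S" "\<And>y. y \<in> S \<Longrightarrow> h y \<le> h e"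
    using continuous_attains_sup[of S h] by blast
  have eX: "e \<in> X" "x \<in> seg T e" using e by (auto simp: S_def)
  have "h x \<le> h e" using e(2) xS by blast
  then have eT: "e \<noteq> T" using h_pos[OF x] by auto
  have se: "same_leg x e" using eX by (simp add: same_leg_def)
  show ?thesis
  proof (rule that[OF eX(1) eT se])
    fix y assume y: "y \<in> X" "y \<noteq> T" "same_leg x y"
    have s: "same_leg y e"
      using same_leg_trans[OF y(1) x(1) eX(1) x(2) same_leg_sym[OF y(3)] se] .
    show "y \<in> seg T e"
    proof (cases "x \<in> seg T y")
      case True
      then have "h y \<le> h e" using e(2) y by (simp add: S_def)
      then show ?thesis using same_leg_height[OF y(1) eX(1) s] by simp
    next
      case False
      then have "y \<in> seg T x" using y by (simp add: same_leg_def)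
      then show ?thesis using seg_trans[OF T_in eX(1) eX(2)] by blast
    qed
  qed
qed

theorem coordinates:
  obtains C :: "(nat \<Rightarrow> real) set" and f and \<Phi> where "fan_coordinates X T C f \<Phi>"
proof -
  obtain \<pi> :: "'a \<Rightarrow> nat \<Rightarrow> real" where \<pi>01: "\<And>x i. \<pi> x i \<in> {0, 1}"
    and cont_\<pi>: "\<And>n. continuous_on (level n) \<pi>"
    and \<pi>_eq: "\<And>x y. \<lbrakk>x \<in> X - {T}; y \<in> X - {T}\<rbrakk> \<Longrightarrow> \<pi> x = \<pi> y \<longleftrightarrow> same_leg x y"
    using leg_code by blast
  \<comment> \<open>The closure is taken to obtain a compact index space. It may add limits of codes
    of legs that shrink to \<open>T\<close>.\<close>
  define C where "C = closure (\<pi> ` (X - {T}))"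
  \<comment> \<open>The inserted 0 is the length assigned to codes of no leg. On a genuine leg all
    heights are positive, so it does not change the supremum.\<close>
  define f where "f = (\<lambda>c. Sup (insert 0 (h ` {x \<in> X - {T}. \<pi> x = c})))"
  define Z where "Z = hypograph C f"
  have f_leg: "f c = h e"
    if e: "e \<in> X - {T}" "\<pi> e = c" "\<And>y. y \<in> X - {T} \<Longrightarrow> \<pi> y = c \<Longrightarrow> y \<in> seg T e" for c e
  proof -
    have "Sup (insert 0 (h ` {x \<in> X - {T}. \<pi> x = c})) = h e"
      using e h_nonneg[of e] h_le[of e] by (intro cSup_eq_maximum) auto
    then show ?thesis by (simp add: f_def)
  qed
  have top: "\<exists>e. e \<in> X - {T} \<and> \<pi> e = \<pi> x \<and> (\<forall>y\<in>X - {T}. \<pi> y = \<pi> x \<longrightarrow> y \<in> seg T e) \<and> f (\<pi> x) = h e"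
    if x: "x \<in> X - {T}" for x
  proof -
    obtain e where e: "e \<in> X" "e \<noteq> T" "same_leg x e"
      "\<And>y. y \<in> X \<Longrightarrow> y \<noteq> T \<Longrightarrow> same_leg x y \<Longrightarrow> y \<in> seg T e"
      using leg_top[of x] x by blast
    have e1: "e \<in> X - {T}" using e by blast
    have e2: "\<pi> e = \<pi> x" using \<pi>_eq[OF x e1] e(3) by simp
    have e3: "y \<in> seg T e" if "y \<in> X - {T}" "\<pi> y = \<pi> x" for y
      using e(4) \<pi>_eq[OF x that(1)] that by simp
    show ?thesis using e1 e2 e3 f_leg[OF e1 e2] by blast
  qed
  have f_empty: "f c = 0" if "c \<notin> \<pi> ` (X - {T})" for c
  proof -
    have "{x \<in> X - {T}. \<pi> x = c} = {}" using that by blast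
    then show ?thesis unfolding f_def by (simp only: image_empty cSup_singleton)
  qed
  have f_pos: "0 < f (\<pi> x)" if "x \<in> X - {T}" for x
    using top[OF that] h_pos by force
  have f_nn: "0 \<le> f c" for c
    using f_pos f_empty[of c] by (cases "c \<in> \<pi> ` (X - {T})") (auto intro: less_imp_le)
  have inC: "\<pi> x \<in> C" if "x \<in> X - {T}" for x
    unfolding C_def by (rule subsetD[OF closure_subset imageI[OF that]])
  have inZ: "(\<pi> x, h x) \<in> Z" if x: "x \<in> X - {T}" for x
  proof -
    obtain e where e: "e \<in> X - {T}" "\<forall>y\<in>X - {T}. \<pi> y = \<pi> x \<longrightarrow> y \<in> seg T e" "f (\<pi> x) = h e"
      using top[OF x] by blast
    then have "h x \<le> f (\<pi> x)" using h_le[of e x] x by auto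
    then show ?thesis using inC[OF x] h_nonneg[of x] x by (simp add: Z_def)
  qed
  \<comment> \<open>The height takes all intermediate values along the arc from \<open>T\<close> to
    the top of the leg with code \<open>c\<close>.\<close>
  have surj: "\<exists>x\<in>X - {T}. \<pi> x = c \<and> h x = u" if z: "(c, u) \<in> Z" "0 < u" for c u
  proof -
    have uc: "0 < u" "u \<le> f c" using z by (auto simp: Z_def)
    then have "c \<in> \<pi> ` (X - {T})" using f_empty[of c] by force
    then obtain x where x: "x \<in> X - {T}" "c = \<pi> x" by blast
    obtain e where e: "e \<in> X - {T}" "\<pi> e = c" "f c = h e"
      using top[OF x(1)] x(2) by blast
    have eX: "e \<in> X" using e by blast
    have "connected (h ` seg T e)"
      using seg_continuum[OF T_in eX] continuous_on_subset[OF cont_h seg_subset[OF T_in eX]]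
      by (auto simp: continuum_def intro: connected_continuous_image)
    then have "{h T..h e} \<subseteq> h ` seg T e"
      by (rule connected_contains_Icc[OF _ imageI[OF seg_ends(1)[OF T_in eX]] imageI[OF seg_ends(2)[OF T_in eX]]])
    moreover have "u \<in> {h T..h e}" using uc e by simp
    ultimately have "u \<in> h ` seg T e" by (rule subsetD)
    then obtain y where y: "y \<in> seg T e" "h y = u" by blast
    have yX: "y \<in> X - {T}" using seg_in_X[OF T_in eX y(1)] y(2) uc by auto
    have "same_leg y e" using y by (simp add: same_leg_def)
    then have "\<pi> y = c" using \<pi>_eq[OF yX e(1)] e by simp
    then show ?thesis using yX y by blast
  qed
  have uniq: "x = y" if xy: "x \<in> X - {T}" "y \<in> X - {T}" "\<pi> x = \<pi> y" "h x = h y" for x y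
  proof -
    have s: "same_leg x y" using \<pi>_eq xy by simp
    have "x \<in> seg T y" "y \<in> seg T x"
      using same_leg_height[of x y] same_leg_height[of y x] xy s same_leg_sym[OF s] by auto
    then show ?thesis using seg_antisym[OF T_in, of x y] xy by blast
  qed
  \<comment> \<open>Positivity of the limit height keeps almost all terms in one level, where the
    code is continuous. This identifies limits both for closedness of the hypograph and for
    continuity of \<open>\<Phi>\<close>.\<close>
  have limit: "l \<in> X - {T} \<and> \<pi> l = c \<and> h l = u"
    if xs: "\<And>n. x n \<in> X - {T}" "x \<longlonglongrightarrow> l" "(\<lambda>n. \<pi> (x n)) \<longlonglongrightarrow> c" "(\<lambda>n. h (x n)) \<longlonglongrightarrow> u" "0 < u"
    for x l c u
  proof -
    have lX: "l \<in> X" using closed_sequentially[OF closed_X _ xs(2)] xs(1) by blast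
    have "(\<lambda>n. h (x n)) \<longlonglongrightarrow> h l"
      using continuous_on_tendsto_compose[OF cont_h xs(2) lX] xs(1) by simp
    then have hl: "h l = u" using LIMSEQ_unique xs(4) by blast
    obtain k :: nat where k: "1 / Suc k < u" using nat_approx_posE[OF xs(5)] .
    have "\<forall>\<^sub>F n in sequentially. 1 / Suc k < h (x n)"
      using xs(4) k by (rule order_tendstoD)
    then obtain N where N: "\<And>n. n \<ge> N \<Longrightarrow> 1 / Suc k < h (x n)"
      by (auto simp: eventually_sequentially)
    have "\<forall>n. x (n + N) \<in> level k"
      using N xs(1) unfolding level_def by (auto intro: less_imp_le)
    moreover have "l \<in> level k" using lX hl k by (simp add: level_def)
    moreover have "(\<lambda>n. x (n + N)) \<longlonglongrightarrow> l" using xs(2) by (rule LIMSEQ_ignore_initial_segment)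
    ultimately have "(\<lambda>n. \<pi> (x (n + N))) \<longlonglongrightarrow> \<pi> l"
      by (intro continuous_on_tendsto_compose[OF cont_\<pi>]) auto
    moreover have "(\<lambda>n. \<pi> (x (n + N))) \<longlonglongrightarrow> c" using xs(3) by (rule LIMSEQ_ignore_initial_segment)
    ultimately have "\<pi> l = c" using LIMSEQ_unique by blast
    then show ?thesis using lX hl xs(5) by auto
  qed
  have C01: "C \<subseteq> {f. \<forall>i. f i \<in> {0, 1}}"
    unfolding C_def
    by (rule closure_minimal) (use \<pi>01 compact_imp_closed[OF compact_zero_one_sequences] in auto)
  have cC: "compact C"
    using compact_Int_closed[OF compact_zero_one_sequences closed_closure, of "\<pi> ` (X - {T})"] C01
    unfolding C_def by (simp add: inf.absorb2)
  have "compact (h ` X)" using cont_h compact_X by (rule compact_continuous_image)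
  then have "bdd_above (h ` X)" by (intro bounded_imp_bdd_above compact_imp_bounded)
  then obtain B where B: "\<And>x. x \<in> X \<Longrightarrow> h x \<le> B"
    unfolding bdd_above_def by blast
  have fB: "f c \<le> max 0 B" for c
  proof (cases "c \<in> \<pi> ` (X - {T})")
    case True
    then obtain x where x: "x \<in> X - {T}" "c = \<pi> x" by blast
    then obtain e where "e \<in> X - {T}" "f c = h e" using top[OF x(1)] by blast
    then show ?thesis using B[of e] by auto
  qed (simp add: f_empty)
  have "closed Z"
    unfolding closed_sequential_limits
  proof (intro allI impI, elim conjE)
    fix z w assume z: "\<forall>n. z n \<in> Z" "z \<longlonglongrightarrow> w"
    obtain c u where w: "w = (c, u)" by fastforce
    have fs: "(\<lambda>n. fst (z n)) \<longlonglongrightarrow> c" "(\<lambda>n. snd (z n)) \<longlonglongrightarrow> u"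
      using tendsto_fst[OF z(2)] tendsto_snd[OF z(2)] w by auto
    have zz: "fst (z n) \<in> C" "0 \<le> snd (z n)" "snd (z n) \<le> f (fst (z n))" for n
      using z(1) by (auto simp: Z_def hypograph_def case_prod_beta)
    have c: "c \<in> C" using closed_sequentially[OF compact_imp_closed[OF cC] _ fs(1)] zz by blast
    have u: "0 \<le> u" using LIMSEQ_le_const[OF fs(2)] zz by blast
    show "w \<in> Z"
    proof (cases "u = 0")
      case True
      then show ?thesis using c f_nn by (simp add: w Z_def)
    next
      case False
      then have u0: "0 < u" using u by simp
      then have "\<forall>\<^sub>F n in sequentially. 0 < snd (z n)" using order_tendstoD(1)[OF fs(2)] by blast
      then obtain N where N: "\<And>n. n \<ge> N \<Longrightarrow> 0 < snd (z n)" by (auto simp: eventually_sequentially)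
      have "\<exists>x\<in>X - {T}. \<pi> x = fst (z (n + N)) \<and> h x = snd (z (n + N))" for n
        using surj[of "fst (z (n + N))" "snd (z (n + N))"] z(1) N[of "n + N"] by simp
      then obtain x where x: "\<And>n. x n \<in> X - {T}" "\<And>n. \<pi> (x n) = fst (z (n + N))" "\<And>n. h (x n) = snd (z (n + N))"
        by metis
      have "\<forall>n. x n \<in> X" using x(1) by blast
      then obtain l s where s: "strict_mono s" "(x \<circ> s) \<longlonglongrightarrow> l"
        using compact_X unfolding compact_eq_seq_compact_metric by (metis seq_compactE)
      have p: "(\<lambda>n. \<pi> ((x \<circ> s) n)) \<longlonglongrightarrow> c" "(\<lambda>n. h ((x \<circ> s) n)) \<longlonglongrightarrow> u"
        using LIMSEQ_subseq_LIMSEQ[OF LIMSEQ_ignore_initial_segment[OF fs(1), of N] s(1)]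
          LIMSEQ_subseq_LIMSEQ[OF LIMSEQ_ignore_initial_segment[OF fs(2), of N] s(1)] x(2,3)
        by (auto simp: o_def)
      have "l \<in> X - {T} \<and> \<pi> l = c \<and> h l = u"
        by (rule limit[OF _ s(2) p u0]) (use x(1) in simp)
      then show ?thesis using inZ[of l] w by auto
    qed
  qed
  moreover have "Z \<subseteq> C \<times> {0..max 0 B}"
  proof
    fix z assume "z \<in> Z"
    then show "z \<in> C \<times> {0..max 0 B}"
      using fB[of "fst z"] by (cases z) (auto simp: Z_def)
  qed
  ultimately have cZ: "compact Z"
    using compact_Int_closed[OF compact_Times[OF cC compact_Icc], of Z 0 "max 0 B"] by (simp add: inf.absorb2)
  \<comment> \<open>The base of the hypograph collapses to \<open>T\<close>; at positive height the
    choice is forced, since code and height determine the point.\<close>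
  define \<Phi> where "\<Phi> = (\<lambda>(c, u). if u = 0 then T else (SOME x. x \<in> X - {T} \<and> \<pi> x = c \<and> h x = u))"
  have \<Phi>0: "\<Phi> (c, 0) = T" for c by (simp add: \<Phi>_def)
  have \<Phi>: "\<Phi> (c, u) \<in> X - {T}" "\<pi> (\<Phi> (c, u)) = c" "h (\<Phi> (c, u)) = u"
    if z: "(c, u) \<in> Z" "0 < u" for c u
  proof -
    have "\<exists>x. x \<in> X - {T} \<and> \<pi> x = c \<and> h x = u" using surj[OF z] by blast
    from someI_ex[OF this] show "\<Phi> (c, u) \<in> X - {T}" "\<pi> (\<Phi> (c, u)) = c" "h (\<Phi> (c, u)) = u"
      using z by (auto simp: \<Phi>_def)
  qed
  have h\<Phi>: "h (\<Phi> z) = snd z" "\<Phi> z \<in> X" if "z \<in> Z" for z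
    using \<Phi>[of "fst z" "snd z"] that \<Phi>0 by (cases "snd z = 0"; cases z; force simp: Z_def)+
  have "fan_coordinates X T C f \<Phi>"
  proof unfold_locales
    show "compact C" using cC .
    show "\<exists>U. clopen_in C U \<and> c \<in> U \<and> U \<subseteq> ball c e" if "c \<in> C" "0 < e" for c e
      using small_clopen_zero_one[OF cC C01 that] by blast
    show "0 \<le> f c" for c by (rule f_nn)
    show "compact (hypograph C f)" using cZ by (simp add: Z_def)
    show "\<exists>d\<in>C. dist d c < e \<and> 0 < f d" if c: "c \<in> C" "0 < e" for c e
    proof -
      obtain x where "x \<in> X - {T}" "dist (\<pi> x) c < e"
        using c unfolding C_def closure_approachable by blast
      then show ?thesis using inC f_pos by blast
    qed
    show "continuous_on (hypograph C f) \<Phi>"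
      unfolding Z_def[symmetric]
    proof (rule continuous_on_compact_closed_graph[OF compact_X])
      show "\<Phi> ` Z \<subseteq> X" using h\<Phi> by blast
      fix z w l assume z: "\<And>n. z n \<in> Z" "z \<longlonglongrightarrow> w" and w: "w \<in> Z" and l: "(\<lambda>n. \<Phi> (z n)) \<longlonglongrightarrow> l"
      obtain c u where cu: "w = (c, u)" by fastforce
      have fs: "(\<lambda>n. fst (z n)) \<longlonglongrightarrow> c" "(\<lambda>n. snd (z n)) \<longlonglongrightarrow> u"
        using tendsto_fst[OF z(2)] tendsto_snd[OF z(2)] cu by auto
      have lX: "l \<in> X" using closed_sequentially[OF closed_X _ l] h\<Phi> z(1) by blast
      have "(\<lambda>n. h (\<Phi> (z n))) \<longlonglongrightarrow> h l"
        using continuous_on_tendsto_compose[OF cont_h l lX] h\<Phi> z(1) by simp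
      then have hl: "h l = u" using LIMSEQ_unique[OF _ fs(2)] h\<Phi>(1)[OF z(1)] by simp
      show "l = \<Phi> w"
      proof (cases "u = 0")
        case True
        then show ?thesis using hl h_zero[OF lX] \<Phi>0 cu by simp
      next
        case False
        then have u0: "0 < u" using hl h_nonneg[OF lX] by simp
        then have "\<forall>\<^sub>F n in sequentially. 0 < snd (z n)" using order_tendstoD(1)[OF fs(2)] by blast
        then obtain N where N: "\<And>n. n \<ge> N \<Longrightarrow> 0 < snd (z n)" by (auto simp: eventually_sequentially)
        have p: "\<Phi> (z (n + N)) \<in> X - {T}" "\<pi> (\<Phi> (z (n + N))) = fst (z (n + N))" for n
          using \<Phi>[of "fst (z (n + N))" "snd (z (n + N))"] z(1)[of "n + N"] N[of "n + N"] by auto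
        have "l \<in> X - {T} \<and> \<pi> l = c \<and> h l = u"
        proof (rule limit[OF p(1) LIMSEQ_ignore_initial_segment[OF l] _ _ u0])
          show "(\<lambda>n. \<pi> (\<Phi> (z (n + N)))) \<longlonglongrightarrow> c"
            using LIMSEQ_ignore_initial_segment[OF fs(1)] p(2) by simp
          show "(\<lambda>n. h (\<Phi> (z (n + N)))) \<longlonglongrightarrow> u"
            using LIMSEQ_ignore_initial_segment[OF fs(2)] h\<Phi>(1)[OF z(1)] by simp
        qed
        then show ?thesis using uniq[of l "\<Phi> w"] \<Phi>[of c u] w cu u0 by auto
      qed
    qed
    show "\<Phi> ` hypograph C f = X"
    proof
      show "\<Phi> ` hypograph C f \<subseteq> X" using h\<Phi> by (auto simp: Z_def[symmetric])
      show "X \<subseteq> \<Phi> ` hypograph C f"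
      proof
        fix x assume x: "x \<in> X"
        show "x \<in> \<Phi> ` hypograph C f"
        proof (cases "x = T")
          case True
          obtain y where "y \<in> X" "y \<noteq> T" using ex_not_T by blast
          then have "(\<pi> y, 0) \<in> Z" using inC[of y] f_nn by (simp add: Z_def)
          then show ?thesis using \<Phi>0[of "\<pi> y"] True by (metis Z_def image_eqI)
        next
          case False
          then have x': "x \<in> X - {T}" using x by blast
          have "h x > 0" using h_pos[OF x False] .
          then have "x = \<Phi> (\<pi> x, h x)" using uniq[OF x'] \<Phi>[OF inZ[OF x']] by simp
          then show ?thesis using inZ[OF x'] by (metis Z_def image_eqI)
        qed
      qed
    qed
    show "\<Phi> (c, u) = T \<longleftrightarrow> u = 0" if "(c, u) \<in> hypograph C f" for c u
      using \<Phi>0[of c] \<Phi>(1)[of c u] that by (cases "u = 0") (auto simp: Z_def)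
    show "\<Phi> (c, u) \<in> seg T (\<Phi> (d, v)) \<longleftrightarrow> c = d \<and> u \<le> v"
      if "(c, u) \<in> hypograph C f" "(d, v) \<in> hypograph C f" "0 < u" "0 < v" for c u d v
    proof -
      have x: "\<Phi> (c, u) \<in> X - {T}" "\<pi> (\<Phi> (c, u)) = c" "h (\<Phi> (c, u)) = u"
        and y: "\<Phi> (d, v) \<in> X - {T}" "\<pi> (\<Phi> (d, v)) = d" "h (\<Phi> (d, v)) = v"
        using \<Phi> that by (auto simp: Z_def)
      have s: "c = d \<longleftrightarrow> same_leg (\<Phi> (c, u)) (\<Phi> (d, v))"
        using \<pi>_eq[OF x(1) y(1)] x y by simp
      show ?thesis
      proof (cases "c = d")
        case True
        then show ?thesis using same_leg_height[of "\<Phi> (c, u)" "\<Phi> (d, v)"] s x y by auto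
      next
        case False
        then show ?thesis using s by (auto simp: same_leg_def)
      qed
    qed
  qed
  then show ?thesis by (rule that)
qed

end

section \<open>Lelek functions\<close>

text \<open>The condition says that the graph of \<open>f\<close> is dense below itself: as in the
  Lelek fan, the ends accumulate at every point of every leg.\<close>

definition lelek :: "'b::metric_space set \<Rightarrow> ('b \<Rightarrow> real) \<Rightarrow> bool" where
  "lelek C f \<longleftrightarrow> (\<forall>c\<in>C. \<forall>r e. 0 < r \<and> r < f c \<and> 0 < e \<longrightarrow> (\<exists>d\<in>C. dist d c < e \<and> \<bar>f d - r\<bar> < e))"

definition peak :: "('b \<Rightarrow> real) \<Rightarrow> 'b set \<Rightarrow> 'b \<Rightarrow> bool" where
  "peak f A a \<longleftrightarrow> a \<in> A \<and> (\<forall>x\<in>A. f x \<le> f a)"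

lemma Sup_peak: "peak f A a \<Longrightarrow> Sup (f ` A) = f a"
  unfolding peak_def by (intro cSup_eq_maximum) auto

lemma clopen_in_trans: "clopen_in C A \<Longrightarrow> clopen_in A B \<Longrightarrow> clopen_in C B"
  unfolding clopen_in_def using openin_trans closedin_trans by metis

lemma clopen_in_ball:
  assumes "clopen_in C U" "c \<in> U"
  obtains e where "e > 0" "\<And>d. d \<in> C \<Longrightarrow> dist d c < e \<Longrightarrow> d \<in> U"
proof -
  obtain V where V: "open V" "U = C \<inter> V" using assms(1) unfolding clopen_in_def openin_open by blast
  obtain e where e: "e > 0" "ball c e \<subseteq> V" using V assms(2) openE[of V c] by blast
  have "d \<in> U" if "d \<in> C" "dist d c < e" for d
    using that e(2) V(2) by (auto simp: dist_commute subset_eq)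
  then show ?thesis using that e(1) by blast
qed

context usc_positive
begin

text \<open>Otherwise some points \<open>d\<close> arbitrarily near \<open>c\<close> would have
  \<open>f d\<close> at least \<open>r\<close>. The points \<open>(d, r)\<close> lie in the
  hypograph, and so would their limit \<open>(c, r)\<close>, against \<open>f c < r\<close>.\<close>

lemma usc:
  assumes c: "c \<in> C" and r: "f c < r"
  obtains e where "e > 0" "\<And>d. d \<in> C \<Longrightarrow> dist d c < e \<Longrightarrow> f d < r"
proof (rule ccontr)
  assume n: "\<not> thesis"
  have "\<exists>d\<in>C. dist d c < 1 / Suc n \<and> r \<le> f d" for n :: nat
  proof (rule ccontr)
    assume "\<not> ?thesis"
    then have "\<And>d. d \<in> C \<Longrightarrow> dist d c < 1 / Suc n \<Longrightarrow> f d < r" by (meson not_le)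
    moreover have "0 < 1 / real (Suc n)" by simp
    ultimately show False using that n by blast
  qed
  then obtain d :: "nat \<Rightarrow> 'b" where d: "\<And>n. d n \<in> C" "\<And>n. dist (d n) c < 1 / Suc n" "\<And>n. r \<le> f (d n)"
    by metis
  have "(\<lambda>n. dist (d n) c) \<longlonglongrightarrow> 0"
  proof (rule tendsto_sandwich[OF _ _ tendsto_const])
    show "\<forall>\<^sub>F n in sequentially. dist (d n) c \<le> 1 / Suc n" using d(2) by (intro always_eventually allI less_imp_le)
    show "(\<lambda>n. 1 / real (Suc n)) \<longlonglongrightarrow> 0" using LIMSEQ_Suc[OF lim_1_over_n] by simp
  qed auto
  then have lim: "(\<lambda>n. (d n, r)) \<longlonglongrightarrow> (c, r)"
    using tendsto_dist_iff by (intro tendsto_Pair tendsto_const) blast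
  have mem: "(d n, r) \<in> hypograph C f" for n
    using d f_nonneg[OF c] r by (simp add: less_imp_le order.trans[of 0 "f c" r])
  have "(c, r) \<in> hypograph C f"
    by (rule closed_sequentially[OF compact_imp_closed[OF compact_hypograph] mem lim])
  then show False using r by simp
qed

lemma small_clopen_below:
  assumes "c \<in> C" "f c < r" "0 < e"
  obtains U where "clopen_in C U" "c \<in> U" "U \<subseteq> ball c e" "\<And>d. d \<in> U \<Longrightarrow> f d < r"
proof -
  obtain e' where e': "e' > 0" "\<And>d. d \<in> C \<Longrightarrow> dist d c < e' \<Longrightarrow> f d < r"
    using usc[OF assms(1,2)] by blast
  obtain U where U: "clopen_in C U" "c \<in> U" "U \<subseteq> ball c (min e e')"
    using small_clopen[OF assms(1), of "min e e'"] assms(3) e'(1) by auto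
  show ?thesis
  proof (rule that[OF U(1,2)])
    show "U \<subseteq> ball c e" using U(3) by auto
    show "f d < r" if "d \<in> U" for d
      using e'(2)[of d] subsetD[OF U(3) that] subsetD[OF clopen_in_subset[OF U(1)] that]
      by (simp add: dist_commute)
  qed
qed

text \<open>The second coordinate attains its maximum on the compact part of the hypograph over
  \<open>A\<close>.\<close>

lemma peak_exists:
  assumes A: "clopen_in C A" "A \<noteq> {}"
  obtains a where "peak f A a"
proof -
  have sub: "A \<subseteq> C" using clopen_in_subset[OF A(1)] .
  have "compact (hypograph C f \<inter> A \<times> UNIV)"
    using clopen_in_compact[OF compact_C A(1)]
    by (intro compact_Int_closed compact_hypograph closed_Times) (auto simp: compact_imp_closed)
  moreover obtain x where "x \<in> A" using A by blast
  then have "(x, 0) \<in> hypograph C f \<inter> A \<times> UNIV" using sub f_nonneg by auto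
  ultimately obtain z where z: "z \<in> hypograph C f \<inter> A \<times> UNIV"
    "\<And>y. y \<in> hypograph C f \<inter> A \<times> UNIV \<Longrightarrow> snd y \<le> snd z"
    using continuous_attains_sup[of "hypograph C f \<inter> A \<times> UNIV" snd] continuous_on_snd[OF continuous_on_id]
    by (metis empty_iff)
  have "f x \<le> f (fst z)" if x: "x \<in> A" for x
  proof -
    have "(x, f x) \<in> hypograph C f \<inter> A \<times> UNIV" using x sub f_nonneg by auto
    from z(2)[OF this] show ?thesis using z(1) by (cases z) auto
  qed
  moreover have "fst z \<in> A" using z(1) by auto
  ultimately have "peak f A (fst z)" by (simp add: peak_def)
  then show ?thesis by (rule that)
qed

text \<open>A clopen set contains points where \<open>f\<close> is positive, by density. This is
  what makes logarithms of suprema over nonempty clopen sets meaningful.\<close>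

lemma peak_pos:
  assumes A: "clopen_in C A" and p: "peak f A a"
  shows "0 < f a"
proof -
  have a: "a \<in> A" "a \<in> C" using p clopen_in_subset[OF A] by (auto simp: peak_def)
  obtain e where e: "e > 0" "\<And>d. d \<in> C \<Longrightarrow> dist d a < e \<Longrightarrow> d \<in> A"
    using clopen_in_ball[OF A a(1)] by blast
  obtain d where "d \<in> C" "dist d a < e" "0 < f d" using f_pos_dense[OF a(2) e(1)] by blast
  then show ?thesis using e(2) p unfolding peak_def by force
qed

text \<open>The blocks are the atoms of a finite cover by small clopen sets: points with the same
  membership pattern form one block.\<close>

lemma small_partition:
  assumes A: "clopen_in C A" and e: "0 < e"
  obtains \<A> where "finite \<A>" "\<Union>\<A> = A" "\<forall>B\<in>\<A>. clopen_in A B \<and> B \<noteq> {} \<and> (\<exists>x. B \<subseteq> ball x e)"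
    "\<forall>B\<in>\<A>. \<forall>B'\<in>\<A>. B \<noteq> B' \<longrightarrow> B \<inter> B' = {}"
proof -
  have sub: "A \<subseteq> C" using clopen_in_subset[OF A] .
  define \<U> where "\<U> = {U. clopen_in A U \<and> (\<exists>x. U \<subseteq> ball x e)}"
  have "A \<subseteq> \<Union>\<U>"
  proof
    fix x assume x: "x \<in> A"
    then obtain U where U: "clopen_in C U" "x \<in> U" "U \<subseteq> ball x e" using small_clopen[of x e] sub e by blast
    have "clopen_in A (U \<inter> A)" using clopen_in_restrict[OF U(1) sub] .
    then have "U \<inter> A \<in> \<U>" using U(3) by (auto simp: \<U>_def)
    then show "x \<in> \<Union>\<U>" using U x by blast
  qed
  moreover have "compact A" using clopen_in_compact[OF compact_C A] .
  moreover have "\<forall>U\<in>\<U>. openin (top_of_set A) U" by (simp add: \<U>_def clopen_in_def)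
  ultimately obtain \<F> where \<F>: "\<F> \<subseteq> \<U>" "finite \<F>" "A \<subseteq> \<Union>\<F>"
    unfolding compact_eq_openin_cover[of A] by metis
  define cell where "cell = (\<lambda>x. {y \<in> A. \<forall>U\<in>\<F>. y \<in> U \<longleftrightarrow> x \<in> U})"
  have cl: "clopen_in A {y \<in> A. \<forall>U\<in>\<G>. y \<in> U \<longleftrightarrow> x \<in> U}" if "finite \<G>" "\<G> \<subseteq> \<U>" for \<G> x
    using that
  proof (induction \<G>)
    case (insert V \<G>)
    have V: "clopen_in A V" using insert.prems by (auto simp: \<U>_def)
    have eq: "{y \<in> A. \<forall>U\<in>insert V \<G>. y \<in> U \<longleftrightarrow> x \<in> U}
        = {y \<in> A. \<forall>U\<in>\<G>. y \<in> U \<longleftrightarrow> x \<in> U} \<inter> (if x \<in> V then V else A - V)"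
      using clopen_in_subset[OF V] by auto
    show ?case
      unfolding eq using insert V by (intro clopen_in_Int) (auto intro: clopen_in_Diff)
  qed simp
  show ?thesis
  proof
    have "cell ` A \<subseteq> (\<lambda>\<G>. {y \<in> A. {U \<in> \<F>. y \<in> U} = \<G>}) ` Pow \<F>"
    proof
      fix B assume "B \<in> cell ` A"
      then obtain x where "B = cell x" by blast
      then have "B = {y \<in> A. {U \<in> \<F>. y \<in> U} = {U \<in> \<F>. x \<in> U}}" by (auto simp: cell_def)
      then show "B \<in> (\<lambda>\<G>. {y \<in> A. {U \<in> \<F>. y \<in> U} = \<G>}) ` Pow \<F>" by blast
    qed
    then show "finite (cell ` A)" using \<F>(2) finite_surj[of "Pow \<F>"] by simp
    show "\<Union> (cell ` A) = A" by (auto simp: cell_def)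
    show "\<forall>B\<in>cell ` A. clopen_in A B \<and> B \<noteq> {} \<and> (\<exists>x. B \<subseteq> ball x e)"
    proof
      fix B assume B: "B \<in> cell ` A"
      obtain x where x: "x \<in> A" "B = cell x" using B by blast
      obtain U where U: "U \<in> \<F>" "x \<in> U" using \<F>(3) x by blast
      then have "B \<subseteq> U" using x by (auto simp: cell_def)
      moreover obtain y where "U \<subseteq> ball y e" using U \<F>(1) by (auto simp: \<U>_def)
      moreover have "clopen_in A B" using cl[OF \<F>(2,1)] x by (simp add: cell_def)
      moreover have "x \<in> B" using x by (simp add: cell_def)
      ultimately show "clopen_in A B \<and> B \<noteq> {} \<and> (\<exists>x. B \<subseteq> ball x e)" by blast
    qed
    show "\<forall>B\<in>cell ` A. \<forall>B'\<in>cell ` A. B \<noteq> B' \<longrightarrow> B \<inter> B' = {}"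
    proof (intro ballI impI, rule ccontr)
      fix B B' assume BB: "B \<in> cell ` A" "B' \<in> cell ` A" "B \<noteq> B'"
      assume "B \<inter> B' \<noteq> {}"
      then obtain z x y where z: "z \<in> cell x" "z \<in> cell y" "B = cell x" "B' = cell y" using BB by blast
      then have "cell x = cell y" by (auto simp: cell_def)
      then show False using BB z by simp
    qed
  qed
qed

text \<open>Clopen pieces with prescribed approximate suprema can be carved out of every neighbourhood
  of a peak; this is where the Lelek property enters.\<close>

lemma lelek_pieces:
  assumes lel: "lelek C f" and B: "clopen_in C B" "b \<in> B"
    and I: "finite I" "\<And>i. i \<in> I \<Longrightarrow> 0 \<le> lo i \<and> lo i < hi i \<and> lo i < f b"
  shows "\<exists>V. (\<forall>i\<in>I. clopen_in C (V i) \<and> V i \<subseteq> B \<and> b \<notin> V i \<and> (\<exists>d\<in>V i. lo i < f d) \<and> (\<forall>d\<in>V i. f d < hi i))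
    \<and> (\<forall>i\<in>I. \<forall>j\<in>I. i \<noteq> j \<longrightarrow> V i \<inter> V j = {})"
  using I
proof (induction I)
  case (insert i I)
  have "\<And>j. j \<in> I \<Longrightarrow> 0 \<le> lo j \<and> lo j < hi j \<and> lo j < f b" using insert.prems by simp
  from insert.IH[OF this] obtain V where
    V0: "(\<forall>i\<in>I. clopen_in C (V i) \<and> V i \<subseteq> B \<and> b \<notin> V i \<and> (\<exists>d\<in>V i. lo i < f d) \<and> (\<forall>d\<in>V i. f d < hi i))
      \<and> (\<forall>i\<in>I. \<forall>j\<in>I. i \<noteq> j \<longrightarrow> V i \<inter> V j = {})"
    by (rule exE)
  note V = bspec[OF conjunct1[OF V0]] bspec[OF bspec[OF conjunct2[OF V0]], rule_format]
  define W where "W = B - (\<Union>j\<in>I. V j)"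
  have "clopen_in C (B - (\<Union>j\<in>J. V j))" if "finite J" "J \<subseteq> I" for J
    using that
  proof (induction J)
    case (insert j J)
    have "B - (\<Union>j\<in>insert j J. V j) = (B - (\<Union>j\<in>J. V j)) - V j" by blast
    then show ?case using insert V(1)[of j] by (auto intro!: clopen_in_Diff)
  qed (simp add: B)
  then have W: "clopen_in C W" using insert.hyps by (simp add: W_def)
  have bW: "b \<in> W" using B V(1) by (auto simp: W_def)
  have bC: "b \<in> C" using clopen_in_subset[OF W] bW by blast
  \<comment> \<open>Aiming below \<open>f b\<close> as well as below \<open>hi i\<close> makes the
    value at the new point differ from \<open>f b\<close>, so the new point is not
    \<open>b\<close>.\<close>
  define m where "m = min (hi i) (f b)"
  have lom: "0 \<le> lo i" "lo i < m" using insert.prems[of i] by (auto simp: m_def)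
  define r where "r = (lo i + m) / 2"
  have r: "0 < r" "r < f b" "lo i < r" "r < m" using lom by (auto simp: r_def m_def)
  obtain e where e: "e > 0" "\<And>d. d \<in> C \<Longrightarrow> dist d b < e \<Longrightarrow> d \<in> W" using clopen_in_ball[OF W bW] by blast
  define \<delta> where "\<delta> = min e (min (r - lo i) (m - r))"
  have \<delta>: "\<delta> > 0" using e r by (simp add: \<delta>_def)
  obtain d where d: "d \<in> C" "dist d b < \<delta>" "\<bar>f d - r\<bar> < \<delta>"
    using lel bC r \<delta> unfolding lelek_def by metis
  have fd: "lo i < f d" "f d < hi i" "f d < f b" using d(3) by (auto simp: \<delta>_def m_def)
  then have db: "d \<noteq> b" by auto
  have dW: "d \<in> W" using e(2) d by (simp add: \<delta>_def)
  \<comment> \<open>The radius \<open>dist d b\<close> of the open ball keeps \<open>b\<close>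
    itself outside the carved piece.\<close>
  obtain U where U: "clopen_in C U" "d \<in> U" "U \<subseteq> ball d (dist d b)" "\<And>x. x \<in> U \<Longrightarrow> f x < hi i"
    using small_clopen_below[OF d(1) fd(2), of "dist d b"] db by auto
  define V' where "V' = V(i := U \<inter> W)"
  have i: "clopen_in C (V' i)" "V' i \<subseteq> B" "b \<notin> V' i" "d \<in> V' i" "\<forall>d\<in>V' i. f d < hi i"
    using U W dW clopen_in_Int by (auto simp: V'_def W_def)
  have same: "V' j = V j" if "j \<in> I" for j using that insert.hyps by (auto simp: V'_def)
  have disj: "V' i \<inter> V' j = {}" if "j \<in> I" for j
    using that same[OF that] by (auto simp: V'_def W_def)
  show ?case
  proof (intro exI[of _ V'] conjI ballI impI)
    fix j assume j: "j \<in> insert i I"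
    show "clopen_in C (V' j)" "V' j \<subseteq> B" "b \<notin> V' j" "\<exists>d\<in>V' j. lo j < f d"
      using j i fd V(1)[of j] same[of j] by auto
    show "f x < hi j" if "x \<in> V' j" for x
      using j i V(1)[of j] same[of j] that by auto
    show "V' j \<inter> V' k = {}" if "k \<in> insert i I" "j \<noteq> k" for k
      using j that disj[of j] disj[of k] V(2)[of j k] same[of j] same[of k] by (auto simp: Int_commute)
  qed
qed auto

end

section \<open>Matched clopen partitions for two Lelek functions\<close>

definition log_ratio :: "('b \<Rightarrow> real) \<Rightarrow> ('c \<Rightarrow> real) \<Rightarrow> 'b set \<times> 'c set \<Rightarrow> real" where
  "log_ratio f g P = ln (Sup (g ` snd P)) - ln (Sup (f ` fst P))"

lemma log_ratio_swap: "log_ratio g f (prod.swap P) = - log_ratio f g P"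
  by (simp add: log_ratio_def)

text \<open>A set of pairs encodes a bijection between two clopen partitions. The last clause ties
  \<open>c\<close> to \<open>d\<close> at every stage, so that the limit map sends \<open>c\<close>
  to \<open>d\<close>.\<close>

definition matching :: "'b::metric_space set \<Rightarrow> 'c::metric_space set \<Rightarrow> 'b \<Rightarrow> 'c \<Rightarrow> ('b set \<times> 'c set) set \<Rightarrow> bool" where
  "matching C D c d \<P> \<longleftrightarrow>
     (\<forall>P\<in>\<P>. clopen_in C (fst P) \<and> clopen_in D (snd P) \<and> fst P \<noteq> {} \<and> snd P \<noteq> {}) \<and>
     \<Union>(fst ` \<P>) = C \<and> \<Union>(snd ` \<P>) = D \<and>
     (\<forall>P\<in>\<P>. \<forall>Q\<in>\<P>. P \<noteq> Q \<longrightarrow> fst P \<inter> fst Q = {} \<and> snd P \<inter> snd Q = {}) \<and>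
     (\<exists>P\<in>\<P>. c \<in> fst P \<and> d \<in> snd P)"

text \<open>With logarithms the errors of successive refinements add up, so a geometric choice of
  \<open>e\<close> makes the ratios converge uniformly.\<close>

definition refines :: "('b \<Rightarrow> real) \<Rightarrow> ('c \<Rightarrow> real) \<Rightarrow> real \<Rightarrow> ('b set \<times> 'c set) set \<Rightarrow> ('b set \<times> 'c set) set \<Rightarrow> bool" where
  "refines f g e \<Q> \<P> \<longleftrightarrow> (\<forall>Q\<in>\<Q>. \<exists>P\<in>\<P>. fst Q \<subseteq> fst P \<and> snd Q \<subseteq> snd P \<and>
     \<bar>log_ratio f g Q - log_ratio f g P\<bar> < e)"

lemma matching_swap: "matching C D c d \<P> \<Longrightarrow> matching D C d c (prod.swap ` \<P>)"
proof -
  assume M: "matching C D c d \<P>"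
  have eq: "fst ` prod.swap ` \<P> = snd ` \<P>" "snd ` prod.swap ` \<P> = fst ` \<P>"
    by (simp_all add: image_image)
  have inj: "prod.swap P = prod.swap Q \<longleftrightarrow> P = Q" for P Q :: "'a set \<times> 'b set"
    by (metis swap_swap)
  show ?thesis
    unfolding matching_def eq ball_simps(9) bex_simps(7) fst_swap snd_swap inj
    using M unfolding matching_def by (intro conjI; blast)
qed

lemma refines_swap: "refines f g e \<Q> \<P> \<Longrightarrow> refines g f e (prod.swap ` \<Q>) (prod.swap ` \<P>)"
  unfolding refines_def ball_simps(9) bex_simps(7) fst_swap snd_swap log_ratio_swap
  by (simp add: abs_minus_commute conj_left_commute)

lemma refines_trans:
  assumes "refines f g e \<R> \<Q>" "refines f g e' \<Q> \<P>"
  shows "refines f g (e + e') \<R> \<P>"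
  unfolding refines_def
proof
  fix R assume "R \<in> \<R>"
  then obtain Q where Q: "Q \<in> \<Q>" "fst R \<subseteq> fst Q" "snd R \<subseteq> snd Q" "\<bar>log_ratio f g R - log_ratio f g Q\<bar> < e"
    using assms(1) unfolding refines_def by meson
  then obtain P where P: "P \<in> \<P>" "fst Q \<subseteq> fst P" "snd Q \<subseteq> snd P" "\<bar>log_ratio f g Q - log_ratio f g P\<bar> < e'"
    using assms(2) unfolding refines_def by meson
  have "\<bar>log_ratio f g R - log_ratio f g P\<bar> < e + e'" using P(4) Q(4) by linarith
  then show "\<exists>P\<in>\<P>. fst R \<subseteq> fst P \<and> snd R \<subseteq> snd P \<and> \<bar>log_ratio f g R - log_ratio f g P\<bar> < e + e'"
    using P Q by blast
qed

lemma matching_unique_fst: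
  assumes "matching C D c d \<P>" "P \<in> \<P>" "Q \<in> \<P>" "x \<in> fst P" "x \<in> fst Q"
  shows "P = Q"
  using assms unfolding matching_def by blast

lemma matching_ex_fst:
  assumes "matching C D c d \<P>" "x \<in> C"
  shows "\<exists>P\<in>\<P>. x \<in> fst P"
  using assms unfolding matching_def by blast

locale usc_pair = C: usc_positive C f + D: usc_positive D g
  for C :: "'b::metric_space set" and f :: "'b \<Rightarrow> real"
    and D :: "'c::metric_space set" and g :: "'c \<Rightarrow> real"
begin

text \<open>Every small block of \<open>A\<close> except the one at the peak \<open>a\<close>
  receives a piece of \<open>B\<close> whose supremum is scaled by nearly the same ratio. The block
  at \<open>a\<close> receives the rest of \<open>B\<close>, which still contains \<open>b\<close>;
  both of its suprema are unchanged, and so is its ratio.\<close>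

lemma refine_block:
  assumes lel: "lelek D g" and A: "clopen_in C A" "peak f A a" and B: "clopen_in D B" "peak g B b"
    and e: "0 < e"
  obtains \<Q> where "matching A B a b \<Q>" "refines f g e \<Q> {(A, B)}" "\<forall>Q\<in>\<Q>. \<exists>x. fst Q \<subseteq> ball x e"
proof -
  obtain \<A> where A0: "finite \<A>" "\<Union>\<A> = A" "\<forall>B\<in>\<A>. clopen_in A B \<and> B \<noteq> {} \<and> (\<exists>x. B \<subseteq> ball x e)"
    "\<forall>B\<in>\<A>. \<forall>B'\<in>\<A>. B \<noteq> B' \<longrightarrow> B \<inter> B' = {}"
    by (rule C.small_partition[OF A(1) e])
  note \<A> = A0(1,2) bspec[OF A0(3)] bspec[OF bspec[OF A0(4)], rule_format]
  have aA: "a \<in> A" and bB: "b \<in> B" using A B by (auto simp: peak_def)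
  obtain A1 where A1: "A1 \<in> \<A>" "a \<in> A1" using \<A>(2) aA by blast
  \<comment> \<open>The ratio of the parent pair, which every child pair should approximate.\<close>
  define \<beta> where "\<beta> = g b / f a"
  have fa: "0 < f a" using C.peak_pos[OF A] .
  have gb: "0 < g b" using D.peak_pos[OF B] .
  have \<beta>: "0 < \<beta>" using fa gb by (simp add: \<beta>_def)
  have clA: "clopen_in C S" if "S \<in> \<A>" for S using \<A>(3)[OF that] clopen_in_trans[OF A(1)] by blast
  have "\<forall>S\<in>\<A>. \<exists>p. peak f S p" using clA \<A>(3) C.peak_exists by metis
  then obtain p where p: "\<And>S. S \<in> \<A> \<Longrightarrow> peak f S (p S)" by metis
  define m where "m = (\<lambda>S. f (p S))"
  have m: "0 < m S" "m S \<le> f a" "Sup (f ` S) = m S" if "S \<in> \<A>" for S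
  proof -
    show "0 < m S" using C.peak_pos[OF clA[OF that] p[OF that]] by (simp add: m_def)
    have "p S \<in> A" using p[OF that] \<A>(2) that by (auto simp: peak_def)
    then show "m S \<le> f a" using A(2) by (auto simp: peak_def m_def)
    show "Sup (f ` S) = m S" using Sup_peak[OF p[OF that]] by (simp add: m_def)
  qed
  have supA: "Sup (f ` A) = f a" and supB: "Sup (g ` B) = g b" using Sup_peak[OF A(2)] Sup_peak[OF B(2)] by simp_all
  have supA1: "Sup (f ` A1) = f a"
    using A(2) A1 \<A>(2) by (intro Sup_peak) (auto simp: peak_def)
  define I where "I = \<A> - {A1}"
  \<comment> \<open>The window from \<open>exp (- e)\<close> to \<open>exp e\<close> is an error
    below \<open>e\<close> after taking logarithms. Its lower end stays below \<open>g b\<close>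
    because \<open>m S \<le> f a\<close>, as carving near the peak \<open>b\<close> demands.\<close>
  have bounds: "0 \<le> \<beta> * m S * exp (- e) \<and> \<beta> * m S * exp (- e) < \<beta> * m S * exp e \<and> \<beta> * m S * exp (- e) < g b"
    if "S \<in> I" for S
  proof -
    have mS: "0 < m S" "m S \<le> f a" using m that by (auto simp: I_def)
    then have pos: "0 < \<beta> * m S" using \<beta> by simp
    have "\<beta> * m S \<le> \<beta> * f a" using mS \<beta> by simp
    also have "\<dots> = g b" using fa by (simp add: \<beta>_def)
    finally have le: "\<beta> * m S \<le> g b" .
    have "\<beta> * m S * exp (- e) < \<beta> * m S * 1" using pos e by (intro mult_strict_left_mono) auto
    then have "\<beta> * m S * exp (- e) < g b" using le by linarith
    moreover have "\<beta> * m S * exp (- e) < \<beta> * m S * exp e" using pos e by (intro mult_strict_left_mono) auto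
    ultimately show ?thesis using pos by (simp add: less_imp_le)
  qed
  have "finite I" using \<A>(1) by (simp add: I_def)
  from D.lelek_pieces[OF lel B(1) bB this bounds]
  obtain V where V0: "(\<forall>i\<in>I. clopen_in D (V i) \<and> V i \<subseteq> B \<and> b \<notin> V i \<and> (\<exists>d\<in>V i. \<beta> * m i * exp (- e) < g d)
      \<and> (\<forall>d\<in>V i. g d < \<beta> * m i * exp e)) \<and> (\<forall>i\<in>I. \<forall>j\<in>I. i \<noteq> j \<longrightarrow> V i \<inter> V j = {})"
    by (rule exE)
  note V = bspec[OF conjunct1[OF V0]] bspec[OF bspec[OF conjunct2[OF V0]], rule_format]
  \<comment> \<open>The leftover becomes the partner of \<open>A1\<close>, so that the pieces cover
    \<open>B\<close> and the peak \<open>b\<close> is paired with the block of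
    \<open>a\<close>.\<close>
  define V1 where "V1 = B - (\<Union>S\<in>I. V S)"
  have "clopen_in D (B - (\<Union>j\<in>J. V j))" if "finite J" "J \<subseteq> I" for J
    using that
  proof (induction J)
    case (insert j J)
    have "B - (\<Union>j\<in>insert j J. V j) = (B - (\<Union>j\<in>J. V j)) - V j" by blast
    moreover have "clopen_in D (V j)" using insert.prems V(1)[of j] by blast
    ultimately show ?case using insert by (simp add: clopen_in_Diff)
  qed (simp add: B)
  then have V1: "clopen_in D V1" using \<open>finite I\<close> by (simp add: V1_def)
  have bV1: "b \<in> V1" using bB V(1) by (auto simp: V1_def)
  define W where "W = (\<lambda>S. if S = A1 then V1 else V S)"
  have W: "clopen_in D (W S)" "W S \<subseteq> B" "W S \<noteq> {}" if "S \<in> \<A>" for S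
  proof -
    show "clopen_in D (W S)" using V1 V(1)[of S] that by (auto simp: W_def I_def)
    show "W S \<subseteq> B" using V(1)[of S] that by (auto simp: W_def I_def V1_def)
    show "W S \<noteq> {}" using V(1)[of S] bV1 that by (auto simp: W_def I_def)
  qed
  have Wdisj: "W S \<inter> W S' = {}" if "S \<in> \<A>" "S' \<in> \<A>" "S \<noteq> S'" for S S'
    using that V(2)[of S S'] by (auto simp: W_def I_def V1_def)
  define \<Q> where "\<Q> = (\<lambda>S. (S, W S)) ` \<A>"
  show ?thesis
  proof
    show "matching A B a b \<Q>"
      unfolding matching_def
    proof (intro conjI ballI impI)
      fix P assume "P \<in> \<Q>"
      then obtain S where S: "S \<in> \<A>" "P = (S, W S)" by (auto simp: \<Q>_def)
      show "clopen_in A (fst P)" "fst P \<noteq> {}" "snd P \<noteq> {}" using S \<A>(3) W(3) by auto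
      have "clopen_in B (W S \<inter> B)"
        using clopen_in_restrict[OF W(1)[OF S(1)] clopen_in_subset[OF B(1)]] .
      then show "clopen_in B (snd P)" using S W(2)[OF S(1)] by (simp add: inf.absorb1)
    next
      show "\<Union> (fst ` \<Q>) = A" using \<A>(2) by (simp add: \<Q>_def image_image)
      show "\<Union> (snd ` \<Q>) = B"
      proof
        show "\<Union> (snd ` \<Q>) \<subseteq> B" using W(2) by (auto simp: \<Q>_def)
        show "B \<subseteq> \<Union> (snd ` \<Q>)"
        proof
          fix y assume "y \<in> B"
          then have "y \<in> V1 \<or> (\<exists>S\<in>I. y \<in> V S)" by (auto simp: V1_def)
          then show "y \<in> \<Union> (snd ` \<Q>)" using A1 by (auto simp: \<Q>_def W_def I_def image_image)
        qed
      qed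
      show "\<exists>P\<in>\<Q>. a \<in> fst P \<and> b \<in> snd P" using A1 bV1 by (auto simp: \<Q>_def W_def)
    next
      fix P Q assume PQ: "P \<in> \<Q>" "Q \<in> \<Q>" "P \<noteq> Q"
      then obtain S S' where S: "S \<in> \<A>" "S' \<in> \<A>" "P = (S, W S)" "Q = (S', W S')"
        by (auto simp: \<Q>_def)
      then have "S \<noteq> S'" using PQ by auto
      then show "fst P \<inter> fst Q = {}" "snd P \<inter> snd Q = {}" using S \<A>(4) Wdisj by auto
    qed
    have close: "\<bar>log_ratio f g (S, W S) - log_ratio f g (A, B)\<bar> < e" if S: "S \<in> \<A>" for S
    proof (cases "S = A1")
      case True
      have "Sup (g ` V1) = g b"
        using bV1 B(2) by (intro Sup_peak) (auto simp: peak_def V1_def)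
      then show ?thesis using e True supA supB supA1 by (simp add: log_ratio_def W_def)
    next
      case False
      then have SI: "S \<in> I" and WS: "W S = V S" using S by (auto simp: I_def W_def)
      obtain q where q: "peak g (W S) q" using D.peak_exists[OF W(1,3)[OF S]] .
      have supW: "Sup (g ` W S) = g q" using Sup_peak[OF q] .
      have qW: "q \<in> V S" using q WS by (simp add: peak_def)
      have up: "g q < \<beta> * m S * exp e" using V(1)[OF SI] qW by blast
      obtain d where "d \<in> V S" "\<beta> * m S * exp (- e) < g d" using V(1)[OF SI] by blast
      then have lo: "\<beta> * m S * exp (- e) < g q" using q WS by (fastforce simp: peak_def)
      have mS: "0 < m S" using m(1)[OF S] .
      have gq: "0 < g q" using D.peak_pos[OF W(1)[OF S] q] .
      have "ln (g q) < ln (\<beta> * m S * exp e)" using up gq by (intro ln_less_cancel_iff[THEN iffD2]) auto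
      moreover have "ln (\<beta> * m S * exp (- e)) < ln (g q)"
        using lo gq mS \<beta> by (intro ln_less_cancel_iff[THEN iffD2]) auto
      moreover have "ln (\<beta> * m S * exp x) = ln (g b) - ln (f a) + ln (m S) + x" for x
        using mS \<beta> fa gb by (simp add: ln_mult \<beta>_def ln_div)
      ultimately show ?thesis
        using supA supB supW m(3)[OF S] by (simp add: log_ratio_def abs_if)
    qed
    show "refines f g e \<Q> {(A, B)}"
      unfolding refines_def using close W(2) \<A>(2) by (auto simp: \<Q>_def)
    show "\<forall>Q\<in>\<Q>. \<exists>x. fst Q \<subseteq> ball x e"
      using A0(3) by (auto simp: \<Q>_def)
  qed
qed

text \<open>Each pair is refined separately at a choice of peaks. In the pair containing
  \<open>c\<close> and \<open>d\<close> these two are taken as the peaks, since they are global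
  maxima, and hence they remain paired.\<close>

lemma refine_fst:
  assumes lel: "lelek D g" and M: "matching C D c d \<P>" and c: "peak f C c" and d: "peak g D d" and e: "0 < e"
  obtains \<Q> where "matching C D c d \<Q>" "refines f g e \<Q> \<P>" "\<forall>Q\<in>\<Q>. \<exists>x. fst Q \<subseteq> ball x e"
proof -
  have P: "clopen_in C (fst P)" "clopen_in D (snd P)" "fst P \<noteq> {}" "snd P \<noteq> {}" if "P \<in> \<P>" for P
    using M that unfolding matching_def by blast+
  have disj: "fst P \<inter> fst Q = {}" "snd P \<inter> snd Q = {}" if "P \<in> \<P>" "Q \<in> \<P>" "P \<noteq> Q" for P Q
    using M that unfolding matching_def by blast+
  have "\<exists>\<Q> a b. matching (fst P) (snd P) a b \<Q> \<and> refines f g e \<Q> {P} \<and> (\<forall>Q\<in>\<Q>. \<exists>x. fst Q \<subseteq> ball x e)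
      \<and> (c \<in> fst P \<and> d \<in> snd P \<longrightarrow> a = c \<and> b = d)" if PP: "P \<in> \<P>" for P
  proof -
    obtain a b where ab: "peak f (fst P) a" "peak g (snd P) b" "c \<in> fst P \<and> d \<in> snd P \<longrightarrow> a = c \<and> b = d"
    proof (cases "c \<in> fst P \<and> d \<in> snd P")
      case True
      then have "peak f (fst P) c" "peak g (snd P) d"
        using c d clopen_in_subset[OF P(1)[OF PP]] clopen_in_subset[OF P(2)[OF PP]]
        by (auto simp: peak_def)
      then show ?thesis using that by blast
    next
      case False
      obtain a where "peak f (fst P) a" using C.peak_exists[OF P(1,3)[OF PP]] .
      moreover obtain b where "peak g (snd P) b" using D.peak_exists[OF P(2,4)[OF PP]] .
      ultimately show ?thesis using that False by blast
    qed
    obtain \<Q> where "matching (fst P) (snd P) a b \<Q>" "refines f g e \<Q> {(fst P, snd P)}"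
      "\<forall>Q\<in>\<Q>. \<exists>x. fst Q \<subseteq> ball x e"
      by (rule refine_block[OF lel P(1)[OF PP] ab(1) P(2)[OF PP] ab(2) e])
    then show ?thesis using ab(3) unfolding prod.collapse by blast
  qed
  then obtain \<Q> a b where Q: "\<And>P. P \<in> \<P> \<Longrightarrow> matching (fst P) (snd P) (a P) (b P) (\<Q> P)"
    "\<And>P. P \<in> \<P> \<Longrightarrow> refines f g e (\<Q> P) {P}"
    "\<And>P. P \<in> \<P> \<Longrightarrow> \<forall>Q\<in>\<Q> P. \<exists>x. fst Q \<subseteq> ball x e"
    "\<And>P. P \<in> \<P> \<Longrightarrow> c \<in> fst P \<and> d \<in> snd P \<longrightarrow> a P = c \<and> b P = d" by metis
  have sub: "clopen_in (fst P) (fst Q) \<and> clopen_in (snd P) (snd Q) \<and> fst Q \<noteq> {} \<and> snd Q \<noteq> {}"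
    if "P \<in> \<P>" "Q \<in> \<Q> P" for P Q
    using Q(1)[OF that(1)] that(2) unfolding matching_def by blast
  have un: "\<Union> (fst ` \<Q> P) = fst P" "\<Union> (snd ` \<Q> P) = snd P" if "P \<in> \<P>" for P
    using Q(1)[OF that] unfolding matching_def by blast+
  define \<R> where "\<R> = (\<Union>P\<in>\<P>. \<Q> P)"
  show ?thesis
  proof
    show "matching C D c d \<R>"
      unfolding matching_def
    proof (intro conjI ballI impI)
      fix R assume "R \<in> \<R>"
      then obtain P where PR: "P \<in> \<P>" "R \<in> \<Q> P" by (auto simp: \<R>_def)
      show "clopen_in C (fst R)" "clopen_in D (snd R)"
        using sub[OF PR] clopen_in_trans P[OF PR(1)] by blast+
      show "fst R \<noteq> {}" "snd R \<noteq> {}" using sub[OF PR] by blast+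
    next
      have "\<Union> (fst ` \<R>) = (\<Union>P\<in>\<P>. \<Union> (fst ` \<Q> P))" by (auto simp: \<R>_def)
      also have "\<dots> = \<Union> (fst ` \<P>)" using un(1) by simp
      finally show "\<Union> (fst ` \<R>) = C" using M by (simp add: matching_def)
      have "\<Union> (snd ` \<R>) = (\<Union>P\<in>\<P>. \<Union> (snd ` \<Q> P))" by (auto simp: \<R>_def)
      also have "\<dots> = \<Union> (snd ` \<P>)" using un(2) by simp
      finally show "\<Union> (snd ` \<R>) = D" using M by (simp add: matching_def)
      obtain P where PP: "P \<in> \<P>" "c \<in> fst P" "d \<in> snd P" using M unfolding matching_def by blast
      then have "a P = c" "b P = d" using Q(4) by blast+
      then have "\<exists>R\<in>\<Q> P. c \<in> fst R \<and> d \<in> snd R" using Q(1)[OF PP(1)] unfolding matching_def by blast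
      then show "\<exists>R\<in>\<R>. c \<in> fst R \<and> d \<in> snd R" using PP by (auto simp: \<R>_def)
    next
      fix R R' assume R: "R \<in> \<R>" "R' \<in> \<R>" "R \<noteq> R'"
      then obtain P P' where PR: "P \<in> \<P>" "R \<in> \<Q> P" "P' \<in> \<P>" "R' \<in> \<Q> P'" by (auto simp: \<R>_def)
      show "fst R \<inter> fst R' = {}" "snd R \<inter> snd R' = {}"
      proof -
        have "fst R \<inter> fst R' = {} \<and> snd R \<inter> snd R' = {}"
        proof (cases "P = P'")
          case True
          then show ?thesis using Q(1)[OF PR(1)] PR R(3) unfolding matching_def by blast
        next
          case False
          have "fst R \<subseteq> fst P" "snd R \<subseteq> snd P" "fst R' \<subseteq> fst P'" "snd R' \<subseteq> snd P'"
            using sub[OF PR(1,2)] sub[OF PR(3,4)] clopen_in_subset by blast+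
          then show ?thesis using disj[OF PR(1,3) False] by blast
        qed
        then show "fst R \<inter> fst R' = {}" "snd R \<inter> snd R' = {}" by auto
      qed
    qed
    show "refines f g e \<R> \<P>"
      unfolding refines_def
    proof
      fix R assume "R \<in> \<R>"
      then obtain P where PR: "P \<in> \<P>" "R \<in> \<Q> P" by (auto simp: \<R>_def)
      then show "\<exists>P\<in>\<P>. fst R \<subseteq> fst P \<and> snd R \<subseteq> snd P \<and> \<bar>log_ratio f g R - log_ratio f g P\<bar> < e"
        using Q(2)[OF PR(1)] unfolding refines_def by blast
    qed
    show "\<forall>R\<in>\<R>. \<exists>x. fst R \<subseteq> ball x e"
      using Q(3) by (auto simp: \<R>_def)
  qed
qed

end

lemma (in usc_pair) refine_both:
  assumes lel: "lelek C f" "lelek D g" and M: "matching C D c d \<P>" and c: "peak f C c" and d: "peak g D d"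
    and e: "0 < e"
  obtains \<Q> where "matching C D c d \<Q>" "refines f g (2 * e) \<Q> \<P>"
    "\<forall>Q\<in>\<Q>. (\<exists>x. fst Q \<subseteq> ball x e) \<and> (\<exists>y. snd Q \<subseteq> ball y e)"
proof -
  interpret S: usc_pair D g C f ..
  obtain \<Q> where Q: "matching C D c d \<Q>" "refines f g e \<Q> \<P>" "\<forall>Q\<in>\<Q>. \<exists>x. fst Q \<subseteq> ball x e"
    by (rule refine_fst[OF lel(2) M c d e])
  obtain \<R> where R: "matching D C d c \<R>" "refines g f e \<R> (prod.swap ` \<Q>)" "\<forall>Q\<in>\<R>. \<exists>x. fst Q \<subseteq> ball x e"
    by (rule S.refine_fst[OF lel(1) matching_swap[OF Q(1)] d c e])
  define \<S> where "\<S> = prod.swap ` \<R>"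
  have ref: "refines f g e \<S> \<Q>"
    using refines_swap[OF R(2)] by (simp add: \<S>_def image_image)
  show ?thesis
  proof
    show "matching C D c d \<S>" unfolding \<S>_def by (rule matching_swap[OF R(1)])
    show "refines f g (2 * e) \<S> \<P>" using refines_trans[OF ref Q(2)] by simp
    show "\<forall>S\<in>\<S>. (\<exists>x. fst S \<subseteq> ball x e) \<and> (\<exists>y. snd S \<subseteq> ball y e)"
    proof
    fix S assume S: "S \<in> \<S>"
    then obtain Q' where "Q' \<in> \<Q>" "fst S \<subseteq> fst Q'" using ref unfolding refines_def by blast
    then have "\<exists>x. fst S \<subseteq> ball x e" using Q(3) by blast
    moreover have "\<exists>y. snd S \<subseteq> ball y e" using S R(3) unfolding \<S>_def by (metis imageE snd_swap)
    ultimately show "(\<exists>x. fst S \<subseteq> ball x e) \<and> (\<exists>y. snd S \<subseteq> ball y e)" ..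
    qed
  qed
qed

section \<open>From matched partitions to a homeomorphism with a multiplier\<close>

lemma openin_eventually:
  assumes "openin (top_of_set C) A" "c \<in> A" "z \<longlonglongrightarrow> c" "\<And>n. z n \<in> C"
  shows "\<forall>\<^sub>F n in sequentially. z n \<in> A"
proof -
  obtain V where V: "open V" "A = C \<inter> V" using assms(1) unfolding openin_open by blast
  have "\<forall>\<^sub>F n in sequentially. z n \<in> V"
    using assms(2,3) V by (intro topological_tendstoD) auto
  then show ?thesis by (rule eventually_mono) (use V assms(4) in auto)
qed

definition linked :: "(nat \<Rightarrow> ('b set \<times> 'c set) set) \<Rightarrow> 'b \<Rightarrow> 'c \<Rightarrow> bool" where
  "linked \<P> x y \<longleftrightarrow> (\<forall>n. \<exists>P\<in>\<P> n. x \<in> fst P \<and> y \<in> snd P)"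

lemma linked_swap: "linked (\<lambda>n. prod.swap ` \<P> n) y x \<longleftrightarrow> linked \<P> x y"
  by (auto simp: linked_def conj_commute)

text \<open>The blocks containing \<open>x\<close> are unique at each stage, so refinement makes
  their partners a decreasing sequence of nonempty compact sets. Compactness gives a partner point,
  shrinking diameters its uniqueness.\<close>

lemma linked_ex1:
  fixes \<P> :: "nat \<Rightarrow> ('b::metric_space set \<times> 'c::metric_space set) set"
  assumes M: "\<And>n. matching C D c d (\<P> n)"
    and ref: "\<And>n. \<forall>Q\<in>\<P> (Suc n). \<exists>P\<in>\<P> n. fst Q \<subseteq> fst P \<and> snd Q \<subseteq> snd P"
    and small: "\<And>n. \<forall>Q\<in>\<P> (Suc n). \<exists>y. snd Q \<subseteq> ball y ((1/2)^n)"
    and D: "compact D" and x: "x \<in> C"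
  shows "\<exists>!y. y \<in> D \<and> linked \<P> x y"
proof (rule ex_ex1I)
  have "\<forall>n. \<exists>P. P \<in> \<P> n \<and> x \<in> fst P" using matching_ex_fst[OF M x] by blast
  then obtain p where p: "\<And>n. p n \<in> \<P> n" "\<And>n. x \<in> fst (p n)" by metis
  have cl: "clopen_in D (snd (p n))" "snd (p n) \<noteq> {}" for n
    using M[of n] p(1)[of n] unfolding matching_def by blast+
  have "snd (p (Suc n)) \<subseteq> snd (p n)" for n
  proof -
    obtain P where P: "P \<in> \<P> n" "fst (p (Suc n)) \<subseteq> fst P" "snd (p (Suc n)) \<subseteq> snd P"
      using ref[of n] p(1)[of "Suc n"] by blast
    then have "P = p n" using matching_unique_fst[OF M P(1) p(1)] p(2) by blast
    then show ?thesis using P by simp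
  qed
  then have mono: "snd (p m) \<subseteq> snd (p n)" if "n \<le> m" for n m
    using lift_Suc_antimono_le[of "\<lambda>n. snd (p n)"] that by blast
  have "\<exists>y. y \<in> snd (p n)" for n using cl(2)[of n] by blast
  then obtain y where y: "\<And>n. y n \<in> snd (p n)" by metis
  have "\<forall>n. y n \<in> D" using y clopen_in_subset[OF cl(1)] by blast
  then obtain l s where ls: "l \<in> D" "strict_mono s" "(y \<circ> s) \<longlonglongrightarrow> l"
    using D unfolding compact_eq_seq_compact_metric by (metis seq_compactE)
  have "l \<in> snd (p n)" for n
  proof -
    have "closed (snd (p n))" using clopen_in_compact[OF D cl(1)] by (rule compact_imp_closed)
    moreover have "(y \<circ> s) (k + n) \<in> snd (p n)" for k
      using mono[of n "s (k + n)"] y[of "s (k + n)"] seq_suble[OF ls(2), of "k + n"] by auto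
    moreover have "(\<lambda>k. (y \<circ> s) (k + n)) \<longlonglongrightarrow> l" using ls(3) by (rule LIMSEQ_ignore_initial_segment)
    ultimately show ?thesis by (rule closed_sequentially)
  qed
  then show "\<exists>y. y \<in> D \<and> linked \<P> x y" using ls(1) p unfolding linked_def by blast
next
  fix y y' assume y: "y \<in> D \<and> linked \<P> x y" "y' \<in> D \<and> linked \<P> x y'"
  have "dist y y' \<le> 2 * (1/2)^n" for n
  proof -
    obtain P where P: "P \<in> \<P> (Suc n)" "x \<in> fst P" "y \<in> snd P" using y(1) unfolding linked_def by blast
    obtain P' where P': "P' \<in> \<P> (Suc n)" "x \<in> fst P'" "y' \<in> snd P'" using y(2) unfolding linked_def by blast
    have "P' = P" using matching_unique_fst[OF M P'(1) P(1) P'(2) P(2)] .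
    moreover obtain z where z: "snd P \<subseteq> ball z ((1/2)^n)" using small P(1) by blast
    ultimately have "dist z y < (1/2)^n" "dist z y' < (1/2)^n"
      using subsetD[OF z, of y] subsetD[OF z, of y'] P(3) P'(3) by simp_all
    then show ?thesis using dist_triangle3[of y y' z] by simp
  qed
  moreover have "(\<lambda>n. 2 * (1/2)^n :: real) \<longlonglongrightarrow> 2 * 0"
    by (intro tendsto_mult tendsto_const LIMSEQ_power_zero) simp
  ultimately have "dist y y' \<le> 0" using LIMSEQ_le_const[of "\<lambda>n. 2 * (1/2)^n :: real" 0 "dist y y'"] by auto
  then show "y = y'" by simp
qed

context usc_positive
begin

text \<open>Suprema over shrinking clopen neighbourhoods converge to the value, by semicontinuity.\<close>

lemma Sup_shrinking:
  assumes c: "c \<in> C" and A: "\<And>n. clopen_in C (A n)" "\<And>n. c \<in> A n"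
    and small: "\<And>n. \<exists>x. A (Suc n) \<subseteq> ball x ((1/2)^n)"
  shows "(\<lambda>n. Sup (f ` A n)) \<longlonglongrightarrow> f c"
proof -
  have "\<exists>a. peak f (A n) a" for n
  proof -
    have "A n \<noteq> {}" using A(2) by blast
    then show ?thesis using peak_exists[OF A(1)[of n]] by blast
  qed
  then obtain a where a: "\<And>n. peak f (A n) (a n)" by metis
  have fa: "Sup (f ` A n) = f (a n)" for n using Sup_peak[OF a] .
  have aA: "a n \<in> A n" "f c \<le> f (a n)" for n using a[of n] A(2)[of n] by (auto simp: peak_def)
  have d: "dist (a (Suc n)) c < 2 * (1/2)^n" for n
  proof -
    obtain x where x: "A (Suc n) \<subseteq> ball x ((1/2)^n)" using small by blast
    have "dist x (a (Suc n)) < (1/2)^n" "dist x c < (1/2)^n"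
      using subsetD[OF x aA(1)] subsetD[OF x A(2)] by simp_all
    then show ?thesis using dist_triangle3[of "a (Suc n)" c x] by simp
  qed
  \<comment> \<open>Each set contains \<open>c\<close>, so its supremum is at least
    \<open>f c\<close>; from above, the peaks converge to \<open>c\<close> and semicontinuity
    applies.\<close>
  have "(\<lambda>n. f (a (Suc n))) \<longlonglongrightarrow> f c"
  proof (rule order_tendstoI)
    fix r assume "r < f c"
    then have "r < f (a (Suc n))" for n using aA(2)[of "Suc n"] by linarith
    then show "\<forall>\<^sub>F n in sequentially. r < f (a (Suc n))" by simp
  next
    fix r assume "f c < r"
    then obtain e where e: "e > 0" "\<And>d. d \<in> C \<Longrightarrow> dist d c < e \<Longrightarrow> f d < r" using usc[OF c] by blast
    have "(\<lambda>n. 2 * (1/2)^n :: real) \<longlonglongrightarrow> 2 * 0"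
      by (intro tendsto_mult tendsto_const LIMSEQ_power_zero) simp
    then have "\<forall>\<^sub>F n in sequentially. 2 * (1/2)^n < e" using e(1) by (intro order_tendstoD(2)) auto
    then show "\<forall>\<^sub>F n in sequentially. f (a (Suc n)) < r"
    proof eventually_elim
      case (elim n)
      have "dist (a (Suc n)) c < e" using d[of n] elim by linarith
      then show ?case using e(2) aA(1) clopen_in_subset[OF A(1)] by blast
    qed
  qed
  then show ?thesis unfolding fa by (rule LIMSEQ_imp_Suc)
qed

end

context usc_pair
begin

lemma matching_sequence:
  assumes lel: "lelek C f" "lelek D g" and c: "peak f C c" and d: "peak g D d"
  obtains \<P> where "\<And>n. matching C D c d (\<P> n)" "\<And>n. refines f g (2 * (1/2)^n) (\<P> (Suc n)) (\<P> n)"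
    "\<And>n. \<forall>Q\<in>\<P> (Suc n). (\<exists>x. fst Q \<subseteq> ball x ((1/2)^n)) \<and> (\<exists>y. snd Q \<subseteq> ball y ((1/2)^n))"
proof -
  have "\<exists>\<P>. \<forall>n. matching C D c d (\<P> n) \<and> (refines f g (2 * (1/2)^n) (\<P> (Suc n)) (\<P> n)
      \<and> (\<forall>Q\<in>\<P> (Suc n). (\<exists>x. fst Q \<subseteq> ball x ((1/2)^n)) \<and> (\<exists>y. snd Q \<subseteq> ball y ((1/2)^n))))"
  proof (rule dependent_nat_choice)
    have "matching C D c d {(C, D)}"
      using c d unfolding matching_def by (auto simp: peak_def)
    then show "\<exists>\<P>. matching C D c d \<P>" by blast
    fix \<P> :: "('b set \<times> 'c set) set" and n :: nat
    assume M: "matching C D c d \<P>"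
    have e: "0 < (1/2 :: real)^n" by simp
    obtain \<Q> where "matching C D c d \<Q>" "refines f g (2 * (1/2)^n) \<Q> \<P>"
      "\<forall>Q\<in>\<Q>. (\<exists>x. fst Q \<subseteq> ball x ((1/2)^n)) \<and> (\<exists>y. snd Q \<subseteq> ball y ((1/2)^n))"
      by (rule refine_both[OF lel M c d e])
    then show "\<exists>\<Q>. matching C D c d \<Q> \<and> (refines f g (2 * (1/2)^n) \<Q> \<P>
      \<and> (\<forall>Q\<in>\<Q>. (\<exists>x. fst Q \<subseteq> ball x ((1/2)^n)) \<and> (\<exists>y. snd Q \<subseteq> ball y ((1/2)^n))))"
      by blast
  qed
  then obtain \<P> where "\<forall>n. matching C D c d (\<P> n) \<and> (refines f g (2 * (1/2)^n) (\<P> (Suc n)) (\<P> n)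
      \<and> (\<forall>Q\<in>\<P> (Suc n). (\<exists>x. fst Q \<subseteq> ball x ((1/2)^n)) \<and> (\<exists>y. snd Q \<subseteq> ball y ((1/2)^n))))"
    by (rule exE)
  then show ?thesis by (intro that[of \<P>]) simp_all
qed

text \<open>Points whose blocks are matched at every stage correspond under \<open>\<sigma>\<close>,
  and the log ratios of these blocks converge uniformly to the logarithm of \<open>\<alpha>\<close>.
  Multiplying by \<open>\<alpha>\<close> then carries the leg over \<open>x\<close> onto the leg of
  \<open>g\<close> over \<open>\<sigma> x\<close>.\<close>

theorem lelek_equivalence:
  assumes lel: "lelek C f" "lelek D g" and c: "peak f C c" and d: "peak g D d"
  obtains \<sigma> \<alpha> where "bij_betw \<sigma> C D" "continuous_on C \<sigma>" "continuous_on C \<alpha>"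
    "\<And>x. x \<in> C \<Longrightarrow> 0 < \<alpha> x \<and> g (\<sigma> x) = \<alpha> x * f x" "\<sigma> c = d"
proof -
  obtain \<P> where M: "\<And>n. matching C D c d (\<P> n)" and ref: "\<And>n. refines f g (2 * (1/2)^n) (\<P> (Suc n)) (\<P> n)"
    and small: "\<And>n. \<forall>Q\<in>\<P> (Suc n). (\<exists>x. fst Q \<subseteq> ball x ((1/2)^n)) \<and> (\<exists>y. snd Q \<subseteq> ball y ((1/2)^n))"
    using matching_sequence[OF lel c d] by metis
  have Ex1: "\<exists>!y. y \<in> D \<and> linked \<P> x y" if "x \<in> C" for x
  proof (rule linked_ex1[OF M _ _ D.compact_C that])
    show "\<forall>Q\<in>\<P> (Suc n). \<exists>P\<in>\<P> n. fst Q \<subseteq> fst P \<and> snd Q \<subseteq> snd P" for n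
      using ref[of n] unfolding refines_def by meson
    show "\<forall>Q\<in>\<P> (Suc n). \<exists>y. snd Q \<subseteq> ball y ((1/2)^n)" for n
      using small[of n] by blast
  qed
  have Ex1': "\<exists>!x. x \<in> C \<and> linked \<P> x y" if "y \<in> D" for y
  proof -
    have "\<exists>!x. x \<in> C \<and> linked (\<lambda>n. prod.swap ` \<P> n) y x"
    proof (rule linked_ex1[OF matching_swap[OF M] _ _ C.compact_C that])
      show "\<forall>Q\<in>prod.swap ` \<P> (Suc n). \<exists>P\<in>prod.swap ` \<P> n. fst Q \<subseteq> fst P \<and> snd Q \<subseteq> snd P" for n
        using refines_swap[OF ref[of n]] unfolding refines_def by meson
      show "\<forall>Q\<in>prod.swap ` \<P> (Suc n). \<exists>y. snd Q \<subseteq> ball y ((1/2)^n)" for n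
        using small[of n] unfolding ball_simps(9) snd_swap by blast
    qed
    then show ?thesis unfolding linked_swap .
  qed
  define \<sigma> where "\<sigma> = (\<lambda>x. THE y. y \<in> D \<and> linked \<P> x y)"
  have \<sigma>: "\<sigma> x \<in> D" "linked \<P> x (\<sigma> x)" if "x \<in> C" for x
    using theI'[OF Ex1[OF that]] unfolding \<sigma>_def by blast+
  have \<sigma>_eq: "\<sigma> x = y" if "x \<in> C" "y \<in> D" "linked \<P> x y" for x y
    using Ex1[OF that(1)] \<sigma>[OF that(1)] that by blast
  have cD: "c \<in> C" "d \<in> D" using c d by (auto simp: peak_def)
  have "linked \<P> c d" using M unfolding linked_def matching_def by blast
  then have \<sigma>c: "\<sigma> c = d" using \<sigma>_eq cD by blast
  have bij: "bij_betw \<sigma> C D"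
    unfolding bij_betw_def
  proof
    show "inj_on \<sigma> C"
    proof (rule inj_onI)
      fix x x' assume x: "x \<in> C" "x' \<in> C" "\<sigma> x = \<sigma> x'"
      then have "linked \<P> x (\<sigma> x)" "linked \<P> x' (\<sigma> x)" using \<sigma>(2)[of x] \<sigma>(2)[of x'] by simp_all
      then show "x = x'" using Ex1'[OF \<sigma>(1)[OF x(1)]] x by blast
    qed
    show "\<sigma> ` C = D"
    proof
      show "\<sigma> ` C \<subseteq> D" using \<sigma>(1) by blast
      show "D \<subseteq> \<sigma> ` C"
      proof
        fix y assume y: "y \<in> D"
        then obtain x where "x \<in> C" "linked \<P> x y" using Ex1' by blast
        then show "y \<in> \<sigma> ` C" using \<sigma>_eq y by (metis imageI)
      qed
    qed
  qed
  define part where "part = (\<lambda>n x. SOME P. P \<in> \<P> n \<and> x \<in> fst P)"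
  have part: "part n x \<in> \<P> n" "x \<in> fst (part n x)" if "x \<in> C" for n x
  proof -
    have "\<exists>P. P \<in> \<P> n \<and> x \<in> fst P" using matching_ex_fst[OF M that] by blast
    from someI_ex[OF this] show "part n x \<in> \<P> n" "x \<in> fst (part n x)" by (auto simp: part_def)
  qed
  have cl: "clopen_in C (fst (part n x))" "clopen_in D (snd (part n x))" if "x \<in> C" for n x
    using M[of n] part(1)[OF that, of n] unfolding matching_def by blast+
  have part_eq: "part n y = part n x" if "x \<in> C" "y \<in> fst (part n x)" for n x y
  proof -
    have "y \<in> C" using clopen_in_subset[OF cl(1)[OF that(1)]] that(2) by blast
    then show ?thesis using matching_unique_fst[OF M part(1) part(1)[OF that(1)] part(2) that(2)] by blast
  qed
  have \<sigma>_part: "\<sigma> x \<in> snd (part n x)" if x: "x \<in> C" for n x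
  proof -
    obtain P where P: "P \<in> \<P> n" "x \<in> fst P" "\<sigma> x \<in> snd P" using \<sigma>(2)[OF x] unfolding linked_def by blast
    have "P = part n x" using matching_unique_fst[OF M P(1) part(1)[OF x] P(2) part(2)[OF x]] .
    then show ?thesis using P by simp
  qed
  have ev_part: "\<forall>\<^sub>F k in sequentially. part n (z k) = part n x"
    if "x \<in> C" "z \<longlonglongrightarrow> x" "\<And>k. z k \<in> C" for n x z
  proof -
    have "openin (top_of_set C) (fst (part n x))" using cl(1)[OF that(1)] unfolding clopen_in_def by blast
    then have "\<forall>\<^sub>F k in sequentially. z k \<in> fst (part n x)"
      using part(2)[OF that(1)] that(2,3) by (rule openin_eventually)
    then show ?thesis by (rule eventually_mono) (use part_eq[OF that(1)] in blast)
  qed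
  have cont_\<sigma>: "continuous_on C \<sigma>"
  proof (rule continuous_on_compact_closed_graph[OF D.compact_C])
    show "\<sigma> ` C \<subseteq> D" using \<sigma>(1) by blast
    fix z w l assume z: "\<And>n. z n \<in> C" "z \<longlonglongrightarrow> w" "w \<in> C" "(\<lambda>n. \<sigma> (z n)) \<longlonglongrightarrow> l"
    have l: "l \<in> D"
      using closed_sequentially[OF compact_imp_closed[OF D.compact_C] _ z(4)] \<sigma>(1)[OF z(1)] by blast
    have "l \<in> snd (part n w)" for n
    proof -
      obtain N where N: "\<And>k. k \<ge> N \<Longrightarrow> part n (z k) = part n w"
        using ev_part[OF z(3,2,1), of n] by (auto simp: eventually_sequentially)
      have "\<sigma> (z (k + N)) \<in> snd (part n w)" for k
        using \<sigma>_part[OF z(1)[of "k + N"], of n] N[of "k + N"] by simp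
      then show ?thesis
        using closed_sequentially[OF compact_imp_closed[OF clopen_in_compact[OF D.compact_C cl(2)[OF z(3)]]] _
            LIMSEQ_ignore_initial_segment[OF z(4), of N]] by blast
    qed
    then have "linked \<P> w l" using part[OF z(3)] unfolding linked_def by blast
    then show "l = \<sigma> w" using \<sigma>_eq[OF z(3) l] by simp
  qed
  \<comment> \<open>Constant on each block of the stage, hence continuous.\<close>
  define L where "L = (\<lambda>n x. log_ratio f g (part n x))"
  have cont_L: "continuous_on C (L n)" for n
  proof (rule continuous_on_sequentiallyI)
    fix u a assume u: "\<forall>n. u n \<in> C" "a \<in> C" "u \<longlonglongrightarrow> a"
    have "\<forall>\<^sub>F k in sequentially. L n (u k) = L n a"
      using ev_part[OF u(2,3) spec[OF u(1)], of n] by (rule eventually_mono) (simp add: L_def)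
    then show "(\<lambda>k. L n (u k)) \<longlonglongrightarrow> L n a" by (rule tendsto_eventually)
  qed
  have step: "\<bar>L (Suc n) x - L n x\<bar> \<le> 2 * (1/2)^n" if x: "x \<in> C" for n x
  proof -
    obtain P where P: "P \<in> \<P> n" "fst (part (Suc n) x) \<subseteq> fst P"
      "\<bar>log_ratio f g (part (Suc n) x) - log_ratio f g P\<bar> < 2 * (1/2)^n"
      using ref[of n] part(1)[OF x, of "Suc n"] unfolding refines_def by blast
    have "x \<in> fst P" using P(2) part(2)[OF x] by blast
    then have "P = part n x" using matching_unique_fst[OF M P(1) part(1)[OF x] _ part(2)[OF x]] by blast
    then show ?thesis using P(3) by (simp add: L_def)
  qed
  \<comment> \<open>A telescoping sum: its terms are bounded by \<open>2 * (1/2)^n\<close>, so the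
    limit is uniform and inherits continuity.\<close>
  define l where "l = (\<lambda>x. L 0 x + (\<Sum>n. L (Suc n) x - L n x))"
  have sB: "summable (\<lambda>n. 2 * (1/2)^n :: real)" by (intro summable_mult) simp
  have unif: "uniform_limit C (\<lambda>n x. \<Sum>i<n. L (Suc i) x - L i x) (\<lambda>x. \<Sum>n. L (Suc n) x - L n x) sequentially"
    by (rule Weierstrass_m_test[OF _ sB]) (use step in simp)
  have cont_l: "continuous_on C l"
    unfolding l_def
  proof (intro continuous_on_add cont_L uniform_limit_theorem[OF _ unif])
    show "\<forall>\<^sub>F n in sequentially. continuous_on C (\<lambda>x. \<Sum>i<n. L (Suc i) x - L i x)"
      by (intro always_eventually allI continuous_intros cont_L)
  qed simp
  have lim_L: "(\<lambda>n. L n x) \<longlonglongrightarrow> l x" if x: "x \<in> C" for x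
  proof -
    have "(\<lambda>n. \<Sum>i<n. L (Suc i) x - L i x) \<longlonglongrightarrow> (\<Sum>n. L (Suc n) x - L n x)"
      using tendsto_uniform_limitI[OF unif x] .
    then have "(\<lambda>n. L 0 x + (\<Sum>i<n. L (Suc i) x - L i x)) \<longlonglongrightarrow> l x"
      unfolding l_def by (intro tendsto_intros)
    moreover have "L 0 x + (\<Sum>i<n. L (Suc i) x - L i x) = L n x" for n
      using sum_lessThan_telescope[of "\<lambda>i. L i x" n] by simp
    ultimately show ?thesis by simp
  qed
  have eq: "g (\<sigma> x) = exp (l x) * f x" if x: "x \<in> C" for x
  proof -
    have F: "(\<lambda>n. Sup (f ` fst (part n x))) \<longlonglongrightarrow> f x"
      using small part(1)[OF x] by (intro C.Sup_shrinking[OF x cl(1)[OF x] part(2)[OF x]]) blast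
    have G: "(\<lambda>n. Sup (g ` snd (part n x))) \<longlonglongrightarrow> g (\<sigma> x)"
      using small part(1)[OF x] by (intro D.Sup_shrinking[OF \<sigma>(1)[OF x] cl(2)[OF x] \<sigma>_part[OF x]]) blast
    \<comment> \<open>An exact identity at each stage, as both suprema are positive; its two sides
      have the required limits because the blocks shrink to \<open>x\<close> and
      \<open>\<sigma> x\<close>.\<close>
    have "Sup (g ` snd (part n x)) = exp (L n x) * Sup (f ` fst (part n x))" for n
    proof -
      have "fst (part n x) \<noteq> {}" "snd (part n x) \<noteq> {}" using part(2)[OF x] \<sigma>_part[OF x] by blast+
      then obtain a b where ab: "peak f (fst (part n x)) a" "peak g (snd (part n x)) b"
        using C.peak_exists[OF cl(1)[OF x]] D.peak_exists[OF cl(2)[OF x]] by metis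
      have "0 < f a" "0 < g b" using C.peak_pos[OF cl(1)[OF x] ab(1)] D.peak_pos[OF cl(2)[OF x] ab(2)] .
      then show ?thesis
        using Sup_peak[OF ab(1)] Sup_peak[OF ab(2)] by (simp add: L_def log_ratio_def exp_diff)
    qed
    moreover have "(\<lambda>n. exp (L n x) * Sup (f ` fst (part n x))) \<longlonglongrightarrow> exp (l x) * f x"
      by (intro tendsto_mult tendsto_exp lim_L[OF x] F)
    ultimately show ?thesis using LIMSEQ_unique[OF G] by simp
  qed
  show ?thesis
  proof (rule that[OF bij cont_\<sigma> _ _ \<sigma>c])
    show "continuous_on C (\<lambda>x. exp (l x))" using cont_l by (rule continuous_on_exp)
    show "0 < exp (l x) \<and> g (\<sigma> x) = exp (l x) * f x" if "x \<in> C" for x using eq[OF that] by simp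
  qed
qed

end

section \<open>Homeomorphisms and orbits\<close>

definition same_orbit :: "'a::metric_space set \<Rightarrow> 'a \<Rightarrow> 'a \<Rightarrow> bool" where
  "same_orbit X x y \<longleftrightarrow> (\<exists>h k. homeomorphism X X h k \<and> h x = y)"

lemma same_orbit_refl: "same_orbit X x x"
  unfolding same_orbit_def using homeomorphism_ident[of X] by blast

lemma same_orbit_sym: "x \<in> X \<Longrightarrow> same_orbit X x y \<Longrightarrow> same_orbit X y x"
  unfolding same_orbit_def using homeomorphism_apply1 homeomorphism_symD by metis

lemma same_orbit_trans:
  assumes "same_orbit X x y" "same_orbit X y z"
  shows "same_orbit X x z"
proof -
  obtain h k h' k' where "homeomorphism X X h k" "h x = y" "homeomorphism X X h' k'" "h' y = z"
    using assms unfolding same_orbit_def by blast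
  then have "homeomorphism X X (h' \<circ> h) (k \<circ> k')" "(h' \<circ> h) x = z"
    using homeomorphism_compose by auto
  then show ?thesis unfolding same_orbit_def by blast
qed

lemma homeo_orbit_eq:
  assumes "x \<in> X" "y \<in> X"
  shows "homeo_orbit X x = homeo_orbit X y \<longleftrightarrow> same_orbit X x y"
proof -
  have mem: "z \<in> homeo_orbit X w \<longleftrightarrow> same_orbit X w z" for z w
    by (auto simp: homeo_orbit_def same_orbit_def)
  show ?thesis
  proof
    assume "homeo_orbit X x = homeo_orbit X y"
    then show "same_orbit X x y" using mem same_orbit_refl by metis
  next
    assume s: "same_orbit X x y"
    then have s': "same_orbit X y x" using same_orbit_sym[OF assms(1)] by blast
    show "homeo_orbit X x = homeo_orbit X y"
      unfolding set_eq_iff mem using same_orbit_trans s s' by metis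
  qed
qed

context fan_set
begin

context
  fixes h k assumes hom: "homeomorphism X X h k"
begin

lemma hom_in: "x \<in> X \<Longrightarrow> h x \<in> X"
  using homeomorphism_image1[OF hom] by blast

lemma hom_inj: "inj_on h X"
  using homeomorphism_apply1[OF hom] by (rule inj_on_inverseI)

lemma hom_arc_joining:
  assumes "arc_joining p q A" "A \<subseteq> X"
  shows "arc_joining (h p) (h q) (h ` A)"
proof -
  obtain g where g: "arc g" "pathstart g = p" "pathfinish g = q" "path_image g = A"
    using assms(1) unfolding arc_joining_def by blast
  have img: "g ` {0..1} = A" using g(4) by (simp add: path_image_def)
  have "path (h \<circ> g)"
    unfolding path_def
  proof (rule continuous_on_compose)
    show "continuous_on {0..1} g" using g(1) by (simp add: arc_def path_def)
    show "continuous_on (g ` {0..1}) h"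
      unfolding img using homeomorphism_cont1[OF hom] assms(2) by (rule continuous_on_subset)
  qed
  moreover have "inj_on (h \<circ> g) {0..1}"
    using g(1) hom_inj assms(2) img by (metis arc_def comp_inj_on inj_on_subset)
  ultimately have "arc (h \<circ> g)" by (simp add: arc_def)
  moreover have "pathstart (h \<circ> g) = h p" "pathfinish (h \<circ> g) = h q"
    using g(2,3) by (auto simp: pathstart_def pathfinish_def)
  moreover have "path_image (h \<circ> g) = h ` A"
    unfolding path_image_def image_comp[symmetric] img ..
  ultimately show ?thesis unfolding arc_joining_def by blast
qed

text \<open>A family of more than two arcs disjoint beyond \<open>T\<close> is carried to such a
  family at \<open>h T\<close>, which is therefore the unique ramification point.\<close>

lemma hom_T: "h T = T"
proof (rule ramification_eq)
  have "2 < point_order X T" using T_ramification by (simp add: ramification_point_def)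
  then obtain F where F: "finite F" "arcs_disjoint_beyond X T F" "2 < enat (card F)"
    unfolding point_order_def less_SUP_iff by blast
  have F1: "A \<subseteq> X" "\<exists>q. arc_joining T q A" if "A \<in> F" for A
    using F(2) that unfolding arcs_disjoint_beyond_def by simp_all
  have F2: "A \<inter> B = {T}" if "A \<in> F" "B \<in> F" "A \<noteq> B" for A B
    using F(2) that unfolding arcs_disjoint_beyond_def by simp
  have "\<Union>F \<subseteq> X" using F1(1) by (rule Union_least)
  then have "inj_on ((`) h) F"
    by (intro inj_on_image inj_on_subset[OF hom_inj])
  then have card: "card ((`) h ` F) = card F" by (rule card_image)
  have "arcs_disjoint_beyond X (h T) ((`) h ` F)"
    unfolding arcs_disjoint_beyond_def
  proof (intro conjI ballI impI)
    fix A assume "A \<in> (`) h ` F"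
    then obtain A' where A': "A' \<in> F" "A = h ` A'" by blast
    show "A \<subseteq> X" using A' F1(1)[OF A'(1)] hom_in by blast
    obtain q where "arc_joining T q A'" using F1(2)[OF A'(1)] by blast
    then show "\<exists>q. arc_joining (h T) q A" using hom_arc_joining F1(1)[OF A'(1)] A'(2) by blast
  next
    fix A B assume "A \<in> (`) h ` F" "B \<in> (`) h ` F" "A \<noteq> B"
    then obtain A' B' where AB: "A' \<in> F" "A = h ` A'" "B' \<in> F" "B = h ` B'" "A' \<noteq> B'" by blast
    have "A \<inter> B = h ` (A' \<inter> B')"
      using inj_on_image_Int[OF hom_inj F1(1)[OF AB(1)] F1(1)[OF AB(3)]] AB(2,4) by simp
    then show "A \<inter> B = {h T}" using F2[OF AB(1,3,5)] by simp
  qed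
  then have "enat (card F) \<le> point_order X (h T)"
    unfolding point_order_def using F(1) card by (intro SUP_upper2[of "(`) h ` F"]) auto
  then show "ramification_point X (h T)"
    using F(3) hom_in[OF T_in] unfolding ramification_point_def by (meson order_less_le_trans)
qed

lemma hom_seg:
  assumes "x \<in> X" "y \<in> X"
  shows "seg (h x) (h y) = h ` seg x y"
proof (cases "x = y")
  case False
  have "arc_joining (h x) (h y) (h ` seg x y)"
    using the_arc_joining[OF assms False] by (rule hom_arc_joining)
  moreover have "h ` seg x y \<subseteq> X" using seg_subset[OF assms] hom_in by blast
  ultimately show ?thesis by (rule arc_joining_the_arc)
qed simp

lemma hom_order:
  assumes "x \<in> X" "y \<in> X"
  shows "h x \<in> seg T (h y) \<longleftrightarrow> x \<in> seg T y"
  using hom_seg[OF T_in assms(2)] hom_T inj_on_image_mem_iff[OF hom_inj assms(1) seg_subset[OF T_in assms(2)]]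
  by simp

lemma hom_eq_T: "x \<in> X \<Longrightarrow> h x = T \<longleftrightarrow> x = T"
  using hom_inj hom_T T_in unfolding inj_on_def by metis

end

definition ends :: "'a set" where
  "ends = {e \<in> X - {T}. \<forall>y\<in>X. e \<in> seg T y \<longrightarrow> y = e}"

definition interior_points :: "'a set" where
  "interior_points = X - {T} - ends"

lemma hom_ends:
  assumes hom: "homeomorphism X X h k" and e: "e \<in> ends"
  shows "h e \<in> ends"
  unfolding ends_def
proof (intro CollectI conjI ballI impI)
  have eX: "e \<in> X" "e \<noteq> T" using e by (auto simp: ends_def)
  show "h e \<in> X - {T}" using hom_in[OF hom eX(1)] hom_eq_T[OF hom eX(1)] eX(2) by simp
  fix y assume y: "y \<in> X" "h e \<in> seg T y"
  obtain z where z: "z \<in> X" "y = h z" using homeomorphism_image1[OF hom] y(1) by blast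
  then have "e \<in> seg T z" using hom_order[OF hom eX(1) z(1)] y(2) by simp
  then have "z = e" using e z(1) unfolding ends_def by blast
  then show "y = h e" using z(2) by simp
qed

lemma hom_ends_iff:
  assumes hom: "homeomorphism X X h k" and x: "x \<in> X"
  shows "h x \<in> ends \<longleftrightarrow> x \<in> ends"
  using hom_ends[OF hom, of x] hom_ends[OF homeomorphism_symD[OF hom], of "h x"]
    homeomorphism_apply1[OF hom x] by auto

lemma hom_interior_points_iff:
  assumes hom: "homeomorphism X X h k" and x: "x \<in> X"
  shows "h x \<in> interior_points \<longleftrightarrow> x \<in> interior_points"
  unfolding interior_points_def
  using hom_ends_iff[OF assms] hom_eq_T[OF assms] hom_in[OF assms] x by auto

lemma hom_closure_ends:
  assumes hom: "homeomorphism X X h k" and x: "x \<in> X" "x \<in> closure ends"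
  shows "h x \<in> closure ends"
proof -
  obtain z where z: "\<And>n. z n \<in> ends" "z \<longlonglongrightarrow> x" using x(2) unfolding closure_sequential by blast
  have zX: "z n \<in> X" for n using z(1)[of n] by (simp add: ends_def)
  have "(\<lambda>n. h (z n)) \<longlonglongrightarrow> h x"
    by (rule continuous_on_tendsto_compose[OF homeomorphism_cont1[OF hom] z(2) x(1)])
      (simp add: zX)
  moreover have "h (z n) \<in> ends" for n using hom_ends[OF hom z(1)] .
  ultimately show ?thesis
    unfolding closure_sequential by (intro exI[of _ "\<lambda>n. h (z n)"]) simp
qed

lemma hom_closure_ends_iff:
  assumes hom: "homeomorphism X X h k" and x: "x \<in> X"
  shows "h x \<in> closure ends \<longleftrightarrow> x \<in> closure ends"
  using hom_closure_ends[OF hom x] hom_closure_ends[OF homeomorphism_symD[OF hom] hom_in[OF hom x]]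
    homeomorphism_apply1[OF hom x] by auto

lemma same_orbit_interior: "same_orbit X x y \<Longrightarrow> x \<in> X \<Longrightarrow> y \<in> interior_points \<longleftrightarrow> x \<in> interior_points"
  unfolding same_orbit_def using hom_interior_points_iff by blast

lemma same_orbit_closure_ends:
  "same_orbit X x y \<Longrightarrow> x \<in> X \<Longrightarrow> y \<in> closure ends \<longleftrightarrow> x \<in> closure ends"
  unfolding same_orbit_def using hom_closure_ends_iff by blast

lemma same_orbit_T: "same_orbit X x y \<Longrightarrow> x \<in> X \<Longrightarrow> y = T \<longleftrightarrow> x = T"
  unfolding same_orbit_def using hom_eq_T by blast

end

section \<open>Ends and homeomorphisms in coordinates\<close>

context fan_coordinates
begin

lemma \<Phi>_in: "z \<in> hypograph C f \<Longrightarrow> \<Phi> z \<in> X"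
  using \<Phi>_image by blast

lemma \<Phi>_inj:
  assumes "z \<in> hypograph C f" "w \<in> hypograph C f" "snd z \<noteq> 0" "\<Phi> z = \<Phi> w"
  shows "z = w"
proof -
  obtain c u d v where zw: "z = (c, u)" "w = (d, v)" by fastforce
  have u: "0 < u" using assms zw by auto
  have "\<Phi> z \<noteq> T" using \<Phi>_top[of c u] assms zw by simp
  then have v: "0 < v" using \<Phi>_top[of d v] assms zw by auto
  have "\<Phi> z \<in> seg T (\<Phi> w)" "\<Phi> w \<in> seg T (\<Phi> z)"
    using assms(4) seg_ends(2)[OF T_in \<Phi>_in[OF assms(1)]] by simp_all
  then have "c = d \<and> u \<le> v" "d = c \<and> v \<le> u"
    using \<Phi>_order[of c u d v] \<Phi>_order[of d v c u] assms(1,2) u v zw by simp_all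
  then show ?thesis using zw by simp
qed

lemma coords:
  assumes "x \<in> X" "x \<noteq> T"
  obtains c u where "c \<in> C" "0 < u" "u \<le> f c" "x = \<Phi> (c, u)"
proof -
  obtain z where z: "z \<in> hypograph C f" "x = \<Phi> z" using assms(1) \<Phi>_image by blast
  obtain c u where cu: "z = (c, u)" by fastforce
  then have "u \<noteq> 0" using \<Phi>_top[of c u] z assms(2) by auto
  then show ?thesis using that[of c u] z cu by simp
qed

lemma ends_iff:
  assumes "c \<in> C" "0 < u" "u \<le> f c"
  shows "\<Phi> (c, u) \<in> ends \<longleftrightarrow> u = f c"
proof
  have z: "(c, u) \<in> hypograph C f" "(c, f c) \<in> hypograph C f" using assms by simp_all
  assume "\<Phi> (c, u) \<in> ends"
  moreover have "\<Phi> (c, u) \<in> seg T (\<Phi> (c, f c))" using \<Phi>_order[OF z] assms by simp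
  ultimately have "\<Phi> (c, f c) = \<Phi> (c, u)" using \<Phi>_in[OF z(2)] by (simp add: ends_def)
  then show "u = f c" using \<Phi>_inj[OF z] assms by simp
next
  have z: "(c, u) \<in> hypograph C f" using assms by simp
  assume u: "u = f c"
  show "\<Phi> (c, u) \<in> ends"
    unfolding ends_def
  proof (intro CollectI conjI ballI impI)
    show "\<Phi> (c, u) \<in> X - {T}" using \<Phi>_in[OF z] \<Phi>_top[OF z] assms by simp
    fix y assume y: "y \<in> X" "\<Phi> (c, u) \<in> seg T y"
    have "y \<noteq> T" using y(2) \<open>\<Phi> (c, u) \<in> X - {T}\<close> by auto
    then obtain d v where d: "d \<in> C" "0 < v" "v \<le> f d" "y = \<Phi> (d, v)" using coords[OF y(1)] by blast
    then have "c = d \<and> u \<le> v" using \<Phi>_order[OF z, of d v] y(2) assms by simp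
    then have "d = c \<and> v = u" using d(3) u by auto
    then show "y = \<Phi> (c, u)" using d(4) by simp
  qed
qed

lemma interior_iff:
  assumes "c \<in> C" "0 < u" "u \<le> f c"
  shows "\<Phi> (c, u) \<in> interior_points \<longleftrightarrow> u < f c"
  using assms ends_iff[OF assms] \<Phi>_in[of "(c, u)"] \<Phi>_top[of c u] by (auto simp: interior_points_def)

lemma ends_coords:
  assumes "e \<in> ends" obtains c where "c \<in> C" "0 < f c" "e = \<Phi> (c, f c)"
proof -
  have "e \<in> X" "e \<noteq> T" using assms by (auto simp: ends_def)
  then obtain c u where c: "c \<in> C" "0 < u" "u \<le> f c" "e = \<Phi> (c, u)" by (rule coords)
  then have "u = f c" using ends_iff assms by simp
  then show ?thesis using that c by simp
qed

lemma interior_coords: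
  assumes "x \<in> interior_points" obtains c u where "c \<in> C" "0 < u" "u < f c" "x = \<Phi> (c, u)"
proof -
  have "x \<in> X" "x \<noteq> T" using assms by (auto simp: interior_points_def)
  then obtain c u where c: "c \<in> C" "0 < u" "u \<le> f c" "x = \<Phi> (c, u)" by (rule coords)
  then have "u < f c" using interior_iff assms by simp
  then show ?thesis using that c by simp
qed

text \<open>Ends correspond to positive points of the graph of \<open>f\<close>. A convergent
  subsequence of these in the hypograph has a limit over \<open>\<Phi> (c, r)\<close>, and this must
  be \<open>(c, r)\<close> since \<open>\<Phi>\<close> is injective at positive height.\<close>

lemma closure_ends_coords:
  assumes c: "c \<in> C" "0 < r" "r \<le> f c" and cl: "\<Phi> (c, r) \<in> closure ends"
  obtains x where "\<And>n::nat. x n \<in> C" "\<And>n. 0 < f (x n)" "x \<longlonglongrightarrow> c" "(\<lambda>n. f (x n)) \<longlonglongrightarrow> r"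
proof -
  obtain e where e: "\<And>n::nat. e n \<in> ends" "e \<longlonglongrightarrow> \<Phi> (c, r)" using cl unfolding closure_sequential by blast
  have "\<exists>d. d \<in> C \<and> 0 < f d \<and> e n = \<Phi> (d, f d)" for n using ends_coords[OF e(1)[of n]] by metis
  then obtain d where d: "\<And>n. d n \<in> C" "\<And>n. 0 < f (d n)" "\<And>n. e n = \<Phi> (d n, f (d n))" by metis
  have "\<forall>n. (d n, f (d n)) \<in> hypograph C f" using d(1) f_nonneg by simp
  then obtain w s where ws: "w \<in> hypograph C f" "strict_mono s" "((\<lambda>n. (d n, f (d n))) \<circ> s) \<longlonglongrightarrow> w"
    using compact_hypograph unfolding compact_eq_seq_compact_metric by (metis (no_types, lifting) seq_compactE)
  have lim: "(\<lambda>n. (d (s n), f (d (s n)))) \<longlonglongrightarrow> w" using ws(3) by (simp add: o_def)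
  have "(\<lambda>n. \<Phi> (d (s n), f (d (s n)))) \<longlonglongrightarrow> \<Phi> w"
    by (rule continuous_on_tendsto_compose[OF cont_\<Phi> lim ws(1)]) (simp add: d(1) f_nonneg)
  moreover have "(\<lambda>n. \<Phi> (d (s n), f (d (s n)))) \<longlonglongrightarrow> \<Phi> (c, r)"
    using LIMSEQ_subseq_LIMSEQ[OF e(2) ws(2)] d(3) by (simp add: o_def)
  ultimately have "\<Phi> (c, r) = \<Phi> w" using LIMSEQ_unique by blast
  then have "(c, r) = w" using c ws(1) by (intro \<Phi>_inj) simp_all
  then have "(\<lambda>n. d (s n)) \<longlonglongrightarrow> c" "(\<lambda>n. f (d (s n))) \<longlonglongrightarrow> r"
    using tendsto_fst[OF lim] tendsto_snd[OF lim] by auto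
  then show ?thesis using that[of "\<lambda>n. d (s n)"] d by simp
qed

lemma closure_ends_limit:
  assumes c: "c \<in> C" "0 < r" "r \<le> f c" and x: "\<And>n::nat. x n \<in> C" "x \<longlonglongrightarrow> c" "(\<lambda>n. f (x n)) \<longlonglongrightarrow> r"
  shows "\<Phi> (c, r) \<in> closure ends"
proof -
  have lim: "(\<lambda>n. (x n, f (x n))) \<longlonglongrightarrow> (c, r)" using x(2,3) by (rule tendsto_Pair)
  have "(\<lambda>n. \<Phi> (x n, f (x n))) \<longlonglongrightarrow> \<Phi> (c, r)"
    by (rule continuous_on_tendsto_compose[OF cont_\<Phi> lim]) (use c x(1) f_nonneg in simp_all)
  moreover have "\<forall>\<^sub>F n in sequentially. 0 < f (x n)" using x(3) c(2) by (rule order_tendstoD)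
  then have "\<forall>\<^sub>F n in sequentially. \<Phi> (x n, f (x n)) \<in> closure ends"
  proof eventually_elim
    case (elim n)
    then have "\<Phi> (x n, f (x n)) \<in> ends" using ends_iff[OF x(1)] by simp
    then show ?case using closure_subset by blast
  qed
  ultimately show ?thesis by (intro Lim_in_closed_set[of "closure ends"]) auto
qed

text \<open>A bijection preserving the base of the hypograph descends to the quotient
  \<open>X\<close>. Continuity downstairs follows by lifting sequences to the compact hypograph; the
  inverse is continuous by compactness of \<open>X\<close>.\<close>

lemma lift_homeomorphism:
  assumes cont: "continuous_on (hypograph C f) G" and bij: "bij_betw G (hypograph C f) (hypograph C f)"
    and zero: "\<And>z. z \<in> hypograph C f \<Longrightarrow> snd (G z) = 0 \<longleftrightarrow> snd z = 0"
    and z: "z \<in> hypograph C f"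
  shows "same_orbit X (\<Phi> z) (\<Phi> (G z))"
proof -
  let ?Z = "hypograph C f"
  have GZ: "G w \<in> ?Z" if "w \<in> ?Z" for w using bij that by (auto simp: bij_betw_def)
  have top: "\<Phi> w = T \<longleftrightarrow> snd w = 0" if "w \<in> ?Z" for w
    using \<Phi>_top[of "fst w" "snd w"] that by simp
  \<comment> \<open>The choice is ambiguous only over \<open>T\<close>, where \<open>zero\<close>
    makes every choice yield \<open>T\<close> again.\<close>
  define pre where "pre = (\<lambda>x. SOME w. w \<in> ?Z \<and> \<Phi> w = x)"
  have pre: "pre x \<in> ?Z" "\<Phi> (pre x) = x" if x: "x \<in> X" for x
  proof -
    have "\<exists>w. w \<in> ?Z \<and> \<Phi> w = x" using x \<Phi>_image by blast
    from someI_ex[OF this] show "pre x \<in> ?Z" "\<Phi> (pre x) = x" by (auto simp: pre_def)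
  qed
  define H where "H = (\<lambda>x. \<Phi> (G (pre x)))"
  have H: "H (\<Phi> w) = \<Phi> (G w)" if w: "w \<in> ?Z" for w
  proof (cases "snd w = 0")
    case True
    have p: "pre (\<Phi> w) \<in> ?Z" "\<Phi> (pre (\<Phi> w)) = \<Phi> w" using pre[OF \<Phi>_in[OF w]] by auto
    then have "snd (pre (\<Phi> w)) = 0" using top[OF p(1)] top[OF w] True by simp
    then have "\<Phi> (G (pre (\<Phi> w))) = T" using top[OF GZ[OF p(1)]] zero[OF p(1)] by simp
    moreover have "\<Phi> (G w) = T" using top[OF GZ[OF w]] zero[OF w] True by simp
    ultimately show ?thesis by (simp add: H_def)
  next
    case False
    have "w = pre (\<Phi> w)" using pre[OF \<Phi>_in[OF w]] by (intro \<Phi>_inj[OF w _ False]) auto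
    then show ?thesis by (simp add: H_def)
  qed
  have HX: "H x \<in> X" if "x \<in> X" for x
    using \<Phi>_in[OF GZ[OF pre(1)[OF that]]] by (simp add: H_def)
  have "continuous_on X H"
  proof (rule continuous_on_compact_closed_graph[OF compact_X])
    show "H ` X \<subseteq> X" using HX by blast
    fix x a l assume x: "\<And>n. x n \<in> X" "x \<longlonglongrightarrow> a" "a \<in> X" "(\<lambda>n. H (x n)) \<longlonglongrightarrow> l"
    have "\<forall>n. pre (x n) \<in> ?Z" using pre(1)[OF x(1)] by blast
    then obtain w s where ws: "w \<in> ?Z" "strict_mono s" "((\<lambda>n. pre (x n)) \<circ> s) \<longlonglongrightarrow> w"
      using compact_hypograph unfolding compact_eq_seq_compact_metric by (metis (no_types, lifting) seq_compactE)
    have lim: "(\<lambda>n. pre (x (s n))) \<longlonglongrightarrow> w" using ws(3) by (simp add: o_def)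
    have pZ: "pre (x (s n)) \<in> ?Z" for n using pre(1)[OF x(1)] .
    have "(\<lambda>n. \<Phi> (pre (x (s n)))) \<longlonglongrightarrow> \<Phi> w"
      by (rule continuous_on_tendsto_compose[OF cont_\<Phi> lim ws(1)]) (simp add: pZ)
    moreover have "(\<lambda>n. \<Phi> (pre (x (s n)))) \<longlonglongrightarrow> a"
      using LIMSEQ_subseq_LIMSEQ[OF x(2) ws(2)] pre(2)[OF x(1)] by (simp add: o_def)
    ultimately have a: "a = \<Phi> w" using LIMSEQ_unique by blast
    have limG: "(\<lambda>n. G (pre (x (s n)))) \<longlonglongrightarrow> G w"
      by (rule continuous_on_tendsto_compose[OF cont lim ws(1)]) (simp add: pZ)
    have "(\<lambda>n. \<Phi> (G (pre (x (s n))))) \<longlonglongrightarrow> \<Phi> (G w)"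
      by (rule continuous_on_tendsto_compose[OF cont_\<Phi> limG GZ[OF ws(1)]]) (simp add: GZ pZ)
    moreover have "(\<lambda>n. \<Phi> (G (pre (x (s n))))) \<longlonglongrightarrow> l"
      using LIMSEQ_subseq_LIMSEQ[OF x(4) ws(2)] by (simp add: o_def H_def)
    ultimately have "l = \<Phi> (G w)" using LIMSEQ_unique by blast
    then show "l = H a" using H[OF ws(1)] a by simp
  qed
  moreover have "H ` X = X"
  proof
    show "H ` X \<subseteq> X" using HX by blast
    show "X \<subseteq> H ` X"
    proof
      fix y assume "y \<in> X"
      then obtain w where w: "w \<in> ?Z" "y = \<Phi> w" using \<Phi>_image by blast
      have "w \<in> G ` ?Z" using w(1) bij by (simp add: bij_betw_def)
      then obtain v where v: "v \<in> ?Z" "w = G v" by blast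
      then show "y \<in> H ` X" using H[OF v(1)] w \<Phi>_in[OF v(1)] by (metis imageI)
    qed
  qed
  moreover have "inj_on H X"
  proof (rule inj_onI)
    fix x y assume xy: "x \<in> X" "y \<in> X" "H x = H y"
    have p: "pre x \<in> ?Z" "\<Phi> (pre x) = x" "pre y \<in> ?Z" "\<Phi> (pre y) = y" using pre xy by auto
    have eq: "\<Phi> (G (pre x)) = \<Phi> (G (pre y))" using xy(3) by (simp add: H_def)
    show "x = y"
    proof (cases "snd (pre x) = 0")
      case True
      then have "\<Phi> (G (pre x)) = T" "x = T" using top[OF GZ[OF p(1)]] top[OF p(1)] zero[OF p(1)] p(2) by simp_all
      moreover from this have "snd (pre y) = 0" using eq top[OF GZ[OF p(3)]] zero[OF p(3)] by simp
      ultimately show ?thesis using top[OF p(3)] p(4) by simp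
    next
      case False
      then have "snd (G (pre x)) \<noteq> 0" using zero[OF p(1)] by simp
      then have "G (pre x) = G (pre y)" using eq by (intro \<Phi>_inj GZ p)
      then have "pre x = pre y" using bij p by (auto simp: bij_betw_def inj_on_def)
      then show ?thesis using p by metis
    qed
  qed
  ultimately obtain K where "homeomorphism X X H K" using homeomorphism_compact[OF compact_X] by metis
  then show ?thesis using H[OF z] unfolding same_orbit_def by blast
qed

end

text \<open>For \<open>k, j > 1\<close> mutually inverse piecewise linear homeomorphisms of \<open>{0..s}\<close>,
  jointly continuous in both arguments even where the leg length \<open>s\<close> tends to \<open>0\<close>.\<close>

definition stretch :: "real \<Rightarrow> real \<Rightarrow> real \<Rightarrow> real \<Rightarrow> real" where
  "stretch k j s t = min (k * t) (s - (s - t) / j)"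

definition shrink :: "real \<Rightarrow> real \<Rightarrow> real \<Rightarrow> real \<Rightarrow> real" where
  "shrink k j s u = max (u / k) (s - j * (s - u))"

text \<open>In either composite the inequality selecting the linear piece of the inner map
  rearranges to the one selecting the inverse piece of the outer map.\<close>

lemma
  assumes "1 < k" "1 < j" "0 \<le> t" "t \<le> s"
  shows stretch_nonneg: "0 \<le> stretch k j s t" and stretch_le: "stretch k j s t \<le> s"
    and stretch_ge: "t \<le> stretch k j s t" and shrink_stretch: "shrink k j s (stretch k j s t) = t"
    and shrink_nonneg: "0 \<le> shrink k j s t" and shrink_le: "shrink k j s t \<le> t"
    and stretch_shrink: "stretch k j s (shrink k j s t) = t"
proof -
  have kj: "0 < k" "0 < j" using assms by simp_all
  have st: "0 \<le> (s - t) / j" "(s - t) / j \<le> s - t"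
    using assms by (auto simp: divide_le_eq mult_le_cancel_left1)
  have kt: "t \<le> k * t" using assms by (simp add: mult_le_cancel_right1)
  have tk: "0 \<le> t / k" "t / k \<le> t" using assms by (auto simp: divide_le_eq mult_le_cancel_left1)
  have js: "s - t \<le> j * (s - t)" using assms by (simp add: mult_le_cancel_right1)
  show "0 \<le> stretch k j s t" "stretch k j s t \<le> s" "t \<le> stretch k j s t"
    using st kt assms(3) unfolding stretch_def min_def by (auto split: if_splits; linarith)+
  show "0 \<le> shrink k j s t" "shrink k j s t \<le> t"
    using tk js by (auto simp: shrink_def)
  show "shrink k j s (stretch k j s t) = t"
  proof (cases "k * t \<le> s - (s - t) / j")
    case True
    then have "s - j * (s - k * t) \<le> t" using kj by (simp add: field_simps)
    then show ?thesis using True kj by (simp add: shrink_def stretch_def)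
  next
    case False
    then have "(s - (s - t) / j) / k \<le> t" using kj by (simp add: field_simps)
    then show ?thesis using False kj by (simp add: shrink_def stretch_def)
  qed
  show "stretch k j s (shrink k j s t) = t"
  proof (cases "s - j * (s - t) \<le> t / k")
    case True
    then have "t \<le> s - (s - t / k) / j" using kj by (simp add: field_simps)
    then show ?thesis using True kj by (simp add: shrink_def stretch_def max_def)
  next
    case False
    then have "t \<le> k * (s - j * (s - t))" using kj by (simp add: field_simps)
    then show ?thesis using False kj by (simp add: shrink_def stretch_def)
  qed
qed

lemma stretch_mono: "1 < k \<Longrightarrow> 1 < j \<Longrightarrow> t \<le> t' \<Longrightarrow> stretch k j s t \<le> stretch k j s t'"
  unfolding stretch_def by (intro min.mono) (auto simp: divide_right_mono)

lemma shrink_mono: "1 < k \<Longrightarrow> 1 < j \<Longrightarrow> t \<le> t' \<Longrightarrow> shrink k j s t \<le> shrink k j s t'"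
  unfolding shrink_def by (intro max.mono) (auto simp: divide_right_mono)

text \<open>With these slopes both linear pieces take the value \<open>t1\<close> at
  \<open>t0\<close>, so the break point of \<open>stretch\<close> is
  \<open>(t0, t1)\<close>.\<close>

lemma stretch_hits:
  assumes "0 < t0" "t0 < t1" "t1 < M"
  obtains k j where "1 < k" "1 < j" "stretch k j M t0 = t1"
proof (rule that[of "t1 / t0" "(M - t0) / (M - t1)"])
  show "1 < t1 / t0" "1 < (M - t0) / (M - t1)" using assms by (auto simp: less_divide_eq)
  show "stretch (t1 / t0) ((M - t0) / (M - t1)) M t0 = t1" using assms by (simp add: stretch_def)
qed

section \<open>Orbit counting and the case of ends not accumulating at interior points\<close>

context fan_coordinates
begin

lemma positive_leg: obtains c where "c \<in> C" "0 < f c"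
proof -
  obtain y where "y \<in> X" "y \<noteq> T" using ex_not_T by blast
  then obtain c u where "c \<in> C" "0 < u" "u \<le> f c" using coords by metis
  then show ?thesis using that[of c] by simp
qed

lemma X_cases: "x \<in> X \<Longrightarrow> x = T \<or> x \<in> ends \<or> x \<in> interior_points"
  by (auto simp: interior_points_def)

text \<open>A homeomorphism taking the midpoint of one leg to that of another preserves the order,
  so it takes the end above the first to the only end above the second.\<close>

lemma ends_same_orbit:
  assumes int: "\<And>x y. x \<in> interior_points \<Longrightarrow> y \<in> interior_points \<Longrightarrow> same_orbit X x y"
    and e: "e \<in> ends" "e' \<in> ends"
  shows "same_orbit X e e'"
proof -
  obtain c where c: "c \<in> C" "0 < f c" "e = \<Phi> (c, f c)" using ends_coords[OF e(1)] .
  obtain d where d: "d \<in> C" "0 < f d" "e' = \<Phi> (d, f d)" using ends_coords[OF e(2)] .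
  have m: "\<Phi> (c, f c / 2) \<in> interior_points" "\<Phi> (d, f d / 2) \<in> interior_points"
    using interior_iff[of c "f c / 2"] interior_iff[of d "f d / 2"] c d by auto
  obtain h k where h: "homeomorphism X X h k" "h (\<Phi> (c, f c / 2)) = \<Phi> (d, f d / 2)"
    using int[OF m] unfolding same_orbit_def by blast
  have z: "(c, f c / 2) \<in> hypograph C f" "(c, f c) \<in> hypograph C f" using c by simp_all
  have "\<Phi> (c, f c / 2) \<in> seg T e" using \<Phi>_order[OF z] c by simp
  then have ord: "\<Phi> (d, f d / 2) \<in> seg T (h e)"
    using hom_order[OF h(1) \<Phi>_in[OF z(1)] \<Phi>_in[OF z(2)]] h(2) c(3) by simp
  obtain c' where c': "c' \<in> C" "0 < f c'" "h e = \<Phi> (c', f c')" using ends_coords[OF hom_ends[OF h(1) e(1)]] .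
  have "d = c'" using \<Phi>_order[of d "f d / 2" c' "f c'"] ord c' d by simp
  then have "h e = e'" using c' d by simp
  then show ?thesis using h unfolding same_orbit_def by blast
qed

text \<open>Top, ends and interior points are invariant classes. Two inequivalent interior points
  together with \<open>T\<close> and one end already account for four orbits, so there is no room
  for a second orbit of ends or a third of interior points.\<close>

lemma four_orbits:
  assumes four: "one_over_homogeneous 4 X"
  obtains x0 y0 where "x0 \<in> interior_points" "y0 \<in> interior_points" "\<not> same_orbit X x0 y0"
    "\<And>z. z \<in> interior_points \<Longrightarrow> same_orbit X x0 z \<or> same_orbit X y0 z"
    "\<And>e e'. e \<in> ends \<Longrightarrow> e' \<in> ends \<Longrightarrow> same_orbit X e e'"
proof -
  let ?O = "homeo_orbit X"
  have card4: "card (?O ` X) = 4" and fin: "finite (?O ` X)" using four by (auto simp: one_over_homogeneous_def)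
  obtain c where c: "c \<in> C" "0 < f c" by (rule positive_leg)
  define e0 where "e0 = \<Phi> (c, f c)"
  define o0 where "o0 = \<Phi> (c, f c / 2)"
  have e0: "e0 \<in> ends" unfolding e0_def using ends_iff[of c "f c"] c by simp
  have o0: "o0 \<in> interior_points" unfolding o0_def using interior_iff[of c "f c / 2"] c by simp
  have inX: "e \<in> X" if "e \<in> ends \<or> e \<in> interior_points" for e
    using that by (auto simp: ends_def interior_points_def)
  have "\<exists>x\<in>interior_points. \<exists>y\<in>interior_points. \<not> same_orbit X x y"
  proof (rule ccontr)
    assume "\<not> ?thesis"
    then have int: "\<And>x y. x \<in> interior_points \<Longrightarrow> y \<in> interior_points \<Longrightarrow> same_orbit X x y" by blast
    have "?O ` X \<subseteq> {?O T, ?O e0, ?O o0}"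
    proof
      fix S assume "S \<in> ?O ` X"
      then obtain x where x: "x \<in> X" "S = ?O x" by blast
      from X_cases[OF x(1)] show "S \<in> {?O T, ?O e0, ?O o0}"
      proof (elim disjE)
        assume "x = T" then show ?thesis using x by simp
      next
        assume "x \<in> ends"
        then have "same_orbit X x e0" using ends_same_orbit[OF int] e0 by blast
        then show ?thesis using homeo_orbit_eq[OF x(1)] inX e0 x(2) by simp
      next
        assume "x \<in> interior_points"
        then have "same_orbit X x o0" using int o0 by blast
        then show ?thesis using homeo_orbit_eq[OF x(1)] inX o0 x(2) by simp
      qed
    qed
    then have "card (?O ` X) \<le> card {?O T, ?O e0, ?O o0}" by (intro card_mono) auto
    also have "\<dots> \<le> 3" by (simp add: card_insert_if)
    finally show False using card4 by simp
  qed
  then obtain x0 y0 where xy: "x0 \<in> interior_points" "y0 \<in> interior_points" "\<not> same_orbit X x0 y0" by blast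
  have X: "x0 \<in> X" "y0 \<in> X" "e0 \<in> X" using xy e0 inX by blast+
  have notI: "T \<notin> interior_points" "e0 \<notin> interior_points" "T \<notin> ends"
    using e0 by (auto simp: interior_points_def ends_def)
  have nT: "?O T \<noteq> ?O z" if "z \<in> interior_points \<or> z \<in> ends" for z
  proof -
    have "\<not> same_orbit X T z" using same_orbit_T[of T z] that notI by auto
    then show ?thesis using homeo_orbit_eq[OF T_in inX[of z]] that by blast
  qed
  have nE: "?O e0 \<noteq> ?O z" if z: "z \<in> interior_points" for z
  proof -
    have "\<not> same_orbit X e0 z" using same_orbit_interior[of e0 z] z notI(2) X(3) by blast
    then show ?thesis using homeo_orbit_eq[OF X(3) inX[of z]] z by blast
  qed
  have nXY: "?O x0 \<noteq> ?O y0" using xy(3) homeo_orbit_eq[OF X(1,2)] by simp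
  have "card {?O T, ?O e0, ?O x0, ?O y0} = 4"
    using nT[of e0] nT[of x0] nT[of y0] nE[of x0] nE[of y0] nXY e0 xy by simp
  then have all: "{?O T, ?O e0, ?O x0, ?O y0} = ?O ` X"
    using card4 X by (intro card_subset_eq[OF fin]) auto
  show ?thesis
  proof (rule that[OF xy])
    fix z assume z: "z \<in> interior_points"
    then have zX: "z \<in> X" using inX by blast
    have "?O z \<in> {?O T, ?O e0, ?O x0, ?O y0}" unfolding all using zX by blast
    then have "?O x0 = ?O z \<or> ?O y0 = ?O z" using nT[of z] nE[of z] z by auto
    then show "same_orbit X x0 z \<or> same_orbit X y0 z"
      using homeo_orbit_eq[OF X(1) zX] homeo_orbit_eq[OF X(2) zX] by simp
  next
    have *: "same_orbit X e0 e" if e: "e \<in> ends" for e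
    proof -
      have eX: "e \<in> X" using inX e by blast
      have ne: "?O z \<noteq> ?O e" if "z \<in> interior_points" for z
        using same_orbit_interior[of z e] homeo_orbit_eq[OF inX eX, of z] that e inX
        by (auto simp: interior_points_def)
      have "?O e \<in> {?O T, ?O e0, ?O x0, ?O y0}" unfolding all using eX by blast
      then have "?O e0 = ?O e" using nT[of e] ne[of x0] ne[of y0] e xy by auto
      then show ?thesis using homeo_orbit_eq[OF X(3) eX] by simp
    qed
    fix e e' assume "e \<in> ends" "e' \<in> ends"
    then show "same_orbit X e e'"
      using * same_orbit_trans same_orbit_sym[OF X(3)] by blast
  qed
qed

text \<open>A homeomorphism matching the ends of two legs carries one leg onto the other, by
  preservation of the order. Thus every interior orbit meets every leg.\<close>

lemma leg_transport:
  assumes ends: "\<And>e e'. e \<in> ends \<Longrightarrow> e' \<in> ends \<Longrightarrow> same_orbit X e e'"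
    and x: "x \<in> interior_points" and c: "c \<in> C" "0 < f c"
  obtains u where "0 < u" "u < f c" "same_orbit X x (\<Phi> (c, u))"
proof -
  obtain d v where d: "d \<in> C" "0 < v" "v < f d" "x = \<Phi> (d, v)" using interior_coords[OF x] .
  have z: "(d, v) \<in> hypograph C f" "(d, f d) \<in> hypograph C f" "(c, f c) \<in> hypograph C f" using c d by simp_all
  have "\<Phi> (d, f d) \<in> ends" "\<Phi> (c, f c) \<in> ends" using ends_iff[of d "f d"] ends_iff[of c "f c"] c d by auto
  then obtain h k where h: "homeomorphism X X h k" "h (\<Phi> (d, f d)) = \<Phi> (c, f c)"
    using ends unfolding same_orbit_def by blast
  have xX: "x \<in> X" using \<Phi>_in[OF z(1)] d(4) by simp
  have "x \<in> seg T (\<Phi> (d, f d))" using \<Phi>_order[OF z(1,2)] d by simp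
  then have ord: "h x \<in> seg T (\<Phi> (c, f c))" using hom_order[OF h(1) xX \<Phi>_in[OF z(2)]] h(2) by simp
  have "h x \<in> interior_points" using hom_interior_points_iff[OF h(1) xX] x by simp
  then obtain c' u where c': "c' \<in> C" "0 < u" "u < f c'" "h x = \<Phi> (c', u)" by (rule interior_coords)
  have "c' = c" using \<Phi>_order[of c' u c "f c"] ord c' c by simp
  moreover have "same_orbit X x (h x)" using h(1) unfolding same_orbit_def by blast
  ultimately show ?thesis using that[of u] c' by simp
qed

text \<open>Representatives of both interior orbits can be moved to the given leg, where the
  hypothesis makes them equivalent.\<close>

lemma two_orbits_on_leg:
  assumes four: "one_over_homogeneous 4 X" and c: "c \<in> C" "0 < f c"
    and same: "\<And>t0 t1. \<lbrakk>0 < t0; t0 < t1; t1 < f c\<rbrakk> \<Longrightarrow> same_orbit X (\<Phi> (c, t0)) (\<Phi> (c, t1))"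
  shows False
proof -
  obtain x0 y0 where xy: "x0 \<in> interior_points" "y0 \<in> interior_points" "\<not> same_orbit X x0 y0"
    and ends: "\<And>e e'. e \<in> ends \<Longrightarrow> e' \<in> ends \<Longrightarrow> same_orbit X e e'"
    using four_orbits[OF four] by metis
  obtain u where u: "0 < u" "u < f c" "same_orbit X x0 (\<Phi> (c, u))" by (rule leg_transport[OF ends xy(1) c])
  obtain v where v: "0 < v" "v < f c" "same_orbit X y0 (\<Phi> (c, v))" by (rule leg_transport[OF ends xy(2) c])
  have X: "x0 \<in> X" "y0 \<in> X" "\<Phi> (c, u) \<in> X" "\<Phi> (c, v) \<in> X"
    using xy u v c by (auto simp: interior_points_def intro!: \<Phi>_in)
  have "same_orbit X (\<Phi> (c, u)) (\<Phi> (c, v))"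
  proof (cases u v rule: linorder_cases)
    case less then show ?thesis using same u v by blast
  next
    case equal then show ?thesis using same_orbit_refl by simp
  next
    case greater then show ?thesis using same[of v u] u v same_orbit_sym[OF X(4)] by blast
  qed
  then have "same_orbit X x0 y0"
    using u(3) v(3) same_orbit_trans same_orbit_sym[OF X(2)] by blast
  then show False using xy by blast
qed

text \<open>Each leg is stretched by the same slopes at its two ends, adapted to its own length. The
  only issue is continuity of this map where lengths of nearby legs vary.\<close>

lemma isolated_ends_same_orbit:
  assumes iso: "closure ends \<inter> interior_points = {}" and c: "c \<in> C"
    and t: "0 < t0" "t0 < t1" "t1 < f c"
  shows "same_orbit X (\<Phi> (c, t0)) (\<Phi> (c, t1))"
proof -
  let ?Z = "hypograph C f"
  obtain k j where kj: "1 < k" "1 < j" "stretch k j (f c) t0 = t1" using stretch_hits[OF t] .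
  define G where "G = (\<lambda>z. (fst z, stretch k j (f (fst z)) (snd z)))"
  define G' where "G' = (\<lambda>z. (fst z, shrink k j (f (fst z)) (snd z)))"
  have mem: "fst z \<in> C \<and> 0 \<le> snd z \<and> snd z \<le> f (fst z)" if "z \<in> ?Z" for z
    using that by (cases z) simp
  have GZ: "G z \<in> ?Z" if "z \<in> ?Z" for z
    using mem[OF that] stretch_nonneg[OF kj(1,2)] stretch_le[OF kj(1,2)] by (simp add: G_def)
  have G'Z: "G' z \<in> ?Z" if "z \<in> ?Z" for z
    using mem[OF that] shrink_nonneg[OF kj(1,2)] shrink_le[OF kj(1,2)] by (force simp: G'_def)
  have "bij_betw G ?Z ?Z"
  proof (rule bij_betw_byWitness[where f' = G'])
    show "\<forall>z\<in>?Z. G' (G z) = z"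
      using mem shrink_stretch[OF kj(1,2)] by (auto simp: G_def G'_def prod_eq_iff)
    show "\<forall>z\<in>?Z. G (G' z) = z"
      using mem stretch_shrink[OF kj(1,2)] by (auto simp: G_def G'_def prod_eq_iff)
  qed (use GZ G'Z in auto)
  moreover have "snd (G z) = 0 \<longleftrightarrow> snd z = 0" if z: "z \<in> ?Z" for z
  proof
    assume "snd (G z) = 0"
    then show "snd z = 0" using mem[OF z] stretch_ge[OF kj(1,2), of "snd z" "f (fst z)"] by (simp add: G_def)
  next
    assume "snd z = 0"
    then show "snd (G z) = 0" using mem[OF z] kj by (simp add: G_def stretch_def divide_le_eq mult_le_cancel_left1)
  qed
  moreover have "continuous_on ?Z G"
  proof (rule continuous_on_compact_closed_graph[OF compact_hypograph])
    show "G ` ?Z \<subseteq> ?Z" using GZ by blast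
    fix z w l assume z: "\<And>n. z n \<in> ?Z" "z \<longlonglongrightarrow> w" "w \<in> ?Z" "(\<lambda>n. G (z n)) \<longlonglongrightarrow> l"
    have fs: "(\<lambda>n. fst (z n)) \<longlonglongrightarrow> fst w" "(\<lambda>n. snd (z n)) \<longlonglongrightarrow> snd w"
      using tendsto_fst[OF z(2)] tendsto_snd[OF z(2)] .
    have gl: "(\<lambda>n. fst (z n)) \<longlonglongrightarrow> fst l" "(\<lambda>n. stretch k j (f (fst (z n))) (snd (z n))) \<longlonglongrightarrow> snd l"
      using tendsto_fst[OF z(4)] tendsto_snd[OF z(4)] by (simp_all add: G_def)
    have l1: "fst l = fst w" using LIMSEQ_unique[OF gl(1) fs(1)] .
    have "snd l = stretch k j (f (fst w)) (snd w)"
    proof (cases "snd w = 0")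
      case True
      \<comment> \<open>At the base the leg lengths need not converge, but \<open>stretch\<close> is
        at most \<open>k\<close> times the height, whatever the length.\<close>
      have "(\<lambda>n. k * snd (z n)) \<longlonglongrightarrow> k * 0" using fs(2) True by (intro tendsto_mult tendsto_const) simp
      then have lim0: "(\<lambda>n. k * snd (z n)) \<longlonglongrightarrow> 0" by simp
      have "(\<lambda>n. stretch k j (f (fst (z n))) (snd (z n))) \<longlonglongrightarrow> 0"
      proof (rule tendsto_sandwich[OF _ _ tendsto_const lim0])
        show "\<forall>\<^sub>F n in sequentially. 0 \<le> stretch k j (f (fst (z n))) (snd (z n))"
          using mem[OF z(1)] stretch_nonneg[OF kj(1,2)] by simp
        show "\<forall>\<^sub>F n in sequentially. stretch k j (f (fst (z n))) (snd (z n)) \<le> k * snd (z n)"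
          by (simp add: stretch_def)
      qed
      then have "snd l = 0" using LIMSEQ_unique[OF gl(2)] by blast
      moreover have "stretch k j (f (fst w)) 0 = 0"
        using mem[OF z(3)] kj by (simp add: stretch_def divide_le_eq mult_le_cancel_left1)
      ultimately show ?thesis using True by simp
    next
      case False
      then have w0: "0 < snd w" using mem[OF z(3)] by simp
      \<comment> \<open>At positive height a subsequential limit of leg lengths is positive and
        yields a limit of ends. By \<open>iso\<close> this is not an interior point, so it is the
        end of the limit leg: the lengths converge to \<open>f (fst w)\<close>.\<close>
      have "\<forall>n. (fst (z n), f (fst (z n))) \<in> ?Z" using mem[OF z(1)] f_nonneg by simp
      then obtain v s where vs: "v \<in> ?Z" "strict_mono s" "((\<lambda>n. (fst (z n), f (fst (z n)))) \<circ> s) \<longlonglongrightarrow> v"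
        using compact_hypograph unfolding compact_eq_seq_compact_metric by (metis (no_types, lifting) seq_compactE)
      have v12: "(\<lambda>n. fst (z (s n))) \<longlonglongrightarrow> fst v" "(\<lambda>n. f (fst (z (s n)))) \<longlonglongrightarrow> snd v"
        using tendsto_fst[OF vs(3)] tendsto_snd[OF vs(3)] by (auto simp: o_def)
      have zs: "(\<lambda>n. fst (z (s n))) \<longlonglongrightarrow> fst w" "(\<lambda>n. snd (z (s n))) \<longlonglongrightarrow> snd w"
        using LIMSEQ_subseq_LIMSEQ[OF fs(1) vs(2)] LIMSEQ_subseq_LIMSEQ[OF fs(2) vs(2)] by (auto simp: o_def)
      have v1: "fst v = fst w" using LIMSEQ_unique[OF v12(1) zs(1)] .
      have "snd w \<le> snd v" using LIMSEQ_le[OF zs(2) v12(2)] mem[OF z(1)] by blast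
      then have v2: "0 < snd v" "snd v \<le> f (fst w)" using w0 mem[OF vs(1)] v1 by simp_all
      have wC: "fst w \<in> C" using mem[OF z(3)] by simp
      have "\<Phi> (fst w, snd v) \<in> closure ends"
        by (rule closure_ends_limit[OF wC v2 _ zs(1) v12(2)]) (use mem[OF z(1)] in simp)
      then have "\<Phi> (fst w, snd v) \<notin> interior_points" using iso by blast
      then have fv: "f (fst w) = snd v" using interior_iff[OF wC v2] v2 by simp
      have "(\<lambda>n. stretch k j (f (fst (z (s n)))) (snd (z (s n)))) \<longlonglongrightarrow> stretch k j (f (fst w)) (snd w)"
        unfolding stretch_def fv using kj by (intro tendsto_intros v12(2) zs(2)) auto
      then show ?thesis using LIMSEQ_unique LIMSEQ_subseq_LIMSEQ[OF gl(2) vs(2)] by (auto simp: o_def)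
    qed
    then show "l = G w" using l1 by (simp add: G_def prod_eq_iff)
  qed
  moreover have "(c, t0) \<in> ?Z" using c t by simp
  ultimately have "same_orbit X (\<Phi> (c, t0)) (\<Phi> (G (c, t0)))" by (intro lift_homeomorphism)
  then show ?thesis using kj(3) by (simp add: G_def)
qed

end

lemma continuous_on_stretch: "continuous_on A (stretch k j s)"
proof -
  have "continuous_on A (\<lambda>t. min (k * t) (s - (s - t) / j))"
    by (cases "j = 0") (auto intro!: continuous_intros)
  then show ?thesis unfolding stretch_def .
qed

lemma continuous_on_shrink: "continuous_on A (shrink k j s)"
proof -
  have "continuous_on A (\<lambda>u. max (u / k) (s - j * (s - u)))"
    by (cases "k = 0") (auto intro!: continuous_intros)
  then show ?thesis unfolding shrink_def .
qed

lemma compact_covered_interior: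
  fixes D :: "'b::metric_space set"
  assumes D: "compact D" "D \<noteq> {}" and F: "\<And>n::nat. compact (F n)" "(\<Union>n. F n) = D"
  obtains n W where "open W" "W \<inter> D \<noteq> {}" "W \<inter> D \<subseteq> F n"
proof -
  have "\<exists>n. top_of_set D interior_of F n \<noteq> {}"
  proof (rule ccontr)
    assume "\<not> ?thesis"
    then have "top_of_set D interior_of \<Union> (range F) = {}"
    proof (intro Baire_category_alt)
      have "compact_space (top_of_set D)" using D(1) by (simp add: compact_space_subtopology)
      moreover have "Hausdorff_space (top_of_set D)"
        by (intro Hausdorff_space_subtopology Hausdorff_space_euclidean)
      ultimately show "completely_metrizable_space (top_of_set D)
          \<or> locally_compact_space (top_of_set D) \<and> regular_space (top_of_set D)"
        using compact_Hausdorff_imp_regular_space compact_imp_locally_compact_space by blast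
      show "closedin (top_of_set D) T \<and> top_of_set D interior_of T = {}"
        if "\<not> (\<exists>n. top_of_set D interior_of F n \<noteq> {})" "T \<in> range F" for T
        using that F by (auto intro!: closed_subset compact_imp_closed)
    qed auto
    then show False using F(2) D(2) interior_of_topspace[of "top_of_set D"] by simp
  qed
  then obtain n where "top_of_set D interior_of F n \<noteq> {}" by blast
  moreover have "openin (top_of_set D) (top_of_set D interior_of F n)" by (rule openin_interior_of)
  then obtain W where "open W" "top_of_set D interior_of F n = D \<inter> W" unfolding openin_open by blast
  moreover have "top_of_set D interior_of F n \<subseteq> F n" by (rule interior_of_subset)
  ultimately show ?thesis using that[of W n] by (simp add: Int_commute)
qed

section \<open>The case of dense ends\<close>

context fan_coordinates
begin

lemma dense_ends_lelek:
  assumes dense: "interior_points \<subseteq> closure ends"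
  shows "lelek C f"
  unfolding lelek_def
proof (intro ballI allI impI, elim conjE)
  fix c and r e :: real
  assume c: "c \<in> C" and r: "0 < r" "r < f c" and e: "0 < e"
  have "\<Phi> (c, r) \<in> closure ends" using dense interior_iff[of c r] c r by auto
  then obtain x where x: "\<And>n::nat. x n \<in> C" "x \<longlonglongrightarrow> c" "(\<lambda>n. f (x n)) \<longlonglongrightarrow> r"
    using closure_ends_coords[of c r] c r by (metis less_imp_le)
  have "\<forall>\<^sub>F n in sequentially. dist (x n) c < e \<and> dist (f (x n)) r < e"
    using tendstoD[OF x(2) e] tendstoD[OF x(3) e] by (rule eventually_conj)
  then obtain n where "dist (x n) c < e" "dist (f (x n)) r < e"
    using eventually_happens by force
  then show "\<exists>d\<in>C. dist d c < e \<and> \<bar>f d - r\<bar> < e" using x(1) by (auto simp: dist_real_def)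
qed

text \<open>A height change \<open>\<rho>\<close> of the interval from 0 to the maximum
  \<open>M\<close> with \<open>\<rho> t0 = t1\<close> turns \<open>f\<close> into another Lelek
  function. The equivalence of the two functions, followed by the inverse height change, is a
  homeomorphism of the hypograph of \<open>f\<close>; it is arranged to move the leg over
  \<open>c\<close> by that inverse alone.\<close>

lemma dense_ends_same_orbit:
  assumes dense: "interior_points \<subseteq> closure ends" and c: "peak f C c"
    and t: "0 < t0" "t0 < t1" "t1 < f c"
  shows "same_orbit X (\<Phi> (c, t0)) (\<Phi> (c, t1))"
proof -
  let ?Z = "hypograph C f"
  define M where "M = f c"
  have cC: "c \<in> C" and fM: "\<And>d. d \<in> C \<Longrightarrow> f d \<le> M" using c by (auto simp: peak_def M_def)
  have tM: "0 < t0" "t0 < t1" "t1 < M" using t by (auto simp: M_def)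
  obtain k j where kj: "1 < k" "1 < j" "stretch k j M t0 = t1" using stretch_hits[OF tM] .
  define \<rho> where "\<rho> = stretch k j M"
  define \<rho>' where "\<rho>' = shrink k j M"
  note st = stretch_nonneg[OF kj(1,2), of _ M, folded \<rho>_def] stretch_le[OF kj(1,2), of _ M, folded \<rho>_def]
    stretch_ge[OF kj(1,2), of _ M, folded \<rho>_def]
  note sh = shrink_nonneg[OF kj(1,2), of _ M, folded \<rho>'_def] shrink_le[OF kj(1,2), of _ M, folded \<rho>'_def]
  note inv = shrink_stretch[OF kj(1,2), of _ M, folded \<rho>_def \<rho>'_def]
    stretch_shrink[OF kj(1,2), of _ M, folded \<rho>_def \<rho>'_def]
  note mono = stretch_mono[OF kj(1,2), of _ _ M, folded \<rho>_def] shrink_mono[OF kj(1,2), of _ _ M, folded \<rho>'_def]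
  have cont: "continuous_on A \<rho>" "continuous_on A \<rho>'" for A
    unfolding \<rho>_def \<rho>'_def by (rule continuous_on_stretch continuous_on_shrink)+
  have \<rho>M: "\<rho> M = M" using st(2,3)[of M] tM by auto
  define f' where "f' = (\<lambda>d. \<rho> (f d))"
  \<comment> \<open>Since \<open>\<rho>\<close> is an increasing homeomorphism, compactness of the
    new hypograph is inherited as that of a continuous image.\<close>
  have hyp': "hypograph C f' = (\<lambda>z. (fst z, \<rho> (snd z))) ` ?Z"
  proof
    show "hypograph C f' \<subseteq> (\<lambda>z. (fst z, \<rho> (snd z))) ` ?Z"
    proof
      fix z assume z: "z \<in> hypograph C f'"
      obtain d u where du: "z = (d, u)" by fastforce
      have d: "d \<in> C" "0 \<le> u" "u \<le> \<rho> (f d)" using z du by (auto simp: f'_def)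
      have uM: "u \<le> M" using d(3) st(2)[OF f_nonneg fM] d(1) by fastforce
      have "\<rho>' u \<le> \<rho>' (\<rho> (f d))" using mono(2)[OF d(3)] .
      also have "\<dots> = f d" using inv(1)[OF f_nonneg fM] d(1) by blast
      finally have "(d, \<rho>' u) \<in> ?Z" using d sh(1)[OF d(2) uM] by simp
      moreover have "z = (d, \<rho> (\<rho>' u))" using inv(2)[OF d(2) uM] du by simp
      ultimately show "z \<in> (\<lambda>z. (fst z, \<rho> (snd z))) ` ?Z"
        by (intro image_eqI[of z _ "(d, \<rho>' u)"]) simp_all
    qed
    show "(\<lambda>z. (fst z, \<rho> (snd z))) ` ?Z \<subseteq> hypograph C f'"
    proof clarsimp
      fix d u assume d: "d \<in> C" "0 \<le> u" "u \<le> f d"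
      then show "0 \<le> \<rho> u \<and> \<rho> u \<le> f' d"
        using st(1)[of u] fM[of d] mono(1)[of u "f d"] by (simp add: f'_def)
    qed
  qed
  have U: "usc_positive C f'"
  proof
    show "compact C" by (rule compact_C)
    show "\<exists>U. clopen_in C U \<and> c \<in> U \<and> U \<subseteq> ball c e" if "c \<in> C" "0 < e" for c e
      using small_clopen[OF that] .
    show "0 \<le> f' d" if "d \<in> C" for d using st(1)[OF f_nonneg fM] that by (simp add: f'_def)
    show "compact (hypograph C f')"
      unfolding hyp'
      by (intro compact_continuous_image compact_hypograph continuous_on_Pair continuous_on_fst continuous_on_id
          continuous_on_compose2[OF cont(1)[of UNIV]] continuous_on_snd) auto
    show "\<exists>d\<in>C. dist d c < e \<and> 0 < f' d" if ce: "c \<in> C" "0 < e" for c e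
    proof -
      obtain d where d: "d \<in> C" "dist d c < e" "0 < f d" using f_pos_dense[OF ce] by blast
      have "f d \<le> f' d" using st(3)[of "f d"] fM[OF d(1)] d(3) by (simp add: f'_def)
      then show ?thesis using d by force
    qed
  qed
  have lel: "lelek C f" using dense by (rule dense_ends_lelek)
  have lel': "lelek C f'"
    unfolding lelek_def
  proof (intro ballI allI impI, elim conjE)
    fix d and r e :: real
    assume d: "d \<in> C" and r: "0 < r" "r < f' d" and e: "0 < e"
    have rM: "r \<le> M" using r(2) st(2)[OF f_nonneg[OF d] fM[OF d]] by (simp add: f'_def)
    define q where "q = \<rho>' r"
    have \<rho>q: "\<rho> q = r" using inv(2)[of r] r rM by (simp add: q_def)
    have q0: "0 \<le> q" using sh(1)[of r] r rM by (simp add: q_def)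
    have "\<rho> 0 = 0" using inv(2)[of 0] sh(1,2)[of 0] tM by simp
    then have qpos: "0 < q" using q0 \<rho>q r by (cases "q = 0") auto
    have qf: "q < f d"
    proof (rule ccontr)
      assume "\<not> q < f d"
      then have "\<rho> (f d) \<le> \<rho> q" using mono(1) by simp
      then show False using \<rho>q r by (simp add: f'_def)
    qed
    have "continuous (at q) \<rho>" using cont(1)[of UNIV] by (simp add: continuous_on_eq_continuous_at)
    then obtain \<delta> where \<delta>: "\<delta> > 0" "\<And>x. dist x q < \<delta> \<Longrightarrow> dist (\<rho> x) (\<rho> q) < e"
      using e unfolding continuous_at_eps_delta by (auto simp: dist_real_def)
    obtain x where x: "x \<in> C" "dist x d < min e \<delta>" "\<bar>f x - q\<bar> < min e \<delta>"
      using lel d qpos qf e \<delta>(1) unfolding lelek_def by (metis min_less_iff_conj)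
    have "\<bar>f' x - r\<bar> < e" using \<delta>(2)[of "f x"] x(3) \<rho>q by (simp add: f'_def dist_real_def)
    then show "\<exists>x\<in>C. dist x d < e \<and> \<bar>f' x - r\<bar> < e" using x by auto
  qed
  have c': "peak f' C c"
    unfolding peak_def f'_def using cC fM mono(1) by (auto simp: M_def)
  interpret pair: usc_pair C f C f'
    unfolding usc_pair_def using U usc_positive_axioms by blast
  obtain \<sigma> \<alpha> where bij: "bij_betw \<sigma> C C" and cont_\<sigma>: "continuous_on C \<sigma>" and cont_\<alpha>: "continuous_on C \<alpha>"
    and \<alpha>: "\<And>x. x \<in> C \<Longrightarrow> 0 < \<alpha> x \<and> f' (\<sigma> x) = \<alpha> x * f x" and \<sigma>c: "\<sigma> c = c"
    using pair.lelek_equivalence[OF lel lel' c c'] by metis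
  \<comment> \<open>Here maximality of \<open>f c\<close> pays off: \<open>\<sigma>\<close> fixes
    \<open>c\<close> and \<open>\<rho>\<close> fixes \<open>M\<close>, so the multiplier on this leg
    is \<open>M / M\<close>.\<close>
  have \<alpha>c: "\<alpha> c = 1" using \<alpha>[OF cC] \<sigma>c \<rho>M tM by (simp add: f'_def M_def)
  have \<sigma>C: "\<sigma> x \<in> C" if "x \<in> C" for x using bij that by (auto simp: bij_betw_def)
  \<comment> \<open>Multiplication by \<open>\<alpha>\<close> maps the leg over \<open>x\<close>
    onto that of \<open>f'\<close> over \<open>\<sigma> x\<close>, and \<open>\<rho>'\<close> brings
    it back to the leg of \<open>f\<close> over \<open>\<sigma> x\<close>.\<close>
  define G where "G = (\<lambda>z. (\<sigma> (fst z), \<rho>' (\<alpha> (fst z) * snd z)))"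
  have mem: "fst z \<in> C" "0 \<le> snd z" "snd z \<le> f (fst z)" if "z \<in> ?Z" for z
    using that by (cases z; simp)+
  have bd: "0 \<le> \<alpha> (fst z) * snd z" "\<alpha> (fst z) * snd z \<le> \<rho> (f (\<sigma> (fst z)))" "\<alpha> (fst z) * snd z \<le> M"
    if z: "z \<in> ?Z" for z
  proof -
    have a: "0 < \<alpha> (fst z)" "f' (\<sigma> (fst z)) = \<alpha> (fst z) * f (fst z)" using \<alpha>[OF mem(1)[OF z]] by auto
    show "0 \<le> \<alpha> (fst z) * snd z" using a mem(2)[OF z] by simp
    have "\<alpha> (fst z) * snd z \<le> \<alpha> (fst z) * f (fst z)" using a(1) mem(3)[OF z] by simp
    then show le: "\<alpha> (fst z) * snd z \<le> \<rho> (f (\<sigma> (fst z)))" using a(2) by (simp add: f'_def)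
    have "\<rho> (f (\<sigma> (fst z))) \<le> M" using st(2) f_nonneg fM \<sigma>C[OF mem(1)[OF z]] by blast
    then show "\<alpha> (fst z) * snd z \<le> M" using le by linarith
  qed
  have GZ: "G z \<in> ?Z" if z: "z \<in> ?Z" for z
  proof -
    have "\<rho>' (\<alpha> (fst z) * snd z) \<le> \<rho>' (\<rho> (f (\<sigma> (fst z))))" using mono(2)[OF bd(2)[OF z]] .
    also have "\<dots> = f (\<sigma> (fst z))" using inv(1) f_nonneg fM \<sigma>C[OF mem(1)[OF z]] by blast
    finally show ?thesis using sh(1)[OF bd(1,3)[OF z]] \<sigma>C[OF mem(1)[OF z]] by (simp add: G_def)
  qed
  have inj: "inj_on G ?Z"
  proof (rule inj_onI)
    fix z w assume zw: "z \<in> ?Z" "w \<in> ?Z" "G z = G w"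
    then have "\<sigma> (fst z) = \<sigma> (fst w)" by (simp add: G_def)
    then have eq: "fst z = fst w" using bij mem(1)[OF zw(1)] mem(1)[OF zw(2)] by (auto simp: bij_betw_def inj_on_def)
    have "\<rho> (\<rho>' (\<alpha> (fst z) * snd z)) = \<rho> (\<rho>' (\<alpha> (fst w) * snd w))" using zw(3) by (simp add: G_def)
    then have "\<alpha> (fst z) * snd z = \<alpha> (fst w) * snd w"
      using inv(2)[OF bd(1,3)[OF zw(1)]] inv(2)[OF bd(1,3)[OF zw(2)]] by simp
    then have "snd z = snd w" using eq \<alpha>[OF mem(1)[OF zw(1)]] by simp
    then show "z = w" using eq by (simp add: prod_eq_iff)
  qed
  have surj: "?Z \<subseteq> G ` ?Z"
  proof
    fix w assume w: "w \<in> ?Z"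
    have "fst w \<in> \<sigma> ` C" using bij mem(1)[OF w] by (simp add: bij_betw_def)
    then obtain d where "fst w = \<sigma> d" "d \<in> C" by (rule imageE)
    then have d: "d \<in> C" "\<sigma> d = fst w" by simp_all
    have a: "0 < \<alpha> d" "f' (\<sigma> d) = \<alpha> d * f d" using \<alpha>[OF d(1)] by auto
    have wM: "snd w \<le> M" using mem(3)[OF w] fM[OF mem(1)[OF w]] by linarith
    define z where "z = (d, \<rho> (snd w) / \<alpha> d)"
    have "\<rho> (snd w) \<le> \<alpha> d * f d" using mono(1)[OF mem(3)[OF w]] a(2) d(2) by (simp add: f'_def)
    then have "\<rho> (snd w) / \<alpha> d \<le> f d" using a(1) by (simp add: divide_le_eq mult.commute)
    moreover have "0 \<le> \<rho> (snd w) / \<alpha> d" using a(1) st(1)[OF mem(2)[OF w] wM] by simp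
    ultimately have "z \<in> ?Z" using d(1) by (simp add: z_def)
    moreover have "G z = w"
      using a(1) d(2) inv(1)[OF mem(2)[OF w] wM] by (simp add: G_def z_def prod_eq_iff)
    ultimately show "w \<in> G ` ?Z" by blast
  qed
  have "bij_betw G ?Z ?Z" unfolding bij_betw_def using inj surj GZ by blast
  moreover have "continuous_on ?Z G"
    unfolding G_def
    by (intro continuous_on_Pair continuous_on_compose2[OF cont(2)[of UNIV]] continuous_on_mult
        continuous_on_compose2[OF cont_\<sigma>] continuous_on_compose2[OF cont_\<alpha>] continuous_on_fst
        continuous_on_snd continuous_on_id) (use mem(1) in auto)
  moreover have "snd (G z) = 0 \<longleftrightarrow> snd z = 0" if z: "z \<in> ?Z" for z
  proof
    assume "snd (G z) = 0"
    then have "\<alpha> (fst z) * snd z = \<rho> 0" using inv(2)[OF bd(1,3)[OF z]] by (simp add: G_def)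
    moreover have "\<rho> 0 = 0" using inv(2)[of 0] sh(1,2)[of 0] tM by simp
    ultimately show "snd z = 0" using \<alpha>[OF mem(1)[OF z]] by auto
  next
    assume "snd z = 0"
    then show "snd (G z) = 0" using sh(1,2)[of 0] tM by (simp add: G_def)
  qed
  moreover have z1: "(c, t1) \<in> ?Z" and z0: "(c, t0) \<in> ?Z" using cC t by simp_all
  ultimately have s: "same_orbit X (\<Phi> (c, t1)) (\<Phi> (G (c, t1)))" by (intro lift_homeomorphism)
  have "G (c, t1) = (c, t0)"
    using \<sigma>c \<alpha>c inv(1)[of t0] kj(3) tM by (simp add: G_def \<rho>_def)
  then show ?thesis using s same_orbit_sym[OF \<Phi>_in[OF z1]] by simp
qed

end

section \<open>The mixed case: a Baire category argument\<close>

context fan_coordinates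
begin

text \<open>Suppose the interior limits of ends on the leg all lie below \<open>u\<close>.
  Homogeneity among them leaves just one, at height \<open>b\<close>: a homeomorphism raising a
  lower one to the highest would push the highest further up. But then a point above
  \<open>b\<close> and one below it would both be nonlimits, hence equivalent, although only one has
  an interior limit of ends beneath it.\<close>

lemma end_limit_above:
  assumes ends: "\<And>e e'. e \<in> ends \<Longrightarrow> e' \<in> ends \<Longrightarrow> same_orbit X e e'"
    and L: "\<And>x y. \<lbrakk>x \<in> interior_points \<inter> closure ends; y \<in> interior_points \<inter> closure ends\<rbrakk> \<Longrightarrow> same_orbit X x y"
    and N: "\<And>x y. \<lbrakk>x \<in> interior_points - closure ends; y \<in> interior_points - closure ends\<rbrakk> \<Longrightarrow> same_orbit X x y"
    and ne: "interior_points \<inter> closure ends \<noteq> {}"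
    and c: "c \<in> C" and u: "0 < u" "u < f c" "\<Phi> (c, u) \<notin> closure ends"
  shows "\<exists>v. u < v \<and> v < f c \<and> \<Phi> (c, v) \<in> closure ends"
proof (rule ccontr)
  assume no: "\<not> ?thesis"
  have none: "v \<le> u" if "v < f c" "\<Phi> (c, v) \<in> closure ends" for v
    using no that by (meson not_le)
  define S where "S = {v. 0 < v \<and> v < f c \<and> \<Phi> (c, v) \<in> closure ends}"
  have fc: "0 < f c" using u by simp
  have Z: "(c, v) \<in> hypograph C f" if "0 \<le> v" "v < f c" for v using that c by simp
  have int: "\<Phi> (c, v) \<in> interior_points" if "0 < v" "v < f c" for v
    using interior_iff[of c v] that c by simp
  obtain x where x: "x \<in> interior_points" "x \<in> closure ends" using ne by blast
  have xX: "x \<in> X" using x by (simp add: interior_points_def)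
  obtain v0 where v0: "0 < v0" "v0 < f c" "same_orbit X x (\<Phi> (c, v0))"
    by (rule leg_transport[OF ends x(1) c fc])
  \<comment> \<open>An interior limit of ends exists somewhere and can be transported to this
    leg.\<close>
  have "v0 \<in> S" using v0 same_orbit_closure_ends[OF v0(3) xX] x(2) by (simp add: S_def)
  then have Sne: "S \<noteq> {}" by blast
  have Su: "v \<le> u" if "v \<in> S" for v using that none by (simp add: S_def)
  have bdd: "bdd_above S" using Su by (rule bdd_aboveI)
  define b where "b = Sup S"
  have bu: "b \<le> u" unfolding b_def using Sne Su by (rule cSup_least)
  have Sb: "v \<le> b" if "v \<in> S" for v unfolding b_def using that bdd by (rule cSup_upper)
  have b0: "0 < b" using Sb[OF \<open>v0 \<in> S\<close>] v0 by linarith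
  obtain s where s: "\<And>n::nat. s n \<in> S" "s \<longlonglongrightarrow> b"
    using closure_contains_Sup[OF Sne bdd] unfolding b_def closure_sequential by blast
  have bf: "b < f c" using bu u by linarith
  have lim: "(\<lambda>n. (c, s n)) \<longlonglongrightarrow> (c, b)" using s(2) by (intro tendsto_Pair tendsto_const)
  have lim\<Phi>: "(\<lambda>n. \<Phi> (c, s n)) \<longlonglongrightarrow> \<Phi> (c, b)"
    by (rule continuous_on_tendsto_compose[OF cont_\<Phi> lim])
      (use s(1) b0 bf c in \<open>auto simp: S_def less_imp_le\<close>)
  have mem: "\<Phi> (c, s n) \<in> closure ends" for n using s(1)[of n] by (simp add: S_def)
  have bcl: "\<Phi> (c, b) \<in> closure ends" by (rule closed_sequentially[OF closed_closure mem lim\<Phi>])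
  have bS: "b \<in> S" using bcl b0 bf by (simp add: S_def)
  have "b \<noteq> u" using bcl u by auto
  then have bu': "b < u" using bu by simp
  have X: "\<Phi> (c, v) \<in> X" if "0 \<le> v" "v < f c" for v using \<Phi>_in[OF Z[OF that]] .
  have ord: "\<Phi> (c, v) \<in> seg T (\<Phi> (c, w))" if "0 < v" "v \<le> w" "w < f c" for v w
    using \<Phi>_order[of c v c w] that c by simp
  have only: "v = b" if v: "v \<in> S" for v
  proof (rule ccontr)
    assume "v \<noteq> b"
    then have vb: "v < b" using Sb[OF v] by simp
    have v': "0 < v" "v < f c" "\<Phi> (c, v) \<in> closure ends" using v by (auto simp: S_def)
    obtain h k where h: "homeomorphism X X h k" "h (\<Phi> (c, v)) = \<Phi> (c, b)"
      using L[of "\<Phi> (c, v)" "\<Phi> (c, b)"] int v' bcl b0 bf unfolding same_orbit_def by blast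
    let ?y = "h (\<Phi> (c, b))"
    have "?y \<in> interior_points" "?y \<in> closure ends"
      using hom_interior_points_iff[OF h(1) X[of b]] hom_closure_ends_iff[OF h(1) X[of b]] int[OF b0 bf] bcl b0 bf
      by simp_all
    then obtain d w where d: "d \<in> C" "0 < w" "w < f d" "?y = \<Phi> (d, w)" by (metis interior_coords)
    have "\<Phi> (c, b) \<in> seg T ?y"
      using hom_order[OF h(1) X[of v] X[of b]] h(2) ord[of v b] v' vb b0 bf by simp
    then have dw: "d = c" "b \<le> w" using \<Phi>_order[of c b d w] d c b0 bf by simp_all
    then have "w \<in> S" using d \<open>?y \<in> closure ends\<close> by (simp add: S_def)
    then have "w = b" using Sb dw by force
    then have "h (\<Phi> (c, b)) = h (\<Phi> (c, v))" using d dw h(2) by simp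
    then have "\<Phi> (c, b) = \<Phi> (c, v)" using hom_inj[OF h(1)] X[of b] X[of v] b0 bf v' by (simp add: inj_on_def)
    then show False using \<Phi>_inj[of "(c, b)" "(c, v)"] c b0 bf v' vb by simp
  qed
  have half: "0 < b / 2" "b / 2 < b" using b0 by simp_all
  then have "\<Phi> (c, b / 2) \<notin> closure ends" using only[of "b / 2"] bf by (auto simp: S_def)
  \<comment> \<open>The homeomorphism moving \<open>u\<close> down to \<open>b / 2\<close> carries
    the limit at \<open>b\<close> to a limit at height at most \<open>b / 2\<close>, where there is
    none.\<close>
  moreover have "\<Phi> (c, b / 2) \<in> interior_points" using int half bf by simp
  ultimately obtain h k where h: "homeomorphism X X h k" "h (\<Phi> (c, u)) = \<Phi> (c, b / 2)"
    using N[of "\<Phi> (c, u)" "\<Phi> (c, b / 2)"] int[OF u(1,2)] u(3) unfolding same_orbit_def by blast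
  let ?y = "h (\<Phi> (c, b))"
  have y: "?y \<in> interior_points" "?y \<in> closure ends"
    using hom_interior_points_iff[OF h(1) X[of b]] hom_closure_ends_iff[OF h(1) X[of b]] int[OF b0 bf] bcl b0 bf
    by simp_all
  then obtain d w where d: "d \<in> C" "0 < w" "w < f d" "?y = \<Phi> (d, w)" by (metis interior_coords)
  have "?y \<in> seg T (\<Phi> (c, b / 2))"
    using hom_order[OF h(1) X[of b] X[of u]] h(2) ord[of b u] u bu' b0 bf by simp
  then have dw: "d = c" "w \<le> b / 2" using \<Phi>_order[of d w c "b / 2"] d c half bf by simp_all
  then have "w \<in> S" using d y by (simp add: S_def)
  then show False using only[of w] dw half by simp
qed

text \<open>Baire's theorem provides an open family of legs on which some limit of ends lies at
  height at least \<open>t1\<close> and a uniform amount below the end. The first limit on one such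
  leg is itself approached by ends of nearby legs, and the limits uniformly below those ends
  accumulate at a limit that comes earlier still.\<close>

lemma not_two_kinds:
  assumes ends: "\<And>e e'. e \<in> ends \<Longrightarrow> e' \<in> ends \<Longrightarrow> same_orbit X e e'"
    and L: "\<And>x y. \<lbrakk>x \<in> interior_points \<inter> closure ends; y \<in> interior_points \<inter> closure ends\<rbrakk> \<Longrightarrow> same_orbit X x y"
    and N: "\<And>x y. \<lbrakk>x \<in> interior_points - closure ends; y \<in> interior_points - closure ends\<rbrakk> \<Longrightarrow> same_orbit X x y"
    and ne: "interior_points \<inter> closure ends \<noteq> {}" and ne': "interior_points - closure ends \<noteq> {}"
  shows False
proof -
  let ?Z = "hypograph C f"
  obtain c1 t1 where c1: "c1 \<in> C" "0 < t1" "t1 < f c1" "\<Phi> (c1, t1) \<notin> closure ends"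
    using ne' interior_coords by (metis DiffE all_not_in_conv)
  \<comment> \<open>A point outside the closure of the ends has a neighbourhood free of ends; in
    coordinates, lengths of legs near \<open>c1\<close> keep a definite distance from
    \<open>t1\<close>.\<close>
  have "\<exists>e>0. \<forall>c\<in>C. dist c c1 < e \<longrightarrow> e \<le> \<bar>f c - t1\<bar>"
  proof (rule ccontr)
    assume no: "\<not> ?thesis"
    have "\<exists>c. c \<in> C \<and> dist c c1 < 1 / Suc n \<and> \<bar>f c - t1\<bar> < 1 / Suc n" for n :: nat
    proof -
      have "0 < 1 / real (Suc n)" by simp
      then show ?thesis using no by (metis not_le)
    qed
    then obtain x where x: "\<And>n. x n \<in> C" "\<And>n. dist (x n) c1 < 1 / Suc n" "\<And>n. \<bar>f (x n) - t1\<bar> < 1 / Suc n"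
      by metis
    have inv0: "(\<lambda>n. 1 / real (Suc n)) \<longlonglongrightarrow> 0" using LIMSEQ_Suc[OF lim_1_over_n] by simp
    have "(\<lambda>n. dist (x n) c1) \<longlonglongrightarrow> 0"
      by (rule tendsto_sandwich[OF _ _ tendsto_const inv0]) (use x(2) in \<open>auto intro!: always_eventually less_imp_le\<close>)
    then have x1: "x \<longlonglongrightarrow> c1" using tendsto_dist_iff by blast
    have "(\<lambda>n. dist (f (x n)) t1) \<longlonglongrightarrow> 0"
      by (rule tendsto_sandwich[OF _ _ tendsto_const inv0])
        (use x(3) in \<open>auto simp: dist_real_def intro!: always_eventually less_imp_le\<close>)
    then have "(\<lambda>n. f (x n)) \<longlonglongrightarrow> t1" using tendsto_dist_iff by blast
    then have "\<Phi> (c1, t1) \<in> closure ends" using closure_ends_limit[OF c1(1,2) _ x(1) x1] c1(3) by simp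
    then show False using c1 by blast
  qed
  then obtain \<delta> where \<delta>: "\<delta> > 0" "\<And>c. c \<in> C \<Longrightarrow> dist c c1 < \<delta> \<Longrightarrow> \<delta> \<le> \<bar>f c - t1\<bar>" by blast
  obtain U where U: "clopen_in C U" "c1 \<in> U" "U \<subseteq> ball c1 \<delta>" using small_clopen[OF c1(1) \<delta>(1)] by blast
  have UC: "c \<in> C" "\<delta> \<le> \<bar>f c - t1\<bar>" if "c \<in> U" for c
    using subsetD[OF clopen_in_subset[OF U(1)] that] subsetD[OF U(3) that] \<delta>(2)[of c]
    by (auto simp: dist_commute)
  have compU: "compact U" using clopen_in_compact[OF compact_C U(1)] .
  define D where "D = {c \<in> U. t1 \<le> f c}"
  have "D = fst ` (?Z \<inter> U \<times> {t1..})"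
  proof
    show "D \<subseteq> fst ` (?Z \<inter> U \<times> {t1..})"
    proof
      fix c assume "c \<in> D"
      then have "(c, f c) \<in> ?Z \<inter> U \<times> {t1..}" using UC f_nonneg by (auto simp: D_def)
      then show "c \<in> fst ` (?Z \<inter> U \<times> {t1..})" by force
    qed
  qed (auto simp: D_def)
  moreover have "compact (?Z \<inter> U \<times> {t1..})"
    by (intro compact_Int_closed compact_hypograph closed_Times compact_imp_closed compU closed_atLeast)
  ultimately have compD: "compact D"
    using compact_continuous_image[OF continuous_on_fst[OF continuous_on_id]] by metis
  have DC: "c \<in> C" "t1 < f c" if "c \<in> D" for c
    using that UC[of c] \<delta>(1) by (auto simp: D_def)
  have c1D: "c1 \<in> D" using c1 U(2) by (simp add: D_def)
  \<comment> \<open>The gap \<open>\<delta>\<close> holds throughout \<open>U\<close>, so height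
    \<open>t1\<close> lies off the closure on every leg of \<open>D\<close>. Thus
    \<open>end_limit_above\<close> can be used on all of them with the same starting height.\<close>
  have t1_not: "\<Phi> (c, t1) \<notin> closure ends" if c: "c \<in> D" for c
  proof
    assume cl: "\<Phi> (c, t1) \<in> closure ends"
    have t1f: "t1 \<le> f c" using DC(2)[OF c] by simp
    obtain x where x: "\<And>n::nat. x n \<in> C" "\<And>n. 0 < f (x n)" "x \<longlonglongrightarrow> c" "(\<lambda>n. f (x n)) \<longlonglongrightarrow> t1"
      using closure_ends_coords[OF DC(1)[OF c] c1(2) t1f cl] by metis
    have "c \<in> U" "openin (top_of_set C) U" using c U(1) by (auto simp: D_def clopen_in_def)
    then have "\<forall>\<^sub>F n in sequentially. x n \<in> U" using openin_eventually x(1,3) by blast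
    then have "\<forall>\<^sub>F n in sequentially. x n \<in> U \<and> dist (f (x n)) t1 < \<delta>"
      using tendstoD[OF x(4) \<delta>(1)] by (rule eventually_conj)
    then obtain n where "x n \<in> U" "dist (f (x n)) t1 < \<delta>" using eventually_happens by force
    then show False using UC(2)[of "x n"] by (simp add: dist_real_def)
  qed
  define K where "K = ?Z \<inter> \<Phi> -` closure ends \<inter> D \<times> {t1..}"
  have "closed (?Z \<inter> \<Phi> -` closure ends)"
    using cont_\<Phi> by (intro continuous_closed_preimage compact_imp_closed[OF compact_hypograph] closed_closure)
  then have "compact (?Z \<inter> (?Z \<inter> \<Phi> -` closure ends))" by (intro compact_Int_closed compact_hypograph)
  then have "compact (?Z \<inter> \<Phi> -` closure ends)" by simp
  then have compK: "compact K"
    unfolding K_def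
    by (rule compact_Int_closed[OF _ closed_Times[OF compact_imp_closed[OF compD] closed_atLeast]])
  define \<eta> where "\<eta> = (\<lambda>n::nat. 1 / real (Suc n))"
  \<comment> \<open>Legs with a limit of ends at height at least \<open>t1\<close> and at least
    \<open>\<eta> n\<close> below the end, obtained as the projection of a compact set; quantifying
    over all such limits avoids naming the first one.\<close>
  define F where "F = (\<lambda>n. fst ` (K \<inter> (\<lambda>z. (fst z, snd z + \<eta> n)) -` ?Z))"
  have F_iff: "c \<in> F n \<longleftrightarrow> (\<exists>v. (c, v) \<in> K \<and> v + \<eta> n \<le> f c)" for c n
  proof
    assume "c \<in> F n"
    then show "\<exists>v. (c, v) \<in> K \<and> v + \<eta> n \<le> f c" by (force simp: F_def)
  next
    assume "\<exists>v. (c, v) \<in> K \<and> v + \<eta> n \<le> f c"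
    then obtain v where v: "(c, v) \<in> K" "v + \<eta> n \<le> f c" by blast
    have "(c, v) \<in> ?Z" using v by (simp add: K_def)
    then have "(c, v) \<in> K \<inter> (\<lambda>z. (fst z, snd z + \<eta> n)) -` ?Z" using v by (auto simp: \<eta>_def)
    then show "c \<in> F n" unfolding F_def by force
  qed
  have compF: "compact (F n)" for n
  proof -
    have "closed (K \<inter> (\<lambda>z. (fst z, snd z + \<eta> n)) -` ?Z)"
      by (intro continuous_closed_preimage compact_imp_closed[OF compK] compact_imp_closed[OF compact_hypograph]
          continuous_intros)
    then have "compact (K \<inter> (K \<inter> (\<lambda>z. (fst z, snd z + \<eta> n)) -` ?Z))" by (intro compact_Int_closed compK)
    then have "compact (K \<inter> (\<lambda>z. (fst z, snd z + \<eta> n)) -` ?Z)" by (simp add: Int_absorb)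
    then show ?thesis unfolding F_def
      by (intro compact_continuous_image continuous_on_fst continuous_on_id)
  qed
  have UF: "(\<Union>n. F n) = D"
  proof
    show "(\<Union>n. F n) \<subseteq> D" by (auto simp: F_def K_def)
    show "D \<subseteq> (\<Union>n. F n)"
    proof
      fix c assume c: "c \<in> D"
      obtain v where v: "t1 < v" "v < f c" "\<Phi> (c, v) \<in> closure ends"
        using end_limit_above[OF ends L N ne DC(1)[OF c] c1(2) DC(2)[OF c] t1_not[OF c]] by blast
      obtain n :: nat where n: "1 / Suc n < f c - v" using nat_approx_posE[of "f c - v"] v by auto
      have "(c, v) \<in> K" using v c DC[OF c] c1(2) by (simp add: K_def)
      moreover have "v + \<eta> n \<le> f c" using n by (simp add: \<eta>_def)
      ultimately show "c \<in> (\<Union>n. F n)" using F_iff by blast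
    qed
  qed
  obtain n W where W: "open W" "W \<inter> D \<noteq> {}" "W \<inter> D \<subseteq> F n"
    by (rule compact_covered_interior[OF compD _ compF UF]) (use c1D in auto)
  obtain c where c: "c \<in> W" "c \<in> D" using W(2) by blast
  define Kc where "Kc = snd ` (K \<inter> {c} \<times> UNIV)"
  have Kc: "v \<in> Kc \<longleftrightarrow> (c, v) \<in> K" for v by (force simp: Kc_def)
  have "compact Kc"
    unfolding Kc_def
    by (intro compact_continuous_image continuous_on_snd continuous_on_id compact_Int_closed compK
        closed_Times closed_UNIV closed_singleton)
  moreover obtain v1 where "(c, v1) \<in> K" using c W(3) F_iff by blast
  then have "Kc \<noteq> {}" using Kc by blast
  ultimately obtain a where a: "a \<in> Kc" "\<And>v. v \<in> Kc \<Longrightarrow> a \<le> v"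
    using compact_attains_inf[of Kc] by blast
  \<comment> \<open>\<open>a\<close> is the first limit of ends at height at least \<open>t1\<close>
    on the leg over \<open>c\<close>, and it exists by compactness.\<close>
  have aK: "(c, a) \<in> ?Z" "\<Phi> (c, a) \<in> closure ends" "t1 \<le> a" using a(1) Kc by (auto simp: K_def)
  have "a \<noteq> t1" using aK(2) t1_not[OF c(2)] by auto
  then have at1: "t1 < a" using aK(3) by simp
  have a0: "0 < a" "a \<le> f c" using at1 c1(2) aK(1) by simp_all
  obtain x where x: "\<And>n::nat. x n \<in> C" "\<And>n. 0 < f (x n)" "x \<longlonglongrightarrow> c" "(\<lambda>n. f (x n)) \<longlonglongrightarrow> a"
    using closure_ends_coords[OF DC(1)[OF c(2)] a0 aK(2)] by metis
  have "c \<in> U" "openin (top_of_set C) U" using c U(1) by (auto simp: D_def clopen_in_def)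
  then have evU: "\<forall>\<^sub>F i in sequentially. x i \<in> U" using openin_eventually x(1,3) by blast
  have evW: "\<forall>\<^sub>F i in sequentially. x i \<in> W" using x(3) W(1) c(1) by (rule topological_tendstoD)
  \<comment> \<open>Since \<open>a\<close> lies strictly above \<open>t1\<close>, the legs whose
    ends converge to it eventually belong to \<open>D\<close>, hence to the Baire
    neighbourhood.\<close>
  have evt: "\<forall>\<^sub>F i in sequentially. t1 < f (x i)" using x(4) at1 by (rule order_tendstoD)
  have "\<forall>\<^sub>F i in sequentially. x i \<in> F n"
    using evU evW evt
  proof eventually_elim
    case (elim i)
    then have "x i \<in> W \<inter> D" by (simp add: D_def)
    then show ?case using W(3) by blast
  qed
  then obtain i0 where i0: "\<And>i. i \<ge> i0 \<Longrightarrow> x i \<in> F n" by (auto simp: eventually_sequentially)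
  have "\<exists>v. (x (i + i0), v) \<in> K \<and> v + \<eta> n \<le> f (x (i + i0))" for i
    using i0[of "i + i0"] F_iff by simp
  then obtain v where v: "\<And>i. (x (i + i0), v i) \<in> K" "\<And>i. v i + \<eta> n \<le> f (x (i + i0))" by metis
  obtain w s where ws: "w \<in> K" "strict_mono s" "((\<lambda>i. (x (i + i0), v i)) \<circ> s) \<longlonglongrightarrow> w"
    using compK v(1) unfolding compact_eq_seq_compact_metric by (metis (no_types, lifting) seq_compactE)
  have w12: "(\<lambda>i. x (s i + i0)) \<longlonglongrightarrow> fst w" "(\<lambda>i. v (s i)) \<longlonglongrightarrow> snd w"
    using tendsto_fst[OF ws(3)] tendsto_snd[OF ws(3)] by (auto simp: o_def)
  have xs: "(\<lambda>i. x (s i + i0)) \<longlonglongrightarrow> c" "(\<lambda>i. f (x (s i + i0))) \<longlonglongrightarrow> a"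
    using LIMSEQ_subseq_LIMSEQ[OF LIMSEQ_ignore_initial_segment[OF x(3), of i0] ws(2)]
      LIMSEQ_subseq_LIMSEQ[OF LIMSEQ_ignore_initial_segment[OF x(4), of i0] ws(2)] by (auto simp: o_def)
  have "fst w = c" using LIMSEQ_unique[OF w12(1) xs(1)] .
  then have "snd w \<in> Kc" using Kc ws(1) by (metis prod.collapse)
  then have "a \<le> snd w" using a(2) by blast
  \<comment> \<open>The ends of these legs tend to height \<open>a\<close>, so the uniform gap puts
    the limit \<open>w\<close> below the supposed minimum.\<close>
  moreover have "snd w + \<eta> n \<le> a"
    using LIMSEQ_le[OF tendsto_add[OF w12(2) tendsto_const] xs(2)] v(2) by blast
  moreover have "0 < \<eta> n" by (simp add: \<eta>_def)
  ultimately show False by linarith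
qed

lemma not_quarter_homogeneous: "\<not> one_over_homogeneous 4 X"
proof
  assume four: "one_over_homogeneous 4 X"
  obtain x0 y0 where xy: "x0 \<in> interior_points" "y0 \<in> interior_points" "\<not> same_orbit X x0 y0"
    and two: "\<And>z. z \<in> interior_points \<Longrightarrow> same_orbit X x0 z \<or> same_orbit X y0 z"
    and ends: "\<And>e e'. e \<in> ends \<Longrightarrow> e' \<in> ends \<Longrightarrow> same_orbit X e e'"
    using four_orbits[OF four] by metis
  have inX: "z \<in> X" if "z \<in> interior_points" for z using that by (simp add: interior_points_def)
  have X: "x0 \<in> X" "y0 \<in> X" using xy inX by blast+
  consider "interior_points \<inter> closure ends = {}" | "interior_points \<subseteq> closure ends"
    | "interior_points \<inter> closure ends \<noteq> {}" "interior_points - closure ends \<noteq> {}" by blast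
  then show False
  proof cases
    case 1
    then have iso: "closure ends \<inter> interior_points = {}" by (simp add: Int_commute)
    obtain c where c: "c \<in> C" "0 < f c" by (rule positive_leg)
    show False
      by (rule two_orbits_on_leg[OF four c isolated_ends_same_orbit[OF iso c(1)]])
  next
    case 2
    obtain d where d: "d \<in> C" "0 < f d" by (rule positive_leg)
    then have "C \<noteq> {}" by blast
    then obtain c where c: "peak f C c" using peak_exists[OF clopen_in_self] by blast
    have c': "c \<in> C" "0 < f c" using c peak_pos[OF clopen_in_self c] by (auto simp: peak_def)
    show False
      by (rule two_orbits_on_leg[OF four c' dense_ends_same_orbit[OF 2 c]])
  next
    case 3
    have cl_same: "same_orbit X x0 z \<or> same_orbit X y0 z" "z \<in> X" if "z \<in> interior_points" for z
      using two[OF that] inX[OF that] by auto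
    \<comment> \<open>Membership in the closure is constant on each of the two interior orbits. As
      both kinds of interior point occur, the orbits are exactly the two kinds.\<close>
    have x0y0: "x0 \<in> closure ends \<longleftrightarrow> y0 \<notin> closure ends"
      using 3 two same_orbit_closure_ends X by blast
    have link: "same_orbit X x y" if "x \<in> interior_points" "y \<in> interior_points" "x \<in> closure ends \<longleftrightarrow> y \<in> closure ends" for x y
    proof -
      have "(same_orbit X x0 x \<and> same_orbit X x0 y) \<or> (same_orbit X y0 x \<and> same_orbit X y0 y)"
        using two[OF that(1)] two[OF that(2)] that(3) x0y0 same_orbit_closure_ends X by blast
      then show ?thesis using same_orbit_sym[OF X(1)] same_orbit_sym[OF X(2)] same_orbit_trans by blast
    qed
    show False
      by (rule not_two_kinds[OF ends _ _ 3]) (use link in auto)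
  qed
qed

end

theorem theorem4p1:
  shows "\<not> (\<exists>X :: 'a::metric_space set. fan X \<and> smooth X \<and> one_over_homogeneous 4 X)"
proof
  assume "\<exists>X :: 'a::metric_space set. fan X \<and> smooth X \<and> one_over_homogeneous 4 X"
  then obtain X :: "'a set" where X: "fan X" "smooth X" "one_over_homogeneous 4 X" by blast
  obtain T where T: "ramification_point X T" "\<And>p. ramification_point X p \<Longrightarrow> p = T"
    using X(1) unfolding fan_def by blast
  have d: "dendroid X" using X(1) unfolding fan_def by blast
  interpret fan_set X T
    by unfold_locales (fact d T)+
  obtain p where "p \<in> X" "arcs_usc p" using smooth_imp_arcs_usc[OF X(2)] .
  then interpret smooth_fan X T
    by unfold_locales (rule arcs_usc_T)
  show False
  proof (rule height_function)
    fix h :: "'a \<Rightarrow> real"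
    assume h: "continuous_on X h" "h T = 0"
      "\<And>x y. y \<in> X \<Longrightarrow> x \<in> seg T y \<Longrightarrow> x \<noteq> y \<Longrightarrow> h x < h y"
    interpret smooth_fan_height X T h
      by unfold_locales (fact h)+
    obtain C f \<Phi> where "fan_coordinates X T (C :: (nat \<Rightarrow> real) set) f \<Phi>" by (rule coordinates)
    then interpret fan_coordinates X T C f \<Phi> .
    show False using not_quarter_homogeneous X(3) by blast
  qed
qed

end
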